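(* Let $\mathbf c$ be a cost function such that $\mathbf c\to\mathbf c_\Omega$. Then there is a computably enumerable set $A$ that is smart for $\mathbf c$.
   Context: Cost functions: computable $\mathbf c:\mathbb N\times\mathbb N\to[0,\infty)$, monotonic ($\mathbf c(x,s)\le\mathbf c(x,s+1)$, $\mathbf c(x+1,s)\le\mathbf c(x,s)$), with the limit condition ($\underline{\mathbf c}(x)=\lim_s\mathbf c(x,s)$ exists and $\lim_x\underline{\mathbf c}(x)=0$), and $\mathbf c(x,s)=0$ for $x\ge s$. For a computable approximation $\langle A_s\rangle$ of a $\Delta^0_2$ set $A$, its total $\mathbf c$-cost is $\sum_s\mathbf c(x_s,s)$, summed over stages $s$ where $A_{s-1}\ne A_s$, with $x_s$ least such that $A_{s-1}(x_s)\ne A_s(x_s)$; $A$ obeys $\mathbf c$ ($A\models\mathbf c$) if some computable approximation of $A$ has finite total $\mathbf c$-cost. $\mathbf c\to\mathbf d$ means every $\Delta^0_2$ set obeying $\mathbf c$ obeys $\mathbf d$ (equivalently $\underline{\mathbf d}\le C\,\underline{\mathbf c}$ for some constant $C$). $\Omega$ is a fixed left-c.e. ML-random real with a computable increasing sequence of rationals $\Omega_s\to\Omega$, and $\mathbf c_\Omega(x,s)=\Omega_s-\Omega_x$; a set obeys $\mathbf c_\Omega$ iff it is $K$-trivial. A $\mathbf c$-bounded test is a nested sequence $\langle V_n\rangle$ of uniformly c.e. open sets with $\mu(V_n)\le C\,\underline{\mathbf c}(n)$ for a constant $C$; it captures the elements of $\bigcap_nV_n$. A $K$-trivial set $A$ is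 smart for $\mathbf c$ if $A\models\mathbf c$ and for every ML-random $Y$: $Y$ is captured by some $\mathbf c$-bounded test iff $A\le_{\mathrm T}Y$. *)

theory Defs
  imports Complex_Main "HOL-Library.Nat_Bijection"
begin

datatype recf = Zero | Succ | Proj nat | Comp recf "recf list" | Prec recf recf | Mn recf | Oracle

inductive ev :: "(nat \<Rightarrow> bool) \<Rightarrow> recf \<Rightarrow> nat list \<Rightarrow> nat \<Rightarrow> bool" for orc where
  ev_zero: "ev orc Zero xs 0"
| ev_succ: "ev orc Succ (x # xs) (Suc x)"
| ev_proj: "i < length xs \<Longrightarrow> ev orc (Proj i) xs (xs ! i)"
| ev_comp: "list_all2 (\<lambda>g y. ev orc g xs y) gs ys \<Longrightarrow> ev orc f ys z \<Longrightarrow> ev orc (Comp f gs) xs z"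
| ev_prec0: "ev orc f xs z \<Longrightarrow> ev orc (Prec f g) (0 # xs) z"
| ev_precS: "ev orc (Prec f g) (n # xs) r \<Longrightarrow> ev orc g (n # r # xs) z \<Longrightarrow> ev orc (Prec f g) (Suc n # xs) z"
| ev_mn: "ev orc f (y # xs) 0 \<Longrightarrow> (\<forall>z<y. \<exists>v. 0 < v \<and> ev orc f (z # xs) v) \<Longrightarrow> ev orc (Mn f) xs y"
| ev_oracle: "ev orc Oracle (x # xs) (if orc x then 1 else 0)"

definition no_oracle :: "nat \<Rightarrow> bool" where "no_oracle = (\<lambda>_. False)"

definition computable1 :: "(nat \<Rightarrow> nat) \<Rightarrow> bool" where
  "computable1 f \<longleftrightarrow> (\<exists>t. \<forall>x. ev no_oracle t [x] (f x))"

definition computable2 :: "(nat \<Rightarrow> nat \<Rightarrow> nat) \<Rightarrow> bool" where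
  "computable2 f \<longleftrightarrow> (\<exists>t. \<forall>x y. ev no_oracle t [x, y] (f x y))"

definition computable3 :: "(nat \<Rightarrow> nat \<Rightarrow> nat \<Rightarrow> nat) \<Rightarrow> bool" where
  "computable3 f \<longleftrightarrow> (\<exists>t. \<forall>x y z. ev no_oracle t [x, y, z] (f x y z))"

definition ce_set :: "nat set \<Rightarrow> bool" where
  "ce_set A \<longleftrightarrow> (\<exists>t. \<forall>x. x \<in> A \<longleftrightarrow> (\<exists>y. ev no_oracle t [x] y))"

definition ce_rel2 :: "(nat \<Rightarrow> nat \<Rightarrow> bool) \<Rightarrow> bool" where
  "ce_rel2 R \<longleftrightarrow> (\<exists>t. \<forall>x y. R x y \<longleftrightarrow> (\<exists>v. ev no_oracle t [x, y] v))"

definition turing_le :: "nat set \<Rightarrow> (nat \<Rightarrow> bool) \<Rightarrow> bool" where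
  "turing_le A Y \<longleftrightarrow> (\<exists>t. \<forall>x. ev Y t [x] (if x \<in> A then 1 else 0))"

text \<open>Bijective coding of binary strings by natural numbers.\<close>
primrec str_code :: "bool list \<Rightarrow> nat" where
  "str_code [] = 0"
| "str_code (b # \<sigma>) = 2 * str_code \<sigma> + (if b then 2 else 1)"

definition rat_of_code :: "nat \<Rightarrow> real" where
  "rat_of_code k = (case prod_decode k of (p, q) \<Rightarrow> real_of_int (int_decode p) / real (Suc q))"

definition computable_real2 :: "(nat \<Rightarrow> nat \<Rightarrow> real) \<Rightarrow> bool" where
  "computable_real2 c \<longleftrightarrow> (\<exists>g. computable3 g \<and>
      (\<forall>x s n. \<bar>rat_of_code (g x s n) - c x s\<bar> \<le> (1/2) ^ n))"

definition computable_rat_seq :: "(nat \<Rightarrow> real) \<Rightarrow> bool" where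
  "computable_rat_seq q \<longleftrightarrow> (\<exists>h. computable1 h \<and> (\<forall>s. q s = rat_of_code (h s)))"

definition extends :: "(nat \<Rightarrow> bool) \<Rightarrow> bool list \<Rightarrow> bool" where
  "extends Y \<sigma> \<longleftrightarrow> (\<forall>i < length \<sigma>. Y i = \<sigma> ! i)"

definition open_gen :: "(bool list \<Rightarrow> bool) \<Rightarrow> (nat \<Rightarrow> bool) set" where
  "open_gen W = {Y. \<exists>\<sigma>. W \<sigma> \<and> extends Y \<sigma>}"

text \<open>Uniform (Lebesgue) measure of the open set generated by W.\<close>
definition mu_open :: "(bool list \<Rightarrow> bool) \<Rightarrow> real" where
  "mu_open W = (SUP n. real (card {\<sigma>::bool list. length \<sigma> = n \<and>
       (\<exists>\<tau>. W \<tau> \<and> length \<tau> \<le> n \<and> take (length \<tau>) \<sigma> = \<tau>)}) / 2 ^ n)"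

definition unif_ce :: "(nat \<Rightarrow> bool list \<Rightarrow> bool) \<Rightarrow> bool" where
  "unif_ce W \<longleftrightarrow> (\<exists>R. ce_rel2 R \<and> (\<forall>n \<sigma>. W n \<sigma> \<longleftrightarrow> R n (str_code \<sigma>)))"

definition mlr_test :: "(nat \<Rightarrow> bool list \<Rightarrow> bool) \<Rightarrow> bool" where
  "mlr_test W \<longleftrightarrow> unif_ce W \<and> (\<forall>n. mu_open (W n) \<le> (1/2) ^ n)"

definition mlr_random :: "(nat \<Rightarrow> bool) \<Rightarrow> bool" where
  "mlr_random Y \<longleftrightarrow> (\<forall>W. mlr_test W \<longrightarrow> \<not> (\<forall>n. Y \<in> open_gen (W n)))"

text \<open>Binary expansion of a real in (0,1): digit n is the (n+1)-th binary digit.\<close>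
definition bin_expansion :: "real \<Rightarrow> nat \<Rightarrow> bool" where
  "bin_expansion r n = odd (\<lfloor>r * 2 ^ (Suc n)\<rfloor>)"

definition cost_function :: "(nat \<Rightarrow> nat \<Rightarrow> real) \<Rightarrow> bool" where
  "cost_function c \<longleftrightarrow> computable_real2 c
    \<and> (\<forall>x s. 0 \<le> c x s)
    \<and> (\<forall>x s. c x s \<le> c x (Suc s))
    \<and> (\<forall>x s. c (Suc x) s \<le> c x s)
    \<and> (\<forall>x. convergent (\<lambda>s. c x s))
    \<and> (\<lambda>x. lim (\<lambda>s. c x s)) \<longlonglongrightarrow> 0
    \<and> (\<forall>x s. s \<le> x \<longrightarrow> c x s = 0)"

definition limit_cost :: "(nat \<Rightarrow> nat \<Rightarrow> real) \<Rightarrow> nat \<Rightarrow> real" where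
  "limit_cost c x = lim (\<lambda>s. c x s)"

definition computable_approx :: "(nat \<Rightarrow> nat \<Rightarrow> bool) \<Rightarrow> nat set \<Rightarrow> bool" where
  "computable_approx As A \<longleftrightarrow> computable2 (\<lambda>s x. if As s x then 1 else 0)
     \<and> (\<forall>x. \<exists>s0. \<forall>s\<ge>s0. As s x = (x \<in> A))"

definition cost_term :: "(nat \<Rightarrow> nat \<Rightarrow> real) \<Rightarrow> (nat \<Rightarrow> nat \<Rightarrow> bool) \<Rightarrow> nat \<Rightarrow> real" where
  "cost_term c As s = (if 0 < s \<and> As (s - 1) \<noteq> As s
      then c (LEAST x. As (s - 1) x \<noteq> As s x) s else 0)"

definition obeys :: "nat set \<Rightarrow> (nat \<Rightarrow> nat \<Rightarrow> real) \<Rightarrow> bool" where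
  "obeys A c \<longleftrightarrow> (\<exists>As. computable_approx As A \<and> summable (cost_term c As))"

definition cost_implies :: "(nat \<Rightarrow> nat \<Rightarrow> real) \<Rightarrow> (nat \<Rightarrow> nat \<Rightarrow> real) \<Rightarrow> bool" where
  "cost_implies c d \<longleftrightarrow> (\<forall>A. obeys A c \<longrightarrow> obeys A d)"

definition c_Omega :: "(nat \<Rightarrow> real) \<Rightarrow> nat \<Rightarrow> nat \<Rightarrow> real" where
  "c_Omega Om x s = (if x < s then Om s - Om x else 0)"

definition bounded_test :: "(nat \<Rightarrow> nat \<Rightarrow> real) \<Rightarrow> (nat \<Rightarrow> bool list \<Rightarrow> bool) \<Rightarrow> bool" where
  "bounded_test c V \<longleftrightarrow> unif_ce V
     \<and> (\<forall>n. open_gen (V (Suc n)) \<subseteq> open_gen (V n))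
     \<and> (\<exists>C. \<forall>n. mu_open (V n) \<le> C * limit_cost c n)"

definition captured :: "(nat \<Rightarrow> nat \<Rightarrow> real) \<Rightarrow> (nat \<Rightarrow> bool) \<Rightarrow> bool" where
  "captured c Y \<longleftrightarrow> (\<exists>V. bounded_test c V \<and> (\<forall>n. Y \<in> open_gen (V n)))"

definition smart_for :: "(nat \<Rightarrow> real) \<Rightarrow> (nat \<Rightarrow> nat \<Rightarrow> real) \<Rightarrow> nat set \<Rightarrow> bool" where
  "smart_for Om c A \<longleftrightarrow> obeys A (c_Omega Om) \<and> obeys A c
     \<and> (\<forall>Y. mlr_random Y \<longrightarrow> (captured c Y \<longleftrightarrow> turing_le A Y))"

end

theory Submission
  imports Defs
begin

text \<open>
  If \<open>A\<close> obeys \<open>c\<close> with a given approximation and \<open>V\<close> is a \<open>c\<close>-bounded test, then enumerating, at each stage \<open>s\<close> where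
  \<open>A\<close> changes with least change \<open>x\<close>, the part of \<open>V x\<close> whose measure is paid for by \<open>c x s\<close>, gives a Solovay test. A random
  set captured by \<open>V\<close> lies in finitely many of its components only, so it knows when \<open>A\<close> has settled below \<open>x\<close>.

  For the converse, \<open>A\<close> is built together with tests \<open>V e\<close>, where \<open>V e n\<close> collects from stage \<open>n\<close> on the oracles whose \<open>e\<close>-th
  computation agrees with \<open>A\<close> up to a marker. When too many agree, the marker is put into \<open>A\<close> and they become errors; since
  the errors have bounded measure, \<open>A\<close> obeys \<open>c\<close>. The measure of \<open>V e n\<close> is at most a multiple of the limit cost of \<open>n\<close> plus
  the measure of the errors that appear after stage \<open>n\<close>. The latter is the tail of a left-c.e. real, hence at most a
  multiple of \<open>\<Omega> - \<Omega>\<^sub>n\<close> because \<open>\<Omega>\<close> is random, and this is at most a multiple of the limit cost of \<open>n\<close> because \<open>c\<close> implies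
  \<open>c_Omega\<close>.
\<close>

section \<open>Computable functions between encoded types\<close>

text \<open>\<open>cost_implies\<close> speaks of sets, whereas the test bound needs an inequality
  between limits. It is extracted by contraposition: if no constant works, a finite injury
  construction gives a set that obeys \<open>c\<close> but not \<open>c_Omega\<close>. The bound on
  tails of left-c.e. reals is the Kucera-Slaman theorem. It also shows that \<Omega> lies strictly
  above its approximations, so that every limit cost of \<open>c\<close> is positive. Both
  directions of smartness rest on this positivity: a lower approximation of a large multiple of the
  cost eventually exceeds the measure of a test component, and each marker moves only finitely
  often. Order between computable reals is undecidable, so the constructions compare naturals,
  obtained by clearing powers of 2 and allowing for a bounded error.\<close>

inductive_cases ev_ZeroE: "ev Y Zero xs y"
inductive_cases ev_SuccE: "ev Y Succ xs y"
inductive_cases ev_ProjE: "ev Y (Proj i) xs y"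
inductive_cases ev_CompE: "ev Y (Comp f gs) xs y"
inductive_cases ev_Prec0E: "ev Y (Prec f g) (0 # xs) y"
inductive_cases ev_PrecSE: "ev Y (Prec f g) (Suc n # xs) y"
inductive_cases ev_MnE: "ev Y (Mn f) xs y"
inductive_cases ev_OracleE: "ev Y Oracle xs y"

lemma ev_det: "ev Y t xs y \<Longrightarrow> ev Y t xs z \<Longrightarrow> y = z"
proof (induction arbitrary: z rule: ev.induct)
  case (ev_zero xs) then show ?case by (rule ev_ZeroE) simp
next
  case (ev_succ x xs) then show ?case by (rule ev_SuccE) simp
next
  case (ev_proj i xs) show ?case using ev_proj.prems by (rule ev_ProjE) simp
next
  case (ev_comp xs gs ys f w)
  from ev_comp.prems obtain ys' where a: "list_all2 (\<lambda>g y. ev Y g xs y) gs ys'" and b: "ev Y f ys' z"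
    by (rule ev_CompE) (rule that)
  have "ys = ys'"
  proof (rule nth_equalityI)
    show "length ys = length ys'"
      using list_all2_lengthD[OF ev_comp.IH(1)] list_all2_lengthD[OF a] by simp
    fix i assume i: "i < length ys"
    then have "i < length gs" using list_all2_lengthD[OF ev_comp.IH(1)] by simp
    then have "ev Y (gs ! i) xs (ys' ! i)" "\<And>z. ev Y (gs ! i) xs z \<Longrightarrow> ys ! i = z"
      using list_all2_nthD[OF a] list_all2_nthD[OF ev_comp.IH(1)] by blast+
    then show "ys ! i = ys' ! i" by blast
  qed
  then show ?case using ev_comp.IH(2) b by metis
next
  case (ev_prec0 f xs w g)
  from ev_prec0.prems have "ev Y f xs z" by (rule ev_Prec0E)
  then show ?case by (rule ev_prec0.IH)
next
  case (ev_precS f g n xs r w)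
  from ev_precS.prems obtain r' where "ev Y (Prec f g) (n # xs) r'" "ev Y g (n # r' # xs) z"
    by (rule ev_PrecSE)
  then show ?case using ev_precS.IH by metis
next
  case (ev_mn f y xs)
  have 1: "ev Y f (z # xs) 0" using ev_mn.prems by (rule ev_MnE)
  have 2: "\<forall>u<z. \<exists>v. 0 < v \<and> ev Y f (u # xs) v" using ev_mn.prems by (rule ev_MnE)
  show ?case
  proof (rule linorder_cases[of y z])
    assume "y < z" then show ?thesis using 2 ev_mn.IH(1) by (metis less_irrefl)
  next
    assume "z < y" then show ?thesis using 1 ev_mn.IH(2) by (metis less_irrefl)
  qed simp
next
  case (ev_oracle x xs) then show ?case by (rule ev_OracleE) simp
qed

text \<open>The empty oracle answers every query with 0, so replacing \<open>Oracle\<close> by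
  \<open>Zero\<close> preserves such computations; computability without oracle thus passes to every
  oracle.\<close>

primrec drop_oracle :: "recf \<Rightarrow> recf" where
  "drop_oracle Zero = Zero"
| "drop_oracle Succ = Succ"
| "drop_oracle (Proj i) = Proj i"
| "drop_oracle (Comp f gs) = Comp (drop_oracle f) (map drop_oracle gs)"
| "drop_oracle (Prec f g) = Prec (drop_oracle f) (drop_oracle g)"
| "drop_oracle (Mn f) = Mn (drop_oracle f)"
| "drop_oracle Oracle = Zero"

lemma ev_drop_oracle: "ev no_oracle t xs y \<Longrightarrow> ev Y (drop_oracle t) xs y"
proof (induction rule: ev.induct)
  case (ev_zero xs) show ?case by (simp add: ev.ev_zero)
next
  case (ev_succ x xs) show ?case by (simp add: ev.ev_succ)
next
  case (ev_proj i xs) then show ?case by (simp add: ev.ev_proj)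
next
  case (ev_comp xs gs ys f z)
  have "list_all2 (\<lambda>g y. ev Y g xs y) (map drop_oracle gs) ys"
    using ev_comp.IH(1) by (simp add: list_all2_conv_all_nth)
  then show ?case using ev_comp.IH(2) by (simp add: ev.ev_comp)
next
  case (ev_prec0 f xs z g) then show ?case by (simp add: ev.ev_prec0)
next
  case (ev_precS f g n xs r z) then show ?case by (simp add: ev.ev_precS)
next
  case (ev_mn f y xs)
  have "\<forall>z<y. \<exists>v. 0 < v \<and> ev Y (drop_oracle f) (z # xs) v" using ev_mn.IH(2) by blast
  then show ?case using ev_mn.IH(1) by (simp add: ev.ev_mn)
next
  case (ev_oracle x xs) show ?case by (simp add: no_oracle_def ev.ev_zero)
qed

section \<open>Encodings of data types by natural numbers\<close>

class enc =
  fixes code :: "'a \<Rightarrow> nat"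
  assumes code_inj: "code x = code y \<Longrightarrow> x = y"

text \<open>Surjectivity makes \<open>decode\<close> act as the identity on codes, so decoding is
  computable at no cost.\<close>

class enc_bij = enc +
  assumes code_surj: "\<exists>x. code x = n"

lemma code_eq_iff [simp]: "code x = code y \<longleftrightarrow> x = (y :: 'a::enc)"
  using code_inj by auto

definition decode :: "nat \<Rightarrow> 'a::enc_bij" where
  "decode n = (SOME x. code x = n)"

lemma code_decode [simp]: "code (decode n) = n"
  unfolding decode_def using someI_ex[OF code_surj] by auto

lemma decode_code [simp]: "decode (code x) = x"
  by (rule code_inj) simp

instantiation nat :: enc_bij begin
definition code_nat :: "nat \<Rightarrow> nat" where [simp]: "code_nat n = n"
instance by standard auto
end

instantiation bool :: enc begin
definition code_bool :: "bool \<Rightarrow> nat" where "code_bool b = (if b then 1 else 0)"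
instance by standard (auto simp: code_bool_def split: if_splits)
end

instantiation prod :: (enc, enc) enc begin
definition code_prod :: "'a \<times> 'b \<Rightarrow> nat" where "code_prod p = prod_encode (code (fst p), code (snd p))"
instance by standard (simp add: code_prod_def prod_eq_iff)
end

instance prod :: (enc_bij, enc_bij) enc_bij
proof
  fix n
  have "code (decode (fst (prod_decode n)) :: 'a, decode (snd (prod_decode n)) :: 'b) = n"
    by (simp add: code_prod_def)
  then show "\<exists>x :: 'a \<times> 'b. code x = n" by blast
qed

instantiation list :: (enc) enc begin
definition code_list :: "'a list \<Rightarrow> nat" where "code_list xs = list_encode (map code xs)"
instance
proof
  fix x y :: "'a list"
  assume "code x = code y"
  then have "map code x = map code y" by (simp add: code_list_def list_encode_eq)
  moreover have "inj (code :: 'a \<Rightarrow> nat)" by (rule injI) (rule code_inj)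
  ultimately show "x = y" using map_injective by blast
qed
end

instance list :: (enc_bij) enc_bij
proof
  fix n
  have "code (map decode (list_decode n) :: 'a list) = n"
    by (simp add: code_list_def o_def)
  then show "\<exists>x :: 'a list. code x = n" by blast
qed

text \<open>Built to be bijective: three codes for the constructors without argument, then the
  residue modulo 4 selects one of the other four. Every natural number is thus a program, and
  \<open>decode\<close> enumerates all of them.\<close>

fun rcode :: "recf \<Rightarrow> nat" where
  "rcode Zero = 0"
| "rcode Succ = 1"
| "rcode Oracle = 2"
| "rcode (Proj n) = 3 + 4 * n"
| "rcode (Comp f gs) = 4 + 4 * prod_encode (rcode f, list_encode (map rcode gs))"
| "rcode (Prec f g) = 5 + 4 * prod_encode (rcode f, rcode g)"
| "rcode (Mn f) = 6 + 4 * rcode f"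

lemma list_encode_mem: "x \<in> set xs \<Longrightarrow> x \<le> list_encode xs"
proof (induction xs)
  case (Cons a xs)
  then show ?case
    using le_prod_encode_1[of a "list_encode xs"] le_prod_encode_2[of "list_encode xs" a]
    by (auto intro: le_SucI)
qed simp

lemma rcode_inj: "rcode t = rcode u \<Longrightarrow> t = u"
proof (induction t arbitrary: u)
  case (Comp f gs)
  have "\<exists>f' gs'. u = Comp f' gs'"
    using Comp.prems by (cases u) (simp_all, presburger+)
  then obtain f' gs' where u: "u = Comp f' gs'" by blast
  with Comp.prems have e: "rcode f = rcode f'" "map rcode gs = map rcode gs'"
    by (auto simp: list_encode_eq)
  have "gs = gs'"
    using e(2) Comp.IH(2) by (metis (no_types, lifting) length_map nth_equalityI nth_map nth_mem)
  with u e(1) Comp.IH(1) show ?case by auto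
next
  case (Prec f g)
  have "\<exists>f' g'. u = Prec f' g'"
    using Prec.prems by (cases u) (simp_all, presburger+)
  with Prec show ?case by auto
next
  case (Mn f)
  have "\<exists>f'. u = Mn f'"
    using Mn.prems by (cases u) (simp_all, presburger+)
  with Mn show ?case by auto
next
  case (Proj n)
  then show ?case by (cases u) (simp_all, presburger+)
next
  case Zero then show ?case by (cases u) simp_all
next
  case Succ then show ?case by (cases u) simp_all
next
  case Oracle then show ?case by (cases u) simp_all
qed

lemma rcode_surj: "\<exists>t. rcode t = n"
proof (induction n rule: less_induct)
  case (less n)
  consider "n < 3" | k where "n = 3 + 4 * k" | k where "n = 4 + 4 * k" | k where "n = 5 + 4 * k"
    | k where "n = 6 + 4 * k"
  proof -
    have "n < 3 \<or> n = 3 + 4 * ((n - 3) div 4) \<or> n = 4 + 4 * ((n - 3) div 4)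
       \<or> n = 5 + 4 * ((n - 3) div 4) \<or> n = 6 + 4 * ((n - 3) div 4)" by presburger
    then show ?thesis using that by blast
  qed
  then show ?case
  proof cases
    case 1
    then have "n = rcode Zero \<or> n = rcode Succ \<or> n = rcode Oracle" by auto
    then show ?thesis by metis
  next
    case (2 k) then show ?thesis by (metis rcode.simps(4))
  next
    case (3 k)
    obtain a b where ab: "k = prod_encode (a, b)" by (metis prod_decode_inverse surj_pair)
    have ale: "a \<le> k" "b \<le> k" using ab le_prod_encode_1 le_prod_encode_2 by auto
    obtain f where f: "rcode f = a" using less[of a] ale(1) 3 by auto
    have "\<forall>x\<in>set (list_decode b). \<exists>t. rcode t = x"
    proof
      fix x assume "x \<in> set (list_decode b)"
      then have "x \<le> b" using list_encode_mem[of x "list_decode b"] by simp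
      then show "\<exists>t. rcode t = x" using less 3 ale(2) by simp
    qed
    then obtain h where h: "\<forall>x\<in>set (list_decode b). rcode (h x) = x" by metis
    have "map rcode (map h (list_decode b)) = list_decode b"
      using h by (simp add: map_idI)
    then have "rcode (Comp f (map h (list_decode b))) = n"
      using 3 ab f by (simp only: rcode.simps list_decode_inverse)
    then show ?thesis by blast
  next
    case (4 k)
    obtain a b where ab: "k = prod_encode (a, b)" by (metis prod_decode_inverse surj_pair)
    have ale: "a \<le> k" "b \<le> k" using ab le_prod_encode_1 le_prod_encode_2 by auto
    have "a < n" "b < n" using ale 4 by auto
    then obtain f g where "rcode f = a" "rcode g = b" using less by metis
    then have "rcode (Prec f g) = n" using 4 ab by simp
    then show ?thesis by blast
  next
    case (5 k)
    have "k < n" using 5 by auto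
    then obtain f where "rcode f = k" using less by metis
    then have "rcode (Mn f) = n" using 5 by simp
    then show ?thesis by blast
  qed
qed

instantiation recf :: enc_bij begin
definition code_recf :: "recf \<Rightarrow> nat" where "code_recf = rcode"
instance by standard (simp_all add: code_recf_def rcode_inj rcode_surj)
end

text \<open>All rules in \<open>cpt_intros\<close> conclude \<open>cpt Y (\<lambda>x. F (f x) (g x))\<close> from the computability of the arguments, so that
  \<open>intro cpt_intros\<close> follows the structure of the term; under a binder, the bound variable is paired with \<open>x\<close>.\<close>
definition cpt :: "(nat \<Rightarrow> bool) \<Rightarrow> ('a::enc \<Rightarrow> 'b::enc) \<Rightarrow> bool" where
  "cpt Y f \<longleftrightarrow> (\<exists>t. \<forall>x. ev Y t [code x] (code (f x)))"

named_theorems cpt_intros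

lemma cpt_I: "(\<And>x. ev Y t [code x] (code (f x))) \<Longrightarrow> cpt Y f"
  unfolding cpt_def by blast

lemma cpt_oracle_free: "cpt no_oracle f \<Longrightarrow> cpt Y f"
  unfolding cpt_def using ev_drop_oracle by blast

lemma ev_Proj0: "ev Y (Proj 0) (x # xs) x"
  using ev.ev_proj[of 0 "x # xs"] by simp
lemma ev_Proj1: "ev Y (Proj 1) (x # y # xs) y"
  using ev.ev_proj[of 1 "x # y # xs"] by simp
lemma ev_Proj2: "ev Y (Proj 2) (x # y # z # xs) z"
  using ev.ev_proj[of 2 "x # y # z # xs"] by (simp add: numeral_2_eq_2)

lemma ev_Comp1: "ev Y g xs y \<Longrightarrow> ev Y f [y] z \<Longrightarrow> ev Y (Comp f [g]) xs z"
  by (rule ev.ev_comp[where ys = "[y]"]) auto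
lemma ev_Comp2: "ev Y g xs y \<Longrightarrow> ev Y g' xs y' \<Longrightarrow> ev Y f [y, y'] z \<Longrightarrow> ev Y (Comp f [g, g']) xs z"
  by (rule ev.ev_comp[where ys = "[y, y']"]) auto
lemma ev_Comp3: "ev Y g xs y \<Longrightarrow> ev Y g' xs y' \<Longrightarrow> ev Y g'' xs y'' \<Longrightarrow> ev Y f [y, y', y''] z
   \<Longrightarrow> ev Y (Comp f [g, g', g'']) xs z"
  by (rule ev.ev_comp[where ys = "[y, y', y'']"]) auto

lemma cpt_id: "cpt Y (\<lambda>x. x)"
  by (rule cpt_I[where t = "Proj 0"]) (rule ev_Proj0)

lemma cpt_o: "cpt Y f \<Longrightarrow> cpt Y g \<Longrightarrow> cpt Y (\<lambda>x. f (g x))"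
proof -
  assume "cpt Y f" "cpt Y g"
  then obtain t u where "\<And>x. ev Y t [code x] (code (f x))" "\<And>x. ev Y u [code x] (code (g x))"
    unfolding cpt_def by blast
  then show ?thesis by (intro cpt_I[where t = "Comp t [u]"]) (blast intro: ev_Comp1)
qed

primrec kterm :: "nat \<Rightarrow> recf" where
  "kterm 0 = Zero" | "kterm (Suc n) = Comp Succ [kterm n]"

lemma ev_kterm: "ev Y (kterm n) xs n"
  by (induction n) (auto intro: ev.intros ev_Comp1)

lemma cpt_const: "cpt Y (\<lambda>x. k)"
  by (rule cpt_I[where t = "kterm (code k)"]) (rule ev_kterm)

lemma cpt_oracle: "cpt Y Y"
  by (rule cpt_I[where t = Oracle]) (use ev.ev_oracle in \<open>auto simp: code_bool_def\<close>)

lemma cpt_code: "cpt Y f \<Longrightarrow> cpt Y (\<lambda>x. code (f x))"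
  unfolding cpt_def by simp

lemma cpt_decode: "cpt Y f \<Longrightarrow> cpt Y (\<lambda>x. decode (f x))"
  unfolding cpt_def by simp

lemma cpt_of_code: "cpt Y (\<lambda>x. code (f x)) \<Longrightarrow> cpt Y f"
  unfolding cpt_def by simp

section \<open>Programs for arithmetic and for the pairing function\<close>

definition t_add :: recf where "t_add = Prec (Proj 0) (Comp Succ [Proj 1])"
definition t_tri :: recf where "t_tri = Prec Zero (Comp t_add [Proj 1, Comp Succ [Proj 0]])"
definition t_pair :: recf where "t_pair = Comp t_add [Comp t_tri [t_add], Proj 0]"
definition t_pred :: recf where "t_pred = Prec Zero (Proj 0)"
text \<open>Recursion runs on the first argument, so the subtrahend has to come first;
  \<open>t_sub\<close> restores the order.\<close>

definition t_rsub :: recf where "t_rsub = Prec (Proj 0) (Comp t_pred [Proj 1])"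
definition t_sub :: recf where "t_sub = Comp t_rsub [Proj 1, Proj 0]"
definition t_diag :: recf where
  "t_diag = Mn (Comp t_sub [Comp Succ [Proj 1], Comp t_tri [Comp Succ [Proj 0]]])"
definition t_fst :: recf where "t_fst = Comp t_sub [Proj 0, Comp t_tri [t_diag]]"
definition t_snd :: recf where "t_snd = Comp t_sub [t_diag, t_fst]"

lemma ev_t_add: "ev Y t_add [a, b] (a + b)"
proof (induction a)
  case 0 show ?case unfolding t_add_def using ev.ev_prec0[OF ev_Proj0] by simp
next
  case (Suc a)
  have "ev Y (Comp Succ [Proj 1]) [a, a + b, b] (Suc (a + b))"
    by (rule ev_Comp1[OF ev_Proj1 ev.ev_succ])
  then show ?case using Suc unfolding t_add_def by (simp add: ev.ev_precS)
qed

lemma ev_t_tri: "ev Y t_tri [a] (triangle a)"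
proof (induction a)
  case 0 show ?case unfolding t_tri_def using ev.ev_prec0[OF ev.ev_zero] by simp
next
  case (Suc a)
  have "ev Y (Comp t_add [Proj 1, Comp Succ [Proj 0]]) [a, triangle a] (triangle a + Suc a)"
    by (rule ev_Comp2[OF ev_Proj1 ev_Comp1[OF ev_Proj0 ev.ev_succ] ev_t_add])
  then show ?case using Suc unfolding t_tri_def by (simp add: ev.ev_precS)
qed

lemma ev_t_pair: "ev Y t_pair [a, b] (prod_encode (a, b))"
  unfolding t_pair_def prod_encode_def prod.case
  by (rule ev_Comp2[OF ev_Comp1[OF ev_t_add ev_t_tri] ev_Proj0 ev_t_add])

lemma ev_t_pred: "ev Y t_pred [a] (a - 1)"
proof (induction a)
  case 0 show ?case unfolding t_pred_def using ev.ev_prec0[OF ev.ev_zero] by simp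
next
  case (Suc a) then show ?case unfolding t_pred_def using ev.ev_precS[OF _ ev_Proj0] by fastforce
qed

lemma ev_t_rsub: "ev Y t_rsub [b, a] (a - b)"
proof (induction b)
  case 0 show ?case unfolding t_rsub_def using ev.ev_prec0[OF ev_Proj0] by simp
next
  case (Suc b)
  have "ev Y (Comp t_pred [Proj 1]) [b, a - b, a] (a - b - 1)"
    by (rule ev_Comp1[OF ev_Proj1 ev_t_pred])
  then show ?case using Suc unfolding t_rsub_def by (simp add: ev.ev_precS)
qed

lemma ev_t_sub: "ev Y t_sub [a, b] (a - b)"
  unfolding t_sub_def by (rule ev_Comp2[OF ev_Proj1 ev_Proj0 ev_t_rsub])

lemma mono_triangle: "a \<le> b \<Longrightarrow> triangle a \<le> triangle b"
  by (induction b) (auto simp: le_Suc_eq)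

text \<open>\<open>a + b\<close> is the least \<open>w\<close> with \<open>prod_encode (a, b) < triangle (Suc w)\<close>.\<close>
lemma ev_t_diag: "ev Y t_diag [prod_encode (a, b)] (a + b)"
  unfolding t_diag_def
proof (rule ev.ev_mn)
  let ?n = "prod_encode (a, b)" and ?t = "Comp t_sub [Comp Succ [Proj 1], Comp t_tri [Comp Succ [Proj 0]]]"
  have *: "ev Y ?t [w, ?n]
      (Suc ?n - triangle (Suc w))" for w
    by (rule ev_Comp2[OF ev_Comp1[OF ev_Proj1 ev.ev_succ]
         ev_Comp1[OF ev_Comp1[OF ev_Proj0 ev.ev_succ] ev_t_tri] ev_t_sub])
  show "ev Y ?t [a + b, ?n] 0"
    using *[of "a + b"] by (simp add: prod_encode_def)
  show "\<forall>z<a + b. \<exists>v. 0 < v \<and>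
      ev Y ?t [z, ?n] v"
  proof (intro allI impI)
    fix z assume "z < a + b"
    then have "triangle (Suc z) \<le> triangle (a + b)" by (intro mono_triangle) simp
    then have "0 < Suc ?n - triangle (Suc z)" by (simp add: prod_encode_def)
    then show "\<exists>v. 0 < v \<and> ev Y ?t [z, ?n] v"
      using * by blast
  qed
qed

lemma ev_t_fst: "ev Y t_fst [prod_encode (a, b)] a"
proof -
  have "ev Y t_fst [prod_encode (a, b)] (prod_encode (a, b) - triangle (a + b))"
    unfolding t_fst_def by (rule ev_Comp2[OF ev_Proj0 ev_Comp1[OF ev_t_diag ev_t_tri] ev_t_sub])
  then show ?thesis by (simp add: prod_encode_def)
qed

lemma ev_t_snd: "ev Y t_snd [prod_encode (a, b)] b"
proof -
  have "ev Y t_snd [prod_encode (a, b)] (a + b - a)"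
    unfolding t_snd_def by (rule ev_Comp2[OF ev_t_diag ev_t_fst ev_t_sub])
  then show ?thesis by simp
qed

lemma cpt_Pair:
  assumes "cpt Y f" "cpt Y g" shows "cpt Y (\<lambda>x. (f x, g x))"
proof -
  obtain t u where "\<And>x. ev Y t [code x] (code (f x))" "\<And>x. ev Y u [code x] (code (g x))"
    using assms unfolding cpt_def by blast
  then have "ev Y (Comp t_pair [t, u]) [code x] (code (f x, g x))" for x
    unfolding code_prod_def fst_conv snd_conv by (rule ev_Comp2[OF _ _ ev_t_pair])
  then show ?thesis by (rule cpt_I)
qed

lemma cpt_fst: "cpt Y f \<Longrightarrow> cpt Y (\<lambda>x. fst (f x))"
  by (rule cpt_o[where f = fst, OF cpt_I[where t = t_fst]]) (simp_all add: code_prod_def ev_t_fst)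

lemma cpt_snd: "cpt Y f \<Longrightarrow> cpt Y (\<lambda>x. snd (f x))"
  by (rule cpt_o[where f = snd, OF cpt_I[where t = t_snd]]) (simp_all add: code_prod_def ev_t_snd)

lemma cpt_2:
  assumes "cpt Y (\<lambda>p. h (fst p) (snd p))" "cpt Y f" "cpt Y g" shows "cpt Y (\<lambda>x. h (f x) (g x))"
  using cpt_o[OF assms(1) cpt_Pair[OF assms(2,3)]] by simp

lemma cpt_3:
  assumes "cpt Y (\<lambda>p. h (fst p) (fst (snd p)) (snd (snd p)))" "cpt Y f" "cpt Y g" "cpt Y k"
  shows "cpt Y (\<lambda>x. h (f x) (g x) (k x))"
  using cpt_o[OF assms(1) cpt_Pair[OF assms(2) cpt_Pair[OF assms(3,4)]]] by simp

lemma cpt_rec_nat: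
  assumes h: "cpt Y h" and f: "cpt Y f" and g: "cpt Y (\<lambda>p. g (fst p) (fst (snd p)) (snd (snd p)))"
  shows "cpt Y (\<lambda>x. rec_nat (f x) (g x) (h x))"
proof -
  obtain th tf tg where th: "\<And>x. ev Y th [code x] (h x)" and tf: "\<And>x. ev Y tf [code x] (code (f x))"
    and tg: "\<And>p. ev Y tg [code p] (code (g (fst p) (fst (snd p)) (snd (snd p))))"
    using assms unfolding cpt_def code_nat_def by metis
  \<comment> \<open>\<open>Prec\<close> supplies counter, previous value and parameter as three
    arguments, whereas \<open>tg\<close> takes one code of a triple with the parameter
    first.\<close>
  define tg' where "tg' = Comp tg [Comp t_pair [Proj 2, Comp t_pair [Proj 0, Proj 1]]]"
  have tg': "ev Y tg' [n, code r, code x] (code (g x n r))" for n r x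
  proof -
    have "ev Y (Comp t_pair [Proj 2, Comp t_pair [Proj 0, Proj 1]]) [n, code r, code x] (code (x, n, r))"
      unfolding code_prod_def fst_conv snd_conv code_nat_def
      by (rule ev_Comp2[OF ev_Proj2 ev_Comp2[OF ev_Proj0 ev_Proj1 ev_t_pair] ev_t_pair])
    then show ?thesis unfolding tg'_def using tg[of "(x, n, r)"] by (simp add: ev_Comp1)
  qed
  have "ev Y (Prec tf tg') [n, code x] (code (rec_nat (f x) (g x) n))" for n x
  proof (induction n)
    case 0 then show ?case by (simp add: ev.ev_prec0 tf)
  next
    case (Suc n) then show ?case by (simp add: ev.ev_precS tg')
  qed
  then have "ev Y (Comp (Prec tf tg') [th, Proj 0]) [code x] (code (rec_nat (f x) (g x) (h x)))" for x
    by (rule ev_Comp2[OF th ev_Proj0])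
  then show ?thesis by (rule cpt_I)
qed

lemma cpt_Suc: "cpt Y f \<Longrightarrow> cpt Y (\<lambda>x. Suc (f x))"
  by (rule cpt_o[where f = Suc, OF cpt_I[where t = Succ]]) (simp_all add: ev.ev_succ)

lemma cpt_add: "cpt Y f \<Longrightarrow> cpt Y g \<Longrightarrow> cpt Y (\<lambda>x. f x + (g x :: nat))"
proof (rule cpt_2[where h = "(+)"])
  have "ev Y (Comp t_add [t_fst, t_snd]) [code p] (code (fst p + snd p))" for p :: "nat \<times> nat"
    unfolding code_prod_def code_nat_def by (rule ev_Comp2[OF ev_t_fst ev_t_snd ev_t_add])
  then show "cpt Y (\<lambda>p :: nat \<times> nat. fst p + snd p)" by (rule cpt_I)
qed

lemma cpt_diff: "cpt Y f \<Longrightarrow> cpt Y g \<Longrightarrow> cpt Y (\<lambda>x. f x - (g x :: nat))"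
proof (rule cpt_2[where h = "(-)"])
  have "ev Y (Comp t_sub [t_fst, t_snd]) [code p] (code (fst p - snd p))" for p :: "nat \<times> nat"
    unfolding code_prod_def code_nat_def by (rule ev_Comp2[OF ev_t_fst ev_t_snd ev_t_sub])
  then show "cpt Y (\<lambda>p :: nat \<times> nat. fst p - snd p)" by (rule cpt_I)
qed

lemma cpt_if:
  assumes "cpt Y b" "cpt Y f" "cpt Y g" shows "cpt Y (\<lambda>x. if b x then f x else g x)"
proof -
  \<comment> \<open>Branching is a recursion whose number of rounds is the code 0 or 1 of the
    condition.\<close>
  have "cpt Y (\<lambda>x. rec_nat (g x) (\<lambda>_ _. f x) (code (b x)))"
    by (intro cpt_rec_nat cpt_code assms cpt_o[OF assms(2)] cpt_fst cpt_id)
  moreover have "rec_nat (g x) (\<lambda>_ _. f x) (code (b x)) = (if b x then f x else g x)" for x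
    by (simp add: code_bool_def)
  ultimately show ?thesis by simp
qed

lemma cpt_eq0: "cpt Y f \<Longrightarrow> cpt Y (\<lambda>x. f x = (0::nat))"
proof (rule cpt_of_code)
  assume "cpt Y f"
  then have "cpt Y (\<lambda>x. 1 - f x)" by (intro cpt_diff cpt_const)
  moreover have "1 - f x = code (f x = 0)" for x by (simp add: code_bool_def)
  ultimately show "cpt Y (\<lambda>x. code (f x = 0))" by simp
qed

lemma cpt_cong: "cpt Y f \<Longrightarrow> (\<And>x. f x = g x) \<Longrightarrow> cpt Y g"
  by (simp add: cpt_def)

lemma cpt_not:
  assumes "cpt Y P" shows "cpt Y (\<lambda>x. \<not> P x)"
proof -
  have "cpt Y (\<lambda>x. if P x then False else True)" by (intro cpt_if cpt_const assms)
  then show ?thesis by (rule cpt_cong) simp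
qed
lemma cpt_conj:
  assumes "cpt Y P" "cpt Y Q" shows "cpt Y (\<lambda>x. P x \<and> Q x)"
proof -
  have "cpt Y (\<lambda>x. if P x then Q x else False)" by (intro cpt_if cpt_const assms)
  then show ?thesis by (rule cpt_cong) simp
qed
lemma cpt_disj:
  assumes "cpt Y P" "cpt Y Q" shows "cpt Y (\<lambda>x. P x \<or> Q x)"
proof -
  have "cpt Y (\<lambda>x. if P x then True else Q x)" by (intro cpt_if cpt_const assms)
  then show ?thesis by (rule cpt_cong) simp
qed
lemma cpt_imp:
  assumes "cpt Y P" "cpt Y Q" shows "cpt Y (\<lambda>x. P x \<longrightarrow> Q x)"
proof -
  have "cpt Y (\<lambda>x. if P x then Q x else True)" by (intro cpt_if cpt_const assms)
  then show ?thesis by (rule cpt_cong) simp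
qed
lemma cpt_le: "cpt Y f \<Longrightarrow> cpt Y g \<Longrightarrow> cpt Y (\<lambda>x. f x \<le> (g x :: nat))"
  using cpt_eq0[OF cpt_diff] by simp
lemma cpt_less: "cpt Y f \<Longrightarrow> cpt Y g \<Longrightarrow> cpt Y (\<lambda>x. f x < (g x :: nat))"
  using cpt_le[OF cpt_Suc] by (simp add: Suc_le_eq)
lemma cpt_eq:
  assumes "cpt Y f" "cpt Y g" shows "cpt Y (\<lambda>x. f x = g x)"
proof -
  have "cpt Y (\<lambda>x. code (f x) \<le> code (g x) \<and> code (g x) \<le> code (f x))"
    by (intro cpt_conj cpt_le cpt_code assms)
  moreover have "(code (f x) \<le> code (g x) \<and> code (g x) \<le> code (f x)) = (f x = g x)" for x
    using code_eq_iff by (metis le_antisym order_refl)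
  ultimately show ?thesis by simp
qed
lemma cpt_of_bool: "cpt Y P \<Longrightarrow> cpt Y (\<lambda>x. of_bool (P x) :: nat)"
  using cpt_if[of Y P "\<lambda>_. 1" "\<lambda>_. 0::nat"] by (simp add: cpt_const of_bool_def)

lemma cpt_mult:
  assumes "cpt Y f" "cpt Y g" shows "cpt Y (\<lambda>x. f x * (g x :: nat))"
proof -
  have "cpt Y (\<lambda>x. rec_nat 0 (\<lambda>_ r. r + g x) (f x))"
    by (intro cpt_rec_nat cpt_const assms cpt_add cpt_o[OF assms(2)] cpt_fst cpt_snd cpt_id)
  moreover have "rec_nat 0 (\<lambda>_ r. r + b) a = a * (b :: nat)" for a b by (induction a) auto
  ultimately show ?thesis by simp
qed

lemma cpt_power:
  assumes "cpt Y f" "cpt Y g" shows "cpt Y (\<lambda>x. f x ^ (g x) :: nat)"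
proof -
  have "cpt Y (\<lambda>x. rec_nat 1 (\<lambda>_ r. f x * r) (g x))"
    by (intro cpt_rec_nat cpt_const assms cpt_mult cpt_o[OF assms(1)] cpt_fst cpt_snd cpt_id)
  moreover have "rec_nat 1 (\<lambda>_ r. a * r) b = a ^ (b :: nat)" for a b :: nat by (induction b) auto
  ultimately show ?thesis by simp
qed

section \<open>Unbounded search and computable enumerability\<close>

definition t_test :: "recf \<Rightarrow> recf" where
  "t_test t = Comp t_sub [kterm 1, Comp t [Comp t_pair [Proj 1, Proj 0]]]"
definition t_search :: "recf \<Rightarrow> recf" where
  "t_search t = Mn (t_test t)"

text \<open>\<open>Mn\<close> looks for the value 0, so the truth value of \<open>P\<close> is
  subtracted from 1.\<close>

lemma ev_search_body:
  assumes "\<And>p. ev Y t [code p] (code (P (fst p) (snd p)))"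
  shows "ev Y (t_test t) [n, code x] (1 - code (P x n))"
proof -
  have "ev Y t [prod_encode (code x, n)] (code (P x n))" using assms[of "(x, n)"] by (simp add: code_prod_def)
  then show ?thesis
    unfolding t_test_def by (intro ev_Comp2[OF ev_kterm _ ev_t_sub] ev_Comp1[OF ev_Comp2[OF ev_Proj1 ev_Proj0 ev_t_pair]])
qed

lemma ev_t_search:
  assumes "\<And>p. ev Y t [code p] (code (P (fst p) (snd p)))" and "P x n"
  shows "ev Y (t_search t) [code x] (LEAST n. P x n)"
  unfolding t_search_def
proof (rule ev.ev_mn)
  show "ev Y (t_test t) [LEAST n. P x n, code x] 0"
    using ev_search_body[OF assms(1), of "LEAST n. P x n" x] LeastI[of "P x", OF assms(2)]
    by (simp add: code_bool_def)
  show "\<forall>z<LEAST n. P x n. \<exists>v. 0 < v \<and>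
      ev Y (t_test t) [z, code x] v"
  proof (intro allI impI)
    fix z assume "z < (LEAST n. P x n)"
    then have "\<not> P x z" by (rule not_less_Least)
    then show "\<exists>v. 0 < v \<and> ev Y (t_test t) [z, code x] v"
      using ev_search_body[OF assms(1), of z x] by (auto simp: code_bool_def intro!: exI[of _ "Suc 0"])
  qed
qed

lemma ev_t_searchD:
  assumes "\<And>p. ev Y t [code p] (code (P (fst p) (snd p)))" and "ev Y (t_search t) [code x] y"
  shows "P x y"
proof -
  have "ev Y (t_test t) [y, code x] 0"
    using assms(2) unfolding t_search_def by (rule ev_MnE)
  then have "1 - code (P x y) = 0" using ev_search_body[OF assms(1), of y x] by (rule ev_det[rotated])
  then show ?thesis by (auto simp: code_bool_def split: if_splits)
qed

lemma cpt_Least: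
  fixes P :: "'a::enc \<Rightarrow> nat \<Rightarrow> bool"
  assumes "cpt Y (\<lambda>p. P (fst p) (snd p))" "\<And>x. \<exists>n. P x n"
  shows "cpt Y (\<lambda>x. LEAST n. P x n)"
proof -
  obtain t where t: "\<And>p. ev Y t [code p] (code (P (fst p) (snd p)))" using assms(1) unfolding cpt_def by blast
  have "ev Y (t_search t) [code x] (LEAST n. P x n)" for x
    using assms(2)[of x] ev_t_search[where P = P, OF t] by blast
  then show ?thesis by (intro cpt_I[where t = "t_search t"]) simp
qed

lemma ce_set_search:
  assumes "cpt no_oracle (\<lambda>p. P (fst p) (snd p))"
  shows "ce_set {x. \<exists>s::nat. P x s}"
proof -
  obtain t where t: "\<And>p. ev no_oracle t [code p] (code (P (fst p) (snd p)))" using assms unfolding cpt_def by blast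
  have "x \<in> {x. \<exists>s. P x s} \<longleftrightarrow> (\<exists>y. ev no_oracle (t_search t) [x] y)" for x
    using ev_t_search[where P = P, OF t, of x] ev_t_searchD[where P = P, OF t, of x] by (auto 4 4)
  then show ?thesis unfolding ce_set_def by blast
qed

lemma ev_Comp1D: "ev Y (Comp f [g]) xs z \<Longrightarrow> \<exists>y. ev Y g xs y \<and> ev Y f [y] z"
  by (erule ev_CompE) (auto simp: list_all2_Cons1)

lemma ce_rel2_search:
  fixes P :: "nat \<Rightarrow> nat \<Rightarrow> nat \<Rightarrow> bool"
  assumes "cpt no_oracle (\<lambda>p. P (fst p) (fst (snd p)) (snd (snd p)))"
  shows "ce_rel2 (\<lambda>x y. \<exists>s. P x y s)"
proof -
  define Q where "Q = (\<lambda>q s. P (fst q) (snd q) s)"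
  have "cpt no_oracle (\<lambda>p. Q (fst p) (snd p))"
    unfolding Q_def
    by (intro cpt_3[OF assms] cpt_fst cpt_snd cpt_id)
  then obtain t where t: "\<And>p. ev no_oracle t [code p] (code (Q (fst p) (snd p)))" unfolding cpt_def by blast
  let ?u = "Comp (t_search t) [Comp t_pair [Proj 0, Proj 1]]"
  have p: "ev no_oracle (Comp t_pair [Proj 0, Proj 1]) [x, y] (code (x, y))" for x y
    using ev_Comp2[OF ev_Proj0 ev_Proj1 ev_t_pair] by (simp add: code_prod_def)
  have "(\<exists>s. P x y s) \<longleftrightarrow> (\<exists>v. ev no_oracle ?u [x, y] v)" for x y
  proof
    assume "\<exists>s. P x y s"
    then obtain s where "Q (x, y) s" by (auto simp: Q_def)
    then show "\<exists>v. ev no_oracle ?u [x, y] v"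
      using ev_Comp1[OF p ev_t_search[where P = Q, OF t]] by blast
  next
    assume "\<exists>v. ev no_oracle ?u [x, y] v"
    then obtain v w where "ev no_oracle (Comp t_pair [Proj 0, Proj 1]) [x, y] w" "ev no_oracle (t_search t) [w] v"
      using ev_Comp1D by blast
    then have "ev no_oracle (t_search t) [code (x, y)] v" using ev_det[OF p] by blast
    from ev_t_searchD[where P = Q, OF t this] show "\<exists>s. P x y s" by (auto simp: Q_def)
  qed
  then show ?thesis unfolding ce_rel2_def by blast
qed

lemma cpt_prod_encode: "cpt Y f \<Longrightarrow> cpt Y (\<lambda>x. prod_encode (f x))"
  unfolding cpt_def by (simp add: code_prod_def)
lemma cpt_prod_decode: "cpt Y f \<Longrightarrow> cpt Y (\<lambda>x. prod_decode (f x))"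
  unfolding cpt_def by (simp add: code_prod_def)

lemma cpt_div:
  assumes "cpt Y f" "cpt Y g" shows "cpt Y (\<lambda>x. f x div (g x :: nat))"
proof -
  have "\<exists>q. b = 0 \<or> a < Suc q * b" for a b :: nat
    by (metis Suc_eq_plus1 add.commute gr0I less_mult_imp_div_less lessI mult.commute dividend_less_times_div plus_1_eq_Suc mult_Suc_right)
  \<comment> \<open>The disjunct for divisor 0 makes the search total and yields 0, which is the
    value of \<open>div\<close> there.\<close>
  then have "cpt Y (\<lambda>x. LEAST q. g x = 0 \<or> f x < Suc q * g x)"
    by (intro cpt_Least cpt_disj cpt_eq0 cpt_less cpt_mult cpt_Suc cpt_snd cpt_id
        cpt_o[OF assms(1)] cpt_o[OF assms(2)] cpt_fst) auto
  moreover have "(LEAST q. b = 0 \<or> a < Suc q * b) = a div b" for a b :: nat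
  proof (rule Least_equality)
    show "b = 0 \<or> a < Suc (a div b) * b"
      by (metis dividend_less_div_times gr0I mult_Suc add.commute)
    fix q assume "b = 0 \<or> a < Suc q * b"
    then show "a div b \<le> q"
      by (metis div_by_0 le0 less_Suc_eq_le less_mult_imp_div_less)
  qed
  ultimately show ?thesis by simp
qed

lemma cpt_mod:
  assumes "cpt Y f" "cpt Y g" shows "cpt Y (\<lambda>x. f x mod (g x :: nat))"
  unfolding modulo_nat_def by (intro cpt_diff cpt_mult cpt_div assms)

lemma cpt_min: "cpt Y f \<Longrightarrow> cpt Y g \<Longrightarrow> cpt Y (\<lambda>x. min (f x) (g x :: nat))"
  unfolding min_def by (intro cpt_if cpt_le)
lemma cpt_max: "cpt Y f \<Longrightarrow> cpt Y g \<Longrightarrow> cpt Y (\<lambda>x. max (f x) (g x :: nat))"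
  unfolding max_def by (intro cpt_if cpt_le)

lemma cpt_all_less:
  fixes P :: "'a::enc \<Rightarrow> nat \<Rightarrow> bool"
  assumes "cpt Y h" "cpt Y (\<lambda>p. P (fst p) (snd p))" shows "cpt Y (\<lambda>x. \<forall>i<h x. P x i)"
proof -
  have "cpt Y (\<lambda>x. rec_nat True (\<lambda>i r. r \<and> P x i) (h x))"
    by (intro cpt_rec_nat assms(1) cpt_const cpt_conj cpt_2[OF assms(2)] cpt_fst cpt_snd cpt_id)
  moreover have "rec_nat True (\<lambda>i r. r \<and> P x i) n = (\<forall>i<n. P x i)" for x n
    by (induction n) (auto simp: less_Suc_eq)
  ultimately show ?thesis by simp
qed
lemma cpt_all_le:
  fixes P :: "'a::enc \<Rightarrow> nat \<Rightarrow> bool"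
  assumes "cpt Y h" "cpt Y (\<lambda>p. P (fst p) (snd p))" shows "cpt Y (\<lambda>x. \<forall>i\<le>h x. P x i)"
  using cpt_all_less[OF cpt_Suc assms(2), OF assms(1)] by (simp add: less_Suc_eq_le)
lemma cpt_ex_less:
  fixes P :: "'a::enc \<Rightarrow> nat \<Rightarrow> bool"
  assumes "cpt Y h" "cpt Y (\<lambda>p. P (fst p) (snd p))" shows "cpt Y (\<lambda>x. \<exists>i<h x. P x i)"
  using cpt_not[OF cpt_all_less[OF assms(1) cpt_not[OF assms(2)]]] by simp
lemma cpt_ex_le:
  fixes P :: "'a::enc \<Rightarrow> nat \<Rightarrow> bool"
  assumes "cpt Y h" "cpt Y (\<lambda>p. P (fst p) (snd p))" shows "cpt Y (\<lambda>x. \<exists>i\<le>h x. P x i)"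
  using cpt_not[OF cpt_all_le[OF assms(1) cpt_not[OF assms(2)]]] by simp

lemmas [cpt_intros] = cpt_const cpt_id cpt_Pair cpt_fst cpt_snd cpt_rec_nat cpt_Suc
  cpt_add cpt_diff cpt_mult cpt_power cpt_div cpt_mod cpt_min cpt_max cpt_if cpt_eq cpt_le cpt_less
  cpt_not cpt_conj cpt_disj cpt_imp cpt_of_bool cpt_code cpt_decode cpt_prod_encode cpt_prod_decode
  cpt_all_less cpt_all_le cpt_ex_less cpt_ex_le

section \<open>Computable operations on lists\<close>

lemma code_Nil [simp]: "code [] = 0"
  by (simp add: code_list_def)
lemma code_Cons [simp]: "code (x # xs) = Suc (prod_encode (code x, code xs))"
  by (simp add: code_list_def)

lemma cpt_Cons [cpt_intros]:
  assumes "cpt Y f" "cpt Y g" shows "cpt Y (\<lambda>x. f x # g x)"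
proof (rule cpt_of_code)
  have "cpt Y (\<lambda>x. Suc (prod_encode (code (f x), code (g x))))" by (intro cpt_intros assms)
  then show "cpt Y (\<lambda>x. code (f x # g x))" by simp
qed

lemma cpt_hd [cpt_intros]:
  assumes "cpt Y f" shows "cpt Y (\<lambda>x. hd (f x))"
proof (rule cpt_of_code)
  \<comment> \<open>The head of the empty list is unspecified but fixed, so its code can be a
    constant of the program.\<close>
  have "cpt Y (\<lambda>x. if f x = [] then code (hd ([] :: 'b list)) else fst (prod_decode (code (f x) - 1)))"
    by (intro cpt_intros assms)
  then show "cpt Y (\<lambda>x. code (hd (f x)))"
  proof (rule cpt_cong)
    show "(if f x = [] then code (hd ([] :: 'b list)) else fst (prod_decode (code (f x) - 1))) = code (hd (f x))" for x
      by (cases "f x") simp_all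
  qed
qed

lemma cpt_tl [cpt_intros]:
  assumes "cpt Y f" shows "cpt Y (\<lambda>x. tl (f x))"
proof (rule cpt_of_code)
  have "cpt Y (\<lambda>x. if f x = [] then 0 else snd (prod_decode (code (f x) - 1)))"
    by (intro cpt_intros assms)
  then show "cpt Y (\<lambda>x. code (tl (f x)))"
  proof (rule cpt_cong)
    show "(if f x = [] then 0 else snd (prod_decode (code (f x) - 1))) = code (tl (f x))" for x
      by (cases "f x") simp_all
  qed
qed

lemma length_le_code: "length xs \<le> code xs"
proof (induction xs)
  case (Cons x xs)
  then show ?case using le_prod_encode_2[of "code xs" "code x"] by simp
qed simp

text \<open>Only recursion on numbers is available so far, and the length of a list becomes
  computable only through this lemma. Since the code of a list bounds its length, the loop runs that
  many rounds and idles once the list is used up.\<close>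

lemma cpt_fold [cpt_intros]:
  assumes l: "cpt Y l" and a: "cpt Y a" and g: "cpt Y (\<lambda>p. g (fst p) (fst (snd p)) (snd (snd p)))"
  shows "cpt Y (\<lambda>x. fold (g x) (l x) (a x))"
proof -
  let ?step = "\<lambda>x (_::nat) r. if fst r = [] then r else (tl (fst r), g x (hd (fst r)) (snd r))"
  have c: "cpt Y (\<lambda>x. snd (rec_nat (l x, a x) (?step x) (code (l x))))"
    by (intro cpt_intros assms cpt_3[OF g])
  have e: "snd (rec_nat (l x, a x) (?step x) (code (l x))) = fold (g x) (l x) (a x)" for x
  proof -
    have "\<exists>xs b. rec_nat (l x, a x) (?step x) n = (xs, b) \<and> xs = drop n (l x) \<and> b = fold (g x) (take n (l x)) (a x)" for n
    proof (induction n)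
      case (Suc n)
      show ?case
      proof (cases "n < length (l x)")
        case True
        with Suc show ?thesis
          by (auto simp: take_Suc_conv_app_nth hd_drop_conv_nth drop_Suc tl_drop)
      next
        case False
        with Suc show ?thesis by auto
      qed
    qed simp
    from this[of "code (l x)"] show ?thesis using length_le_code[of "l x"] by auto
  qed
  show ?thesis by (rule cpt_cong[OF c]) (rule e)
qed

lemma cpt_rev [cpt_intros]:
  assumes "cpt Y l" shows "cpt Y (\<lambda>x. rev (l x))"
proof -
  have c: "cpt Y (\<lambda>x. fold (\<lambda>y ys. y # ys) (l x) [])" by (intro cpt_intros assms)
  have e: "fold (\<lambda>y ys. y # ys) xs ys = rev xs @ ys" for xs ys :: "'b list" by (induction xs arbitrary: ys) auto
  show ?thesis by (rule cpt_cong[OF c]) (simp add: e)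
qed

lemma cpt_append [cpt_intros]:
  assumes "cpt Y l" "cpt Y m" shows "cpt Y (\<lambda>x. l x @ m x)"
proof -
  have c: "cpt Y (\<lambda>x. fold (\<lambda>y ys. y # ys) (rev (l x)) (m x))" by (intro cpt_intros assms)
  have e: "fold (\<lambda>y ys. y # ys) xs ys = rev xs @ ys" for xs ys :: "'b list" by (induction xs arbitrary: ys) auto
  show ?thesis by (rule cpt_cong[OF c]) (simp add: e)
qed

lemma cpt_map [cpt_intros]:
  assumes "cpt Y l" "cpt Y (\<lambda>p. g (fst p) (snd p))" shows "cpt Y (\<lambda>x. map (g x) (l x))"
proof -
  have c: "cpt Y (\<lambda>x. rev (fold (\<lambda>y ys. g x y # ys) (l x) []))" by (intro cpt_intros assms(1) cpt_2[OF assms(2)])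
  have e: "fold (\<lambda>y ys. h y # ys) xs ys = rev (map h xs) @ ys" for h xs ys
    by (induction xs arbitrary: ys) auto
  show ?thesis by (rule cpt_cong[OF c]) (simp add: e)
qed

lemma cpt_filter [cpt_intros]:
  assumes "cpt Y l" "cpt Y (\<lambda>p. P (fst p) (snd p))" shows "cpt Y (\<lambda>x. filter (P x) (l x))"
proof -
  have c: "cpt Y (\<lambda>x. rev (fold (\<lambda>y ys. if P x y then y # ys else ys) (l x) []))"
    by (intro cpt_intros assms(1) cpt_2[OF assms(2)])
  have e: "fold (\<lambda>y ys. if h y then y # ys else ys) xs ys = rev (filter h xs) @ ys" for h and xs ys :: "'b list"
    by (induction xs arbitrary: ys) auto
  show ?thesis by (rule cpt_cong[OF c]) (simp add: e)
qed

lemma cpt_length [cpt_intros]: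
  assumes "cpt Y l" shows "cpt Y (\<lambda>x. length (l x))"
proof -
  have c: "cpt Y (\<lambda>x. fold (\<lambda>y n. Suc n) (l x) 0)" by (intro cpt_intros assms)
  have e: "fold (\<lambda>y n. Suc n) xs n = length xs + n" for xs :: "'b list" and n by (induction xs arbitrary: n) auto
  show ?thesis by (rule cpt_cong[OF c]) (simp add: e)
qed

lemma cpt_Ball_set [cpt_intros]:
  assumes "cpt Y l" "cpt Y (\<lambda>p. P (fst p) (snd p))" shows "cpt Y (\<lambda>x. \<forall>y\<in>set (l x). P x y)"
proof -
  have "cpt Y (\<lambda>x. filter (\<lambda>y. \<not> P x y) (l x) = [])" by (intro cpt_intros assms(1) cpt_2[OF assms(2)])
  then show ?thesis by (rule cpt_cong) (simp add: filter_empty_conv)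
qed

lemma cpt_Bex_set [cpt_intros]:
  assumes "cpt Y l" "cpt Y (\<lambda>p. P (fst p) (snd p))" shows "cpt Y (\<lambda>x. \<exists>y\<in>set (l x). P x y)"
proof -
  have "cpt Y (\<lambda>x. filter (P x) (l x) \<noteq> [])" by (intro cpt_intros assms(1) cpt_2[OF assms(2)])
  then show ?thesis by (rule cpt_cong) (auto simp: filter_empty_conv)
qed

lemma cpt_mem_set [cpt_intros]:
  assumes "cpt Y f" "cpt Y l" shows "cpt Y (\<lambda>x. f x \<in> set (l x))"
proof -
  have "cpt Y (\<lambda>x. \<exists>y\<in>set (l x). y = f x)" by (intro cpt_intros assms(2) cpt_o[OF assms(1)])
  then show ?thesis by (rule cpt_cong) auto
qed

lemma cpt_drop [cpt_intros]:
  assumes "cpt Y n" "cpt Y l" shows "cpt Y (\<lambda>x. drop (n x) (l x))"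
proof -
  have c: "cpt Y (\<lambda>x. rec_nat (l x) (\<lambda>_ r. tl r) (n x))" by (intro cpt_intros assms)
  have e: "rec_nat xs (\<lambda>_ r. tl r) n = drop n xs" for xs :: "'b list" and n
    by (induction n) (auto simp: drop_Suc tl_drop)
  show ?thesis by (rule cpt_cong[OF c]) (simp add: e)
qed

lemma cpt_upt [cpt_intros]:
  assumes "cpt Y n" shows "cpt Y (\<lambda>x. [0..<n x])"
proof -
  have c: "cpt Y (\<lambda>x. rec_nat [] (\<lambda>i r. r @ [i]) (n x))" by (intro cpt_intros assms)
  have e: "rec_nat [] (\<lambda>i r. r @ [i]) n = [0..<n]" for n
    by (induction n) auto
  show ?thesis by (rule cpt_cong[OF c]) (simp add: e)
qed

lemma cpt_take [cpt_intros]: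
  assumes "cpt Y n" "cpt Y l" shows "cpt Y (\<lambda>x. take (n x) (l x))"
proof -
  have c: "cpt Y (\<lambda>x. map (\<lambda>i. hd (drop i (l x))) [0..<min (n x) (length (l x))])"
    by (intro cpt_intros assms(1) cpt_o[OF assms(2)])
  have e: "map (\<lambda>i. hd (drop i xs)) [0..<min n (length xs)] = take n xs" for xs :: "'b list" and n
    by (rule nth_equalityI) (auto simp: hd_drop_conv_nth)
  show ?thesis by (rule cpt_cong[OF c]) (simp add: e)
qed

lemma cpt_sum_list [cpt_intros]:
  assumes "cpt Y l" shows "cpt Y (\<lambda>x. sum_list (l x) :: nat)"
proof -
  have c: "cpt Y (\<lambda>x. fold (\<lambda>y n. y + n) (l x) 0)" by (intro cpt_intros assms)
  have e: "fold (\<lambda>y n. y + n) xs n = sum_list xs + n" for xs and n :: nat by (induction xs arbitrary: n) auto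
  show ?thesis by (rule cpt_cong[OF c]) (simp add: e)
qed

section \<open>Bridges to the notions of computability in the statement\<close>

lemma computable1D: "computable1 f \<Longrightarrow> cpt Y f"
  by (rule cpt_oracle_free) (simp add: cpt_def computable1_def)

lemma computable2I:
  fixes f :: "nat \<Rightarrow> nat \<Rightarrow> nat"
  assumes "cpt no_oracle (\<lambda>p. f (fst p) (snd p))" shows "computable2 f"
proof -
  obtain t where t: "\<And>p. ev no_oracle t [code p] (f (fst p) (snd p))" using assms unfolding cpt_def code_nat_def by blast
  have "ev no_oracle (Comp t [Comp t_pair [Proj 0, Proj 1]]) [x, y] (f x y)" for x y
    using ev_Comp1[OF ev_Comp2[OF ev_Proj0 ev_Proj1 ev_t_pair] t[of "(x, y)", unfolded code_prod_def fst_conv snd_conv code_nat_def]] .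
  then show ?thesis unfolding computable2_def by blast
qed

lemma computable2D:
  fixes f :: "nat \<Rightarrow> nat \<Rightarrow> nat"
  assumes "computable2 f" shows "cpt Y (\<lambda>p. f (fst p) (snd p))"
proof (rule cpt_oracle_free)
  obtain t where t: "\<And>x y. ev no_oracle t [x, y] (f x y)" using assms unfolding computable2_def by blast
  have "ev no_oracle (Comp t [t_fst, t_snd]) [code p] (code (f (fst p) (snd p)))" for p
    unfolding code_prod_def code_nat_def by (rule ev_Comp2[OF ev_t_fst ev_t_snd t])
  then show "cpt no_oracle (\<lambda>p. f (fst p) (snd p))" by (rule cpt_I)
qed

lemma computable3D:
  fixes f :: "nat \<Rightarrow> nat \<Rightarrow> nat \<Rightarrow> nat"
  assumes "computable3 f" shows "cpt Y (\<lambda>p. f (fst p) (fst (snd p)) (snd (snd p)))"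
proof (rule cpt_oracle_free)
  obtain t where t: "\<And>x y z. ev no_oracle t [x, y, z] (f x y z)" using assms unfolding computable3_def by blast
  have "ev no_oracle (Comp t [t_fst, Comp t_fst [t_snd], Comp t_snd [t_snd]]) [code p]
      (code (f (fst p) (fst (snd p)) (snd (snd p))))" for p
    unfolding code_prod_def code_nat_def
    by (rule ev_Comp3[OF ev_t_fst ev_Comp1[OF ev_t_snd ev_t_fst] ev_Comp1[OF ev_t_snd ev_t_snd] t])
  then show "cpt no_oracle (\<lambda>p. f (fst p) (fst (snd p)) (snd (snd p)))" by (rule cpt_I)
qed

section \<open>A universal machine with finite oracle information\<close>

type_synonym judgement = "recf \<times> nat list \<times> nat"

text \<open>\<open>tg\<close> and \<open>payload\<close> undo \<open>rcode\<close> arithmetically,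
  so that case distinctions on programs become computable tests on numbers.\<close>

definition tg :: "recf \<Rightarrow> nat" where
  "tg t = (if code t < 3 then code t else 3 + (code t - 3) mod 4)"
definition payload :: "recf \<Rightarrow> nat" where
  "payload t = (code t - 3) div 4"
definition sub1 :: "recf \<Rightarrow> recf" where "sub1 t = decode (fst (prod_decode (payload t)))"
definition sub2 :: "recf \<Rightarrow> recf" where "sub2 t = decode (snd (prod_decode (payload t)))"
definition subs :: "recf \<Rightarrow> recf list" where "subs t = decode (snd (prod_decode (payload t)))"
definition sub0 :: "recf \<Rightarrow> recf" where "sub0 t = decode (payload t)"

lemma code_recf_simps:
  "code Zero = 0" "code Succ = 1" "code Oracle = 2" "code (Proj n) = 3 + 4 * n"
  "code (Comp f gs) = 4 + 4 * prod_encode (code f, code gs)"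
  "code (Prec f g) = 5 + 4 * prod_encode (code f, code g)"
  "code (Mn f) = 6 + 4 * code f"
  by (simp_all add: code_recf_def code_list_def)

lemma tg_simps [simp]:
  "tg Zero = 0" "tg Succ = 1" "tg Oracle = 2" "tg (Proj n) = 3" "tg (Comp f gs) = 4"
  "tg (Prec f g) = 5" "tg (Mn f) = 6"
proof -
  have "(1 + 4 * m) mod 4 = 1" "(2 + 4 * m) mod 4 = 2" "(3 + 4 * m) mod 4 = 3" for m :: nat by presburger+
  then show "tg Zero = 0" "tg Succ = 1" "tg Oracle = 2" "tg (Proj n) = 3" "tg (Comp f gs) = 4"
    "tg (Prec f g) = 5" "tg (Mn f) = 6"
    by (simp_all add: tg_def code_recf_simps)
qed

lemma payload_simps:
  "payload (Proj n) = n" "payload (Comp f gs) = prod_encode (code f, code gs)"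
  "payload (Prec f g) = prod_encode (code f, code g)" "payload (Mn f) = code f"
proof -
  have "(1 + 4 * m) div 4 = m" "(2 + 4 * m) div 4 = m" "(3 + 4 * m) div 4 = m" for m :: nat by presburger+
  then show "payload (Proj n) = n" "payload (Comp f gs) = prod_encode (code f, code gs)"
    "payload (Prec f g) = prod_encode (code f, code g)" "payload (Mn f) = code f"
    by (simp_all add: payload_def code_recf_simps)
qed

lemma sub_simps [simp]:
  "payload (Proj n) = n" "sub1 (Comp f gs) = f" "subs (Comp f gs) = gs" "sub1 (Prec f g) = f" "sub2 (Prec f g) = g"
  "sub0 (Mn f) = f"
  by (simp_all add: sub1_def sub2_def subs_def sub0_def payload_simps)

text \<open>One application of a rule of \<open>ev\<close> with premises taken from
  \<open>K\<close>. All quantifiers range over \<open>K\<close> or below a number, so the relation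
  is decidable; the rule for \<open>Oracle\<close> fires only if \<open>bs\<close> is long enough to
  answer the query.\<close>

definition justified :: "bool list \<Rightarrow> judgement list \<Rightarrow> judgement \<Rightarrow> bool" where
  "justified bs K j = (case j of (t, xs, y) \<Rightarrow>
     tg t = 0 \<and> y = 0
   \<or> tg t = 1 \<and> xs \<noteq> [] \<and> y = Suc (hd xs)
   \<or> tg t = 2 \<and> xs \<noteq> [] \<and> hd xs < length bs \<and> y = of_bool (hd (drop (hd xs) bs))
   \<or> tg t = 3 \<and> payload t < length xs \<and> y = hd (drop (payload t) xs)
   \<or> tg t = 4 \<and> (\<exists>q\<in>set K. fst q = sub1 t \<and> snd (snd q) = y \<and> length (fst (snd q)) = length (subs t)
        \<and> (\<forall>i<length (subs t). (hd (drop i (subs t)), xs, hd (drop i (fst (snd q)))) \<in> set K))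
   \<or> tg t = 5 \<and> xs \<noteq> [] \<and> (if hd xs = 0 then (sub1 t, tl xs, y) \<in> set K
        else (\<exists>q\<in>set K. fst q = t \<and> fst (snd q) = (hd xs - 1) # tl xs
               \<and> (sub2 t, (hd xs - 1) # snd (snd q) # tl xs, y) \<in> set K))
   \<or> tg t = 6 \<and> (sub0 t, y # xs, 0) \<in> set K
        \<and> (\<forall>z<y. \<exists>q\<in>set K. fst q = sub0 t \<and> fst (snd q) = z # xs \<and> 0 < snd (snd q)))"

text \<open>Forward chaining: stage \<open>s\<close> adds one candidate judgement when it follows in one step from those known;
  every judgement is the candidate at infinitely many stages.\<close>
definition known :: "bool list \<Rightarrow> nat \<Rightarrow> judgement list" where
  "known bs s = rec_nat [] (\<lambda>s K. if justified bs K (decode (fst (prod_decode s)))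
       then decode (fst (prod_decode s)) # K else K) s"

definition Phi :: "nat \<Rightarrow> bool list \<Rightarrow> recf \<Rightarrow> nat list \<Rightarrow> nat \<Rightarrow> bool" where
  "Phi s bs t xs y \<longleftrightarrow> (t, xs, y) \<in> set (known bs s)"

lemma known_simps [simp]:
  "known bs 0 = []"
  "known bs (Suc s) = (if justified bs (known bs s) (decode (fst (prod_decode s)))
       then decode (fst (prod_decode s)) # known bs s else known bs s)"
  by (simp_all add: known_def)

lemma cpt_tg [cpt_intros]: "cpt Y f \<Longrightarrow> cpt Y (\<lambda>x. tg (f x))"
  unfolding tg_def by (intro cpt_intros)
lemma cpt_payload [cpt_intros]: "cpt Y f \<Longrightarrow> cpt Y (\<lambda>x. payload (f x))"
  unfolding payload_def by (intro cpt_intros)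
lemma cpt_subs [cpt_intros]:
  assumes "cpt Y f"
  shows "cpt Y (\<lambda>x. sub1 (f x))" "cpt Y (\<lambda>x. sub2 (f x))" "cpt Y (\<lambda>x. sub0 (f x))" "cpt Y (\<lambda>x. subs (f x))"
  unfolding sub1_def sub2_def sub0_def subs_def by (intro cpt_intros assms)+

lemma cpt_justified [cpt_intros]:
  assumes "cpt Y f" "cpt Y g" "cpt Y h"
  shows "cpt Y (\<lambda>x. justified (f x) (g x) (h x))"
proof (rule cpt_3[OF _ assms])
  show "cpt Y (\<lambda>p. justified (fst p) (fst (snd p)) (snd (snd p)))"
    unfolding justified_def case_prod_beta by (intro cpt_intros)
qed

lemma cpt_known [cpt_intros]:
  assumes "cpt Y f" "cpt Y g" shows "cpt Y (\<lambda>x. known (f x) (g x))"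
  unfolding known_def by (intro cpt_intros assms cpt_o[OF assms(1)])

lemma cpt_Phi [cpt_intros]:
  assumes "cpt Y f" "cpt Y g" "cpt Y h" "cpt Y k" "cpt Y l"
  shows "cpt Y (\<lambda>x. Phi (f x) (g x) (h x) (k x) (l x))"
  unfolding Phi_def by (intro cpt_intros assms)

lemma justified_mono:
  assumes "justified bs K j" "set K \<subseteq> set K'" "n \<le> length bs'" "take n bs' = bs"
  shows "justified bs' K' j"
proof -
  have l: "length bs \<le> length bs'" and n: "\<And>i. i < length bs \<Longrightarrow> hd (drop i bs) = hd (drop i bs')"
    using assms(3,4) by (auto simp: hd_drop_conv_nth)
  obtain t xs y where j: "j = (t, xs, y)" by (cases j)
  show ?thesis
    using assms(1,2) l n unfolding justified_def j prod.case
    by (elim disjE conjE; simp split: if_splits; blast)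
qed

lemma known_mono_stage: "s \<le> s' \<Longrightarrow> set (known bs s) \<subseteq> set (known bs s')"
  by (induction s') (auto simp: le_Suc_eq)

lemma known_mono_string:
  assumes "n \<le> length bs'" shows "set (known (take n bs') s) \<subseteq> set (known bs' s)"
proof (induction s)
  case (Suc s)
  then show ?case using justified_mono[OF _ Suc assms refl] by auto
qed simp

lemma Phi_mono:
  assumes "Phi s (take s bs) t xs y" "s \<le> s'" "s \<le> length bs"
  shows "Phi s' (take s' bs) t xs y"
proof -
  have "take s bs = take s (take s' bs)" using assms(2) by (simp add: min_def)
  then have "set (known (take s bs) s) \<subseteq> set (known (take s' bs) s)"
    using known_mono_string[of s "take s' bs" s] assms(2,3) by simp
  then show ?thesis using assms(1) known_mono_stage[OF assms(2)] unfolding Phi_def by blast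
qed

lemma justified_sound:
  assumes j: "justified bs K (t, xs, y)" and K: "\<And>t xs y. (t, xs, y) \<in> set K \<Longrightarrow> ev Y t xs y"
    and Y: "extends Y bs"
  shows "ev Y t xs y"
proof (cases t)
  case Zero then show ?thesis using j by (simp add: justified_def ev.ev_zero)
next
  case Succ then show ?thesis using j by (cases xs) (simp_all add: justified_def ev.ev_succ)
next
  case (Proj i) then show ?thesis using j by (simp add: justified_def hd_drop_conv_nth ev.ev_proj)
next
  case Oracle
  then obtain x xs' where x: "xs = x # xs'" "x < length bs" "y = of_bool (bs ! x)"
    using j by (cases xs) (auto simp: justified_def hd_drop_conv_nth)
  then have "y = (if Y x then 1 else 0)" using Y by (simp add: extends_def)
  then show ?thesis using Oracle x ev.ev_oracle by metis
next
  case (Comp f gs)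
  then obtain ys where ys: "(f, ys, y) \<in> set K" "length ys = length gs"
      "\<forall>i<length gs. (hd (drop i gs), xs, hd (drop i ys)) \<in> set K"
    using j by (auto simp: justified_def)
  have "list_all2 (\<lambda>g y. ev Y g xs y) gs ys"
    using ys(2,3) K by (auto simp: list_all2_conv_all_nth hd_drop_conv_nth)
  then show ?thesis using Comp ev.ev_comp K[OF ys(1)] by blast
next
  case (Prec f g)
  then obtain x xs' where x: "xs = x # xs'" using j by (cases xs) (auto simp: justified_def)
  show ?thesis
  proof (cases x)
    case 0
    then have "(f, xs', y) \<in> set K" using j Prec x by (simp add: justified_def)
    then show ?thesis using Prec x 0 K ev.ev_prec0 by blast
  next
    case (Suc n)
    then obtain r where "(Prec f g, n # xs', r) \<in> set K" "(g, n # r # xs', y) \<in> set K"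
      using j Prec x by (auto simp: justified_def)
    then show ?thesis using Prec x Suc K ev.ev_precS by blast
  qed
next
  case (Mn f)
  then have "(f, y # xs, 0) \<in> set K" "\<forall>z<y. \<exists>q\<in>set K. fst q = f \<and> fst (snd q) = z # xs \<and> 0 < snd (snd q)"
    using j by (auto simp: justified_def)
  then have "ev Y f (y # xs) 0" "\<forall>z<y. \<exists>v. 0 < v \<and> ev Y f (z # xs) v"
    using K by (blast, metis prod.collapse)
  then show ?thesis using Mn by (simp add: ev.ev_mn)
qed

lemma Phi_sound:
  assumes "extends Y bs" shows "Phi s bs t xs y \<Longrightarrow> ev Y t xs y"
  unfolding Phi_def
proof (induction s arbitrary: t xs y)
  case (Suc s)
  show ?case
  proof (cases "(t, xs, y) \<in> set (known bs s)")
    case False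
    then have "justified bs (known bs s) (t, xs, y)" using Suc.prems by (auto split: if_splits)
    then show ?thesis using Suc.IH assms by (rule justified_sound)
  qed (use Suc.IH in blast)
qed simp

text \<open>One number bounds both the stage and the length of the oracle prefix, so that the bounds
  for finitely many premises merge into their maximum.\<close>

definition settled :: "(nat \<Rightarrow> bool) \<Rightarrow> judgement \<Rightarrow> nat \<Rightarrow> bool" where
  "settled Y j N \<longleftrightarrow> (\<forall>s\<ge>N. \<forall>bs. N \<le> length bs \<longrightarrow> extends Y bs \<longrightarrow> j \<in> set (known bs s))"

lemma settled_mono: "settled Y j N \<Longrightarrow> N \<le> M \<Longrightarrow> settled Y j M"
  unfolding settled_def by (meson le_trans)

lemma settled_step:
  assumes "\<And>s bs. N \<le> s \<Longrightarrow> N \<le> length bs \<Longrightarrow> extends Y bs \<Longrightarrow> justified bs (known bs s) j"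
  shows "\<exists>N. settled Y j N"
proof
  \<comment> \<open>At this stage \<open>j\<close> is the candidate, and the second component makes
    the stage at least \<open>N\<close>.\<close>
  let ?s = "prod_encode (code j, N)"
  show "settled Y j (Suc ?s)"
    unfolding settled_def
  proof (intro allI impI)
    fix s bs assume *: "Suc ?s \<le> s" "Suc ?s \<le> length bs" "extends Y bs"
    have "N \<le> ?s" by (rule le_prod_encode_2)
    then have "justified bs (known bs ?s) j" using * by (intro assms) auto
    then have "j \<in> set (known bs (Suc ?s))" by simp
    then show "j \<in> set (known bs s)" using known_mono_stage[OF *(1)] by blast
  qed
qed

lemma settled_bound:
  assumes "finite J" "\<And>j. j \<in> J \<Longrightarrow> \<exists>N. settled Y j N"
  shows "\<exists>N. \<forall>j\<in>J. settled Y j N"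
  using assms
proof (induction rule: finite_induct)
  case (insert j J)
  then obtain N M where "\<forall>j\<in>J. settled Y j N" "settled Y j M" by blast
  then have "settled Y i (max N M)" if "i \<in> insert j J" for i
    using that settled_mono[OF _ max.cobounded1, of Y i N M] settled_mono[OF _ max.cobounded2, of Y i M N] by blast
  then show ?case by blast
qed simp

lemma settledD: "settled Y j N \<Longrightarrow> N \<le> s \<Longrightarrow> N \<le> length bs \<Longrightarrow> extends Y bs \<Longrightarrow> j \<in> set (known bs s)"
  by (simp add: settled_def)

lemma ev_settled: "ev Y t xs y \<Longrightarrow> \<exists>N. settled Y (t, xs, y) N"
proof (induction rule: ev.induct)
  case (ev_zero xs) show ?case by (rule settled_step) (simp add: justified_def)
next
  case (ev_succ x xs) show ?case by (rule settled_step) (simp add: justified_def)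
next
  case (ev_proj i xs) then show ?case by (intro settled_step) (simp add: justified_def hd_drop_conv_nth)
next
  case (ev_comp xs gs ys f z)
  have len: "length gs = length ys" using ev_comp.IH(1) by (rule list_all2_lengthD)
  let ?J = "insert (f, ys, z) ((\<lambda>i. (gs ! i, xs, ys ! i)) ` {..<length gs})"
  have i: "\<exists>N. settled Y (gs ! i, xs, ys ! i) N" if "i < length gs" for i
    using list_all2_nthD[OF ev_comp.IH(1) that] by (rule conjunct2)
  have "\<exists>N. settled Y j N" if "j \<in> ?J" for j
    using that
  proof
    assume "j = (f, ys, z)" then show ?thesis using ev_comp.IH(2) by simp
  next
    assume "j \<in> (\<lambda>i. (gs ! i, xs, ys ! i)) ` {..<length gs}"
    then show ?thesis by (elim imageE) (simp add: i)
  qed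
  then obtain N where N: "\<forall>j\<in>?J. settled Y j N" using settled_bound[of ?J] by blast
  show ?case
  proof (rule settled_step)
    fix s bs assume *: "N \<le> s" "N \<le> length bs" "extends Y bs"
    have "\<forall>j\<in>?J. j \<in> set (known bs s)" using N settledD[OF _ *] by blast
    then show "justified bs (known bs s) (Comp f gs, xs, z)"
      using len by (auto simp: justified_def hd_drop_conv_nth intro!: bexI[of _ "(f, ys, z)"])
  qed
next
  case (ev_prec0 f xs z g)
  then obtain N where N: "settled Y (f, xs, z) N" by blast
  then show ?case by (intro settled_step[of N]) (auto simp: justified_def settledD)
next
  case (ev_precS f g n xs r z)
  then obtain N M where "settled Y (Prec f g, n # xs, r) N" "settled Y (g, n # r # xs, z) M" by blast
  then show ?case
    by (intro settled_step[of "max N M"])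
      (auto simp: justified_def settledD intro!: bexI[of _ "(Prec f g, n # xs, r)"])
next
  case (ev_mn f y xs)
  then obtain v where v: "\<And>z. z < y \<Longrightarrow> 0 < v z \<and> (\<exists>N. settled Y (f, z # xs, v z) N)" by metis
  let ?J = "insert (f, y # xs, 0) ((\<lambda>z. (f, z # xs, v z)) ` {..<y})"
  have "\<exists>N. settled Y j N" if "j \<in> ?J" for j
    using that ev_mn.IH(1) v by auto
  then obtain N where N: "\<forall>j\<in>?J. settled Y j N" using settled_bound[of ?J] by blast
  show ?case
  proof (rule settled_step)
    fix s bs assume *: "N \<le> s" "N \<le> length bs" "extends Y bs"
    have m: "\<forall>j\<in>?J. j \<in> set (known bs s)" using N settledD[OF _ *] by blast
    have "\<exists>q\<in>set (known bs s). fst q = f \<and> fst (snd q) = z # xs \<and> 0 < snd (snd q)" if "z < y" for z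
      using m v[OF that] that by (intro bexI[of _ "(f, z # xs, v z)"]) auto
    then show "justified bs (known bs s) (Mn f, xs, y)"
      using m by (simp add: justified_def)
  qed
next
  case (ev_oracle x xs)
  show ?case
    by (rule settled_step[of "Suc x"]) (auto simp: justified_def hd_drop_conv_nth extends_def)
qed

lemma Phi_complete:
  assumes "ev Y t xs y"
  shows "\<exists>N. \<forall>s\<ge>N. \<forall>bs. N \<le> length bs \<longrightarrow> extends Y bs \<longrightarrow> Phi s bs t xs y"
  using ev_settled[OF assms] unfolding settled_def Phi_def .

section \<open>Strings, measure and dyadic approximations\<close>

primrec strs :: "nat \<Rightarrow> bool list list" where
  "strs 0 = [[]]"
| "strs (Suc n) = map (Cons True) (strs n) @ map (Cons False) (strs n)"

lemma set_strs [simp]: "set (strs n) = {bs. length bs = n}"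
proof (induction n)
  case (Suc n)
  show ?case
  proof (intro set_eqI)
    fix bs :: "bool list"
    show "bs \<in> set (strs (Suc n)) \<longleftrightarrow> bs \<in> {bs. length bs = Suc n}"
      using Suc by (cases bs; cases "hd bs") auto
  qed
qed auto

lemma distinct_strs: "distinct (strs n)"
  by (induction n) (auto simp: distinct_map)

lemma cpt_strs [cpt_intros]:
  assumes "cpt Y f" shows "cpt Y (\<lambda>x. strs (f x))"
proof -
  have c: "cpt Y (\<lambda>x. rec_nat [[]] (\<lambda>_ r. map (\<lambda>bs. True # bs) r @ map (\<lambda>bs. False # bs) r) (f x))"
    by (intro cpt_intros assms)
  have e: "rec_nat [[]] (\<lambda>_ r. map (\<lambda>bs. True # bs) r @ map (\<lambda>bs. False # bs) r) n = strs n" for n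
    by (induction n) auto
  show ?thesis by (rule cpt_cong[OF c]) (rule e)
qed

section \<open>Counting strings of a fixed length as dyadic measure\<close>

definition cnt :: "nat \<Rightarrow> (bool list \<Rightarrow> bool) \<Rightarrow> nat" where
  "cnt n P = card {bs. length bs = n \<and> P bs}"

lemma cnt_filter: "cnt n P = length (filter P (strs n))"
proof -
  have "{bs. length bs = n \<and> P bs} = set (filter P (strs n))" by auto
  then show ?thesis unfolding cnt_def by (simp only: distinct_card[OF distinct_filter[OF distinct_strs]])
qed

lemma cpt_cnt [cpt_intros]:
  assumes "cpt Y f" "cpt Y (\<lambda>p. P (fst p) (snd p))" shows "cpt Y (\<lambda>x. cnt (f x) (P x))"
  unfolding cnt_filter by (intro cpt_intros assms)

lemma finite_strings [simp]: "finite {bs::bool list. length bs = n \<and> P bs}"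
  by (rule finite_subset[OF _ finite_set[of "strs n"]]) auto

lemma cnt_mono: "(\<And>bs. length bs = n \<Longrightarrow> P bs \<Longrightarrow> Q bs) \<Longrightarrow> cnt n P \<le> cnt n Q"
  unfolding cnt_def by (rule card_mono) auto

lemma cnt_cong: "(\<And>bs. length bs = n \<Longrightarrow> P bs = Q bs) \<Longrightarrow> cnt n P = cnt n Q"
  by (intro antisym cnt_mono) auto

lemma length_strs: "length (strs n) = 2 ^ n"
  by (induction n) auto

lemma cnt_le: "cnt n P \<le> 2 ^ n"
  unfolding cnt_filter using length_filter_le[of P "strs n"] by (simp add: length_strs)

lemma cnt_disj: "cnt n (\<lambda>bs. P bs \<or> Q bs) \<le> cnt n P + cnt n Q"
proof -
  have "{bs. length bs = n \<and> (P bs \<or> Q bs)} = {bs. length bs = n \<and> P bs} \<union> {bs. length bs = n \<and> Q bs}" by auto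
  then show ?thesis unfolding cnt_def by (simp only: card_Un_le)
qed

lemma cnt_disjoint:
  assumes "\<And>bs. length bs = n \<Longrightarrow> P bs \<Longrightarrow> Q bs \<Longrightarrow> False"
  shows "cnt n (\<lambda>bs. P bs \<or> Q bs) = cnt n P + cnt n Q"
proof -
  have "{bs. length bs = n \<and> (P bs \<or> Q bs)} = {bs. length bs = n \<and> P bs} \<union> {bs. length bs = n \<and> Q bs}" by auto
  moreover have "card ({bs. length bs = n \<and> P bs} \<union> {bs. length bs = n \<and> Q bs})
      = card {bs. length bs = n \<and> P bs} + card {bs. length bs = n \<and> Q bs}"
    by (rule card_Un_disjoint) (use assms in auto)
  ultimately show ?thesis unfolding cnt_def by simp
qed

lemma cnt_lift: "cnt (n + k) (\<lambda>bs. P (take n bs)) = 2 ^ k * cnt n P"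
proof -
  have "bij_betw (\<lambda>(bs, \<rho>). bs @ \<rho>) ({bs. length bs = n \<and> P bs} \<times> {\<rho>. length \<rho> = k \<and> True})
      {bs. length bs = n + k \<and> P (take n bs)}"
    by (rule bij_betw_byWitness[where f' = "\<lambda>bs. (take n bs, drop n bs)"]) auto
  then have "cnt (n + k) (\<lambda>bs. P (take n bs)) = card ({bs. length bs = n \<and> P bs} \<times> {\<rho>::bool list. length \<rho> = k \<and> True})"
    unfolding cnt_def by (rule bij_betw_same_card[symmetric])
  also have "\<dots> = cnt n P * cnt k (\<lambda>_. True)" by (simp add: cnt_def card_cartesian_product)
  finally show ?thesis by (simp add: cnt_filter[of k] length_strs)
qed

lemma cnt_lift': "n \<le> m \<Longrightarrow> cnt m (\<lambda>bs. P (take n bs)) = 2 ^ (m - n) * cnt n P"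
  using cnt_lift[of n "m - n" P] by simp

text \<open>Double counting of pairs of an index and a string; it is the source of Markov's
  inequality for the Solovay test below.\<close>

lemma cnt_sum:
  "(\<Sum>s\<in>S. cnt n (P s)) = (\<Sum>bs | length bs = n. card {s\<in>S. P s bs})" if "finite S"
proof -
  have fin: "finite {bs::bool list. length bs = n}" using finite_strings[of n "\<lambda>_. True"] by simp
  have "cnt n (P s) = (\<Sum>bs | length bs = n. if P s bs then 1 else 0)" for s
    using sum.inter_filter[OF fin, of "\<lambda>_. 1::nat" "P s"] by (simp add: cnt_def)
  then have "(\<Sum>s\<in>S. cnt n (P s)) = (\<Sum>s\<in>S. \<Sum>bs | length bs = n. if P s bs then 1 else 0)"
    by simp
  also have "\<dots> = (\<Sum>bs | length bs = n. \<Sum>s\<in>S. if P s bs then 1 else 0)" by (rule sum.swap)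
  also have "\<dots> = (\<Sum>bs | length bs = n. card {s\<in>S. P s bs})"
    using sum.inter_filter[OF that, of "\<lambda>_. 1::nat"] by simp
  finally show ?thesis .
qed

definition gen_cnt :: "(bool list \<Rightarrow> bool) \<Rightarrow> nat \<Rightarrow> nat" where
  "gen_cnt W n = cnt n (\<lambda>bs. \<exists>cs. W cs \<and> length cs \<le> n \<and> take (length cs) bs = cs)"

lemma mu_open_alt: "mu_open W = (SUP n. real (gen_cnt W n) / 2 ^ n)"
  unfolding mu_open_def gen_cnt_def cnt_def by simp

lemma mu_open_le:
  assumes "\<And>n. real (gen_cnt W n) \<le> b * 2 ^ n" shows "mu_open W \<le> b"
  unfolding mu_open_alt by (rule cSUP_least) (use assms in \<open>auto simp: field_simps\<close>)

lemma gen_cnt_le_mu_open: "real (gen_cnt W n) \<le> mu_open W * 2 ^ n"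
proof -
  have "bdd_above (range (\<lambda>n. real (gen_cnt W n) / 2 ^ n))"
  proof (rule bdd_aboveI2)
    fix n
    have "real (gen_cnt W n) \<le> real (2 ^ n)" unfolding gen_cnt_def by (rule of_nat_mono) (rule cnt_le)
    then show "real (gen_cnt W n) / 2 ^ n \<le> 1" by simp
  qed
  then have "real (gen_cnt W n) / 2 ^ n \<le> mu_open W" unfolding mu_open_alt by (rule cSUP_upper[rotated]) simp
  then show ?thesis by (simp add: field_simps)
qed

text \<open>The tests constructed below are closed under extension of strings, so their measure at
  level \<open>n\<close> is a plain count.\<close>

lemma gen_cnt_upward:
  assumes "\<And>bs cs. W cs \<Longrightarrow> length cs \<le> length bs \<Longrightarrow> take (length cs) bs = cs \<Longrightarrow> W bs"
  shows "gen_cnt W n = cnt n W"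
  unfolding gen_cnt_def by (rule cnt_cong) (use assms in \<open>auto intro: exI[of _ "_ :: bool list"]\<close>)

lemma str_code_inj: "str_code bs = str_code cs \<Longrightarrow> bs = cs"
proof (induction bs arbitrary: cs)
  case Nil then show ?case by (cases cs) (auto split: if_splits)
next
  case (Cons b bs)
  then show ?case by (cases cs) (simp_all split: if_splits, presburger+)
qed

lemma cpt_str_code [cpt_intros]:
  assumes "cpt Y f" shows "cpt Y (\<lambda>x. str_code (f x))"
proof -
  have c: "cpt Y (\<lambda>x. fold (\<lambda>b r. 2 * r + (if b then 2 else 1)) (rev (f x)) (0::nat))"
    by (intro cpt_intros assms)
  have e: "fold (\<lambda>b r. 2 * r + (if b then 2 else 1)) (rev bs) 0 = str_code bs" for bs
    by (induction bs) auto
  show ?thesis by (rule cpt_cong[OF c]) (simp add: e)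
qed

lemma unif_ce_decidable:
  assumes "cpt no_oracle (\<lambda>p. W (fst p) (snd p))" shows "unif_ce W"
proof -
  \<comment> \<open>The string is recovered from its code by search through all lengths, which
    avoids a program for the inverse of \<open>str_code\<close>.\<close>
  let ?R = "\<lambda>n k. \<exists>s. \<exists>bs\<in>set (strs s). str_code bs = k \<and> W n bs"
  have "ce_rel2 ?R"
    by (intro ce_rel2_search cpt_intros cpt_2[OF assms])
  moreover have "W n bs \<longleftrightarrow> ?R n (str_code bs)" for n bs
    using str_code_inj by auto
  ultimately show ?thesis unfolding unif_ce_def by blast
qed

definition pre :: "(nat \<Rightarrow> bool) \<Rightarrow> nat \<Rightarrow> bool list" where
  "pre Y n = map Y [0..<n]"

lemma length_pre [simp]: "length (pre Y n) = n" by (simp add: pre_def)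
lemma extends_pre [simp]: "extends Y (pre Y n)" by (simp add: pre_def extends_def)
lemma take_pre [simp]: "take m (pre Y n) = pre Y (min m n)" by (simp add: pre_def take_map min_def)
lemma extends_iff_pre: "extends Y bs \<longleftrightarrow> bs = pre Y (length bs)"
  unfolding list_eq_iff_nth_eq by (auto simp: extends_def pre_def)

lemma cpt_pre: "cpt Y f \<Longrightarrow> cpt Y (\<lambda>x. pre Y (f x))"
  unfolding pre_def by (intro cpt_intros cpt_o[OF cpt_oracle])

lemma cpt_pre_no_oracle [cpt_intros]: "cpt Y f \<Longrightarrow> cpt Y (\<lambda>x. pre no_oracle (f x))"
  by (rule cpt_o[OF cpt_oracle_free[OF cpt_pre[OF cpt_id]]])

text \<open>Lower approximations with denominator \<open>2 ^ s\<close>, so that all constructions below compute with naturals.\<close>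
definition dyadic_lower :: "(nat \<Rightarrow> nat \<Rightarrow> nat) \<Rightarrow> (nat \<Rightarrow> nat \<Rightarrow> real) \<Rightarrow> bool" where
  "dyadic_lower l c \<longleftrightarrow> cpt no_oracle (\<lambda>p. l (fst p) (snd p))
     \<and> (\<forall>x s. real (l x s) \<le> 2 ^ s * c x s \<and> 2 ^ s * c x s \<le> real (l x s) + 3)"

text \<open>The floor of \<open>max 0 (rat_of_code k) * 2 ^ s\<close>: \<open>int_decode\<close>
  maps the even codes to the nonnegative integers, and the odd codes, which give negative ones, are
  cut to 0.\<close>

definition floor_code :: "nat \<Rightarrow> nat \<Rightarrow> nat" where
  "floor_code k s = (let p = fst (prod_decode k); q = snd (prod_decode k) in
      ((if p mod 2 = 0 then p div 2 else 0) * 2 ^ s) div Suc q)"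

lemma cpt_floor_code [cpt_intros]:
  "cpt Y f \<Longrightarrow> cpt Y g \<Longrightarrow> cpt Y (\<lambda>x. floor_code (f x) (g x))"
  unfolding floor_code_def Let_def by (intro cpt_intros)

lemma floor_code:
  "real (floor_code k s) \<le> max 0 (rat_of_code k) * 2 ^ s" "max 0 (rat_of_code k) * 2 ^ s < real (floor_code k s) + 1"
proof -
  obtain p q where k: "prod_decode k = (p, q)" by (cases "prod_decode k")
  define a where "a = (if p mod 2 = 0 then p div 2 else 0)"
  have "max 0 (rat_of_code k) = real a / real (Suc q)"
  proof (cases "even p")
    case True
    then have "int_decode p = int a" by (simp add: int_decode_def sum_decode_def a_def)
    then show ?thesis by (simp add: rat_of_code_def k)
  next
    case False
    then have "int_decode p < 0" by (simp add: int_decode_def sum_decode_def)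
    then have "rat_of_code k < 0" by (simp add: rat_of_code_def k divide_neg_pos)
    then show ?thesis using False by (simp add: a_def mod2_eq_if)
  qed
  then have e: "max 0 (rat_of_code k) * 2 ^ s = real (a * 2 ^ s) / real (Suc q)" by simp
  have f: "floor_code k s = (a * 2 ^ s) div Suc q" by (simp add: floor_code_def k a_def)
  show "real (floor_code k s) \<le> max 0 (rat_of_code k) * 2 ^ s"
  proof -
    have "real ((a * 2 ^ s) div Suc q * Suc q) \<le> real (a * 2 ^ s)"
      by (rule of_nat_mono) (rule div_times_less_eq_dividend)
    then show ?thesis unfolding e f by (subst pos_le_divide_eq) (simp_all only: of_nat_mult of_nat_0_less_iff zero_less_Suc)
  qed
  have "a * 2 ^ s < Suc q * Suc ((a * 2 ^ s) div Suc q)"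
    by (metis dividend_less_times_div mult_Suc_right zero_less_Suc)
  then have "real (a * 2 ^ s) < real (Suc q) * (real ((a * 2 ^ s) div Suc q) + 1)"
    by (metis of_nat_Suc of_nat_less_iff of_nat_mult add.commute)
  then show "max 0 (rat_of_code k) * 2 ^ s < real (floor_code k s) + 1"
    unfolding e f by (subst pos_divide_less_eq) (auto simp: mult.commute)
qed

lemma dyadic_lower_exists:
  assumes "computable_real2 c" "\<And>x s. 0 \<le> c x s"
  shows "\<exists>l. dyadic_lower l c"
proof -
  obtain g where g: "computable3 g" "\<And>x s n. \<bar>rat_of_code (g x s n) - c x s\<bar> \<le> (1/2) ^ n"
    using assms(1) unfolding computable_real2_def by blast
  \<comment> \<open>The approximation of \<open>c x s\<close> has error \<open>(1/2) ^ s\<close>,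
    that is 1 after scaling; subtracting 1 keeps the result a lower bound. Approximation, rounding
    and this subtraction each lose at most 1, whence the 3.\<close>
  define l where "l x s = floor_code (g x s s) s - 1" for x s
  have "cpt no_oracle (\<lambda>p. l (fst p) (snd p))"
    unfolding l_def by (intro cpt_intros cpt_3[OF computable3D[OF g(1)]])
  moreover have "real (l x s) \<le> 2 ^ s * c x s \<and> 2 ^ s * c x s \<le> real (l x s) + 3" for x s
  proof -
    define m where "m = max 0 (rat_of_code (g x s s))"
    have "\<bar>m - c x s\<bar> \<le> (1/2) ^ s" using g(2)[of x s s] assms(2)[of x s] by (auto simp: m_def)
    then have "\<bar>m - c x s\<bar> * 2 ^ s \<le> (1/2) ^ s * 2 ^ s" by (intro mult_right_mono) auto
    then have "\<bar>m * 2 ^ s - 2 ^ s * c x s\<bar> \<le> 1"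
      by (simp add: abs_mult left_diff_distrib[symmetric] power_divide mult.commute[of "2 ^ s" "c x s"])
    moreover have "0 \<le> 2 ^ s * c x s" using assms(2) by simp
    ultimately show ?thesis
      using floor_code[of "g x s s" s] unfolding l_def m_def[symmetric] by linarith
  qed
  ultimately show ?thesis unfolding dyadic_lower_def by blast
qed

section \<open>Captured random sets compute sets of small cost\<close>

lemmas finite_nat_boundE = finite_nat_set_iff_bounded[THEN iffD1, THEN exE]
lemmas eventually_sequentiallyE = eventually_sequentially[THEN iffD1, THEN exE]

text \<open>The universal machine on the empty oracle provides the enumeration: termination by stage
  \<open>s\<close> is read off the finite list \<open>known\<close>, which only grows.\<close>

lemma ce_rel2_stages:
  assumes "ce_rel2 R"
  shows "\<exists>Rs :: nat \<Rightarrow> nat \<Rightarrow> nat \<Rightarrow> bool. (\<forall>Y. cpt Y (\<lambda>p. Rs (fst p) (fst (snd p)) (snd (snd p))))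
    \<and> (\<forall>s s' x y. Rs s x y \<longrightarrow> s \<le> s' \<longrightarrow> Rs s' x y) \<and> (\<forall>x y. R x y \<longleftrightarrow> (\<exists>s. Rs s x y))"
proof -
  obtain t where t: "\<And>x y. R x y \<longleftrightarrow> (\<exists>v. ev no_oracle t [x, y] v)" using assms unfolding ce_rel2_def by blast
  define Rs where "Rs s x y \<longleftrightarrow> (\<exists>q\<in>set (known (pre no_oracle s) s). fst q = t \<and> fst (snd q) = [x, y])" for s x y
  have Phi: "Rs s x y \<longleftrightarrow> (\<exists>v. Phi s (pre no_oracle s) t [x, y] v)" for s x y
    unfolding Rs_def Phi_def by (auto intro!: bexI[rotated])
  show ?thesis
  proof (intro exI[of _ Rs] conjI allI impI)
    show "cpt Y (\<lambda>p. Rs (fst p) (fst (snd p)) (snd (snd p)))" for Y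
      unfolding Rs_def by (intro cpt_intros)
    fix s s' x y assume "Rs s x y" "s \<le> s'"
    then obtain v where "Phi s (take s (pre no_oracle s')) t [x, y] v" unfolding Phi by auto
    from Phi_mono[OF this \<open>s \<le> s'\<close>] \<open>s \<le> s'\<close> show "Rs s' x y" unfolding Phi by auto
  next
    fix x y
    show "R x y \<longleftrightarrow> (\<exists>s. Rs s x y)"
    proof
      assume "R x y"
      then obtain v where "ev no_oracle t [x, y] v" unfolding t by blast
      from Phi_complete[OF this] obtain N where
        "\<forall>s\<ge>N. \<forall>bs. N \<le> length bs \<longrightarrow> extends no_oracle bs \<longrightarrow> Phi s bs t [x, y] v" by (elim exE)
      then have "Phi N (pre no_oracle N) t [x, y] v" by simp
      then show "\<exists>s. Rs s x y" unfolding Phi by blast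
    next
      assume "\<exists>s. Rs s x y"
      then show "R x y" unfolding Phi t using Phi_sound[OF extends_pre] by blast
    qed
  qed
qed

lemma limit_cost_upper:
  assumes "cost_function c" shows "c x s \<le> limit_cost c x" "limit_cost c x \<ge> 0"
    "(\<lambda>s. c x s) \<longlonglongrightarrow> limit_cost c x"
proof -
  show l: "(\<lambda>s. c x s) \<longlonglongrightarrow> limit_cost c x"
    using assms unfolding cost_function_def limit_cost_def by (simp add: convergent_LIMSEQ_iff)
  have "incseq (\<lambda>s. c x s)" using assms unfolding cost_function_def by (intro incseq_SucI) blast
  then show "c x s \<le> limit_cost c x" using l by (rule incseq_le)
  then show "limit_cost c x \<ge> 0" using assms unfolding cost_function_def by (meson order_trans)
qed

lemma cost_mono:
  assumes "cost_function c" shows "s \<le> s' \<Longrightarrow> c x s \<le> c x s'" "x \<le> x' \<Longrightarrow> c x' s \<le> c x s"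
proof -
  have "c x s \<le> c x (Suc s)" "c (Suc x) s \<le> c x s" for x s
    using assms unfolding cost_function_def by blast+
  then show "s \<le> s' \<Longrightarrow> c x s \<le> c x s'" "x \<le> x' \<Longrightarrow> c x' s \<le> c x s"
    using lift_Suc_mono_le[of "\<lambda>s. c x s"] lift_Suc_antimono_le[of "\<lambda>x. c x s"] by blast+
qed

lemma cost_term_nonneg: "cost_function c \<Longrightarrow> 0 \<le> cost_term c As s"
  by (simp add: cost_term_def cost_function_def)

text \<open>\<open>G m s\<close> below is the part of \<open>V m\<close> whose measure is at most \<open>B\<close> times \<open>c m s\<close>, and \<open>T s\<close> is the component of the
  Solovay test that belongs to the change of the approximation at stage \<open>s\<close>.\<close>
lemma obeys_captured_turing_le:
  assumes c: "cost_function c" and pos: "\<And>x. 0 < limit_cost c x" and A: "obeys A c"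
    and Y: "mlr_random Y" "captured c Y"
  shows "turing_le A Y"
proof -
  have c0: "0 \<le> c x s" for x s using c by (simp add: cost_function_def)
  obtain l where l: "dyadic_lower l c"
    using dyadic_lower_exists[of c] c by (auto simp: cost_function_def)
  have l_cpt: "cpt Z (\<lambda>p. l (fst p) (snd p))" for Z using l by (auto simp: dyadic_lower_def intro: cpt_oracle_free)
  obtain As where As: "computable_approx As A" and summ: "summable (cost_term c As)"
    using A unfolding obeys_def by blast
  have As_cpt: "cpt Z (\<lambda>p. As (fst p) (snd p))" for Z
  proof (rule cpt_of_code)
    have "cpt Z (\<lambda>p. (\<lambda>s x. if As s x then 1 else 0) (fst p) (snd p) :: nat)"
      by (rule computable2D) (use As in \<open>simp add: computable_approx_def\<close>)
    then show "cpt Z (\<lambda>p. code (As (fst p) (snd p)))" by (simp add: code_bool_def)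
  qed
  obtain V where V: "bounded_test c V" "\<And>n. Y \<in> open_gen (V n)" using Y(2) unfolding captured_def by blast
  obtain C where C: "\<And>n. mu_open (V n) \<le> C * limit_cost c n" using V(1) unfolding bounded_test_def by blast
  obtain R where R: "ce_rel2 R" "\<And>n bs. V n bs \<longleftrightarrow> R n (str_code bs)"
    using V(1) unfolding bounded_test_def unif_ce_def by blast
  obtain Rs :: "nat \<Rightarrow> nat \<Rightarrow> nat \<Rightarrow> bool" where Rs0: "\<forall>Y. cpt Y (\<lambda>p. Rs (fst p) (fst (snd p)) (snd (snd p)))"
    "\<forall>s s' x y. Rs s x y \<longrightarrow> s \<le> s' \<longrightarrow> Rs s' x y" "\<forall>x y. R x y \<longleftrightarrow> (\<exists>s. Rs s x y)"
    using ce_rel2_stages[OF R(1)] by (elim exE conjE)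
  have Rs: "\<And>Y. cpt Y (\<lambda>p. Rs (fst p) (fst (snd p)) (snd (snd p)))"
    "\<And>s s' x y. Rs s x y \<Longrightarrow> s \<le> s' \<Longrightarrow> Rs s' x y" "\<And>x y. R x y \<longleftrightarrow> (\<exists>s. Rs s x y)"
    using Rs0 by simp_all
  \<comment> \<open>Strictly above \<open>C\<close>: the gap absorbs the error of the lower
    approximations of the cost in \<open>G_ex\<close>.\<close>
  obtain B :: nat where B: "max C 0 < real B" using reals_Archimedean2 by blast

  define W where "W m r bs \<longleftrightarrow> (\<exists>k\<le>r. Rs r m (str_code (take k bs)))" for m r bs
  define N where "N m r = cnt r (W m r)" for m r
  \<comment> \<open>The measure \<open>N m r / 2 ^ r\<close> enumerated by stage \<open>r\<close> is
    compared with \<open>B\<close> times the lower approximation \<open>l m u / 2 ^ u\<close> of the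
    cost. Ranging over all \<open>r\<close> and \<open>u\<close> up to \<open>s\<close> makes
    \<open>G\<close> increase with \<open>s\<close>.\<close>
  define G where "G m s bs \<longleftrightarrow> (\<exists>r\<le>s. \<exists>u\<le>s. N m r * 2 ^ u \<le> B * l m u * 2 ^ r \<and> W m r (take r bs))" for m s bs
  have W_cpt: "cpt Z (\<lambda>p. W (fst p) (fst (snd p)) (snd (snd p)))" for Z
    unfolding W_def by (intro cpt_intros cpt_3[OF Rs(1)])
  have N_cpt: "cpt Z (\<lambda>p. N (fst p) (snd p))" for Z
    unfolding N_def by (intro cpt_intros cpt_3[OF W_cpt])
  have G_cpt: "cpt Z (\<lambda>p. G (fst p) (fst (snd p)) (snd (snd p)))" for Z
    unfolding G_def by (intro cpt_intros cpt_3[OF W_cpt] cpt_2[OF N_cpt] cpt_2[OF l_cpt])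
  have W_mono: "W m r' (take r' bs)" if "W m r (take r bs)" "r \<le> r'" for m r r' bs
  proof -
    obtain k where k: "k \<le> r" "Rs r m (str_code (take k (take r bs)))" using \<open>W m r (take r bs)\<close> unfolding W_def by blast
    moreover have "take k (take r bs) = take k (take r' bs)" using k(1) \<open>r \<le> r'\<close> by (simp add: min_def)
    ultimately show ?thesis unfolding W_def using Rs(2)[OF _ \<open>r \<le> r'\<close>] \<open>r \<le> r'\<close> by (metis le_trans)
  qed
  have N_le: "real (N m r) \<le> C * limit_cost c m * 2 ^ r" for m r
  proof -
    have "N m r \<le> gen_cnt (V m) r" unfolding N_def gen_cnt_def
    proof (rule cnt_mono)
      fix bs :: "bool list" assume "length bs = r" "W m r bs"
      then obtain k where "k \<le> r" "V m (take k bs)" unfolding W_def R(2) Rs(3) by blast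
      then show "\<exists>cs. V m cs \<and> length cs \<le> r \<and> take (length cs) bs = cs"
        using \<open>length bs = r\<close> by (intro exI[of _ "take k bs"]) (simp add: min_def)
    qed
    then have "real (N m r) \<le> mu_open (V m) * 2 ^ r" using gen_cnt_le_mu_open[of "V m" r] by linarith
    also have "\<dots> \<le> C * limit_cost c m * 2 ^ r" using C[of m] by (intro mult_right_mono) auto
    finally show ?thesis .
  qed
  have G_cnt: "real (cnt L (G m s)) \<le> B * c m s * 2 ^ L" if "s \<le> L" for L m s
  proof (cases "\<exists>r\<le>s. \<exists>u\<le>s. N m r * 2 ^ u \<le> B * l m u * 2 ^ r")
    case False
    then have "cnt L (G m s) = 0" unfolding G_def cnt_def by auto
    then show ?thesis using c0 by simp
  next
    case True
    define Q where "Q r \<longleftrightarrow> r \<le> s \<and> (\<exists>u\<le>s. N m r * 2 ^ u \<le> B * l m u * 2 ^ r)" for r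
    \<comment> \<open>\<open>W m\<close> grows with the stage, so the largest affordable stage
      contains the others and its measure alone bounds that of \<open>G\<close>.\<close>
    define r where "r = (GREATEST r. Q r)"
    have Qr: "Q r" unfolding r_def by (rule GreatestI_ex_nat[where b = s]) (use True in \<open>auto simp: Q_def\<close>)
    have rmax: "r' \<le> r" if "Q r'" for r' unfolding r_def by (rule Greatest_le_nat[where b = s]) (use that in \<open>auto simp: Q_def\<close>)
    obtain u where u: "u \<le> s" "N m r * 2 ^ u \<le> B * l m u * 2 ^ r" using Qr by (auto simp: Q_def)
    have "real (N m r * 2 ^ u) \<le> real (B * l m u * 2 ^ r)" using u(2) by (rule of_nat_mono)
    then have "real (N m r) * 2 ^ u \<le> B * real (l m u) * 2 ^ r" by simp
    also have "\<dots> \<le> B * (2 ^ u * c m u) * 2 ^ r"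
      using l by (intro mult_right_mono mult_left_mono) (auto simp: dyadic_lower_def)
    also have "\<dots> \<le> B * (2 ^ u * c m s) * 2 ^ r"
      using cost_mono(1)[OF c u(1)] by (intro mult_right_mono mult_left_mono) auto
    finally have Nr: "real (N m r) \<le> B * c m s * 2 ^ r" by (simp add: mult.assoc mult.left_commute)
    have GW: "cnt L (G m s) \<le> cnt L (\<lambda>bs. W m r (take r bs))"
    proof (rule cnt_mono)
      fix bs assume "G m s bs"
      then obtain r' where "Q r'" "W m r' (take r' bs)" unfolding G_def Q_def by blast
      then show "W m r (take r bs)" using W_mono rmax by blast
    qed
    have "r \<le> L" using Qr \<open>s \<le> L\<close> by (simp add: Q_def)
    then have "cnt L (G m s) \<le> 2 ^ (L - r) * N m r"
      using GW cnt_lift'[of r L "W m r"] by (simp add: N_def)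
    then have "real (cnt L (G m s)) \<le> real (2 ^ (L - r) * N m r)" by (rule of_nat_mono)
    also have "\<dots> = 2 ^ (L - r) * real (N m r)" by simp
    also have "\<dots> \<le> 2 ^ (L - r) * (B * c m s * 2 ^ r)" using Nr by (intro mult_left_mono) auto
    also have "\<dots> = B * c m s * (2 ^ (L - r) * 2 ^ r)" by simp
    also have "(2::real) ^ (L - r) * 2 ^ r = 2 ^ L" using \<open>r \<le> L\<close> by (simp flip: power_add)
    finally show ?thesis .
  qed

  \<comment> \<open>The disjunct \<open>s \<le> x\<close> keeps the search total; \<open>T\<close>
    discards the value \<open>s\<close> that it can produce.\<close>
  define lx where "lx s = (LEAST x. s \<le> x \<or> As (s - 1) x \<noteq> As s x)" for s
  have lx_cpt: "cpt Z lx" for Z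
    unfolding lx_def by (intro cpt_Least cpt_intros cpt_2[OF As_cpt]) auto
  define T where "T s bs \<longleftrightarrow> 0 < s \<and> lx s < s \<and> G (lx s) s (take s bs)" for s bs
  have T_cpt: "cpt Z (\<lambda>p. T (fst p) (snd p))" for Z
    unfolding T_def by (intro cpt_intros cpt_3[OF G_cpt] cpt_o[OF lx_cpt])
  have T_cnt: "real (cnt L (T s)) \<le> B * cost_term c As s * 2 ^ L" if "s \<le> L" for s L
  proof (cases "0 < s \<and> lx s < s")
    case False
    then have "cnt L (T s) = 0" unfolding T_def cnt_def by auto
    then show ?thesis using cost_term_nonneg[OF c] by simp
  next
    case True
    have ch: "As (s - 1) (lx s) \<noteq> As s (lx s)"
      using LeastI[of "\<lambda>x. s \<le> x \<or> As (s - 1) x \<noteq> As s x" s] True by (auto simp: lx_def)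
    have "(LEAST x. As (s - 1) x \<noteq> As s x) = lx s"
    proof (rule Least_equality)
      show "As (s - 1) (lx s) \<noteq> As s (lx s)" by (rule ch)
      fix y assume "As (s - 1) y \<noteq> As s y"
      then show "lx s \<le> y" unfolding lx_def by (intro Least_le) blast
    qed
    then have e: "cost_term c As s = c (lx s) s" using True ch by (auto simp: cost_term_def)
    have "cnt L (T s) \<le> cnt L (\<lambda>bs. G (lx s) s (take s bs))" by (rule cnt_mono) (simp add: T_def)
    also have "\<dots> = cnt L (G (lx s) s)"
      by (rule cnt_cong) (auto simp: G_def min_def)
    finally show ?thesis unfolding e using G_cnt[OF that, of "lx s"] by linarith
  qed
  have T_pre: "T s (pre Y n) = T s (pre Y s)" if "s \<le> n" for s n
    using that by (simp add: T_def min_def)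

  obtain M :: nat where M: "max 1 (B * suminf (cost_term c As)) < real M" using reals_Archimedean2 by blast
  \<comment> \<open>Markov's inequality: the components have total measure below \<open>M\<close>,
    so the oracles that lie in \<open>2 ^ k * M\<close> of them have measure at most
    \<open>(1/2) ^ k\<close>. This turns the Solovay test into a Martin-Loef test.\<close>
  define U where "U k bs \<longleftrightarrow> 2 ^ k * M \<le> length (filter (\<lambda>s. T s bs) [0..<Suc (length bs)])" for k bs
  have U_card: "U k bs \<longleftrightarrow> 2 ^ k * M \<le> card {s\<in>{..length bs}. T s bs}" for k bs
  proof -
    have "length (filter (\<lambda>s. T s bs) [0..<Suc (length bs)]) = card (set (filter (\<lambda>s. T s bs) [0..<Suc (length bs)]))"
      by (subst distinct_card) auto
    also have "set (filter (\<lambda>s. T s bs) [0..<Suc (length bs)]) = {s\<in>{..length bs}. T s bs}"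
      by (auto simp: le_less)
    finally show ?thesis unfolding U_def by simp
  qed
  have "mlr_test U" unfolding mlr_test_def
  proof (intro conjI allI)
    show "unif_ce U"
      unfolding U_def by (intro unif_ce_decidable cpt_intros cpt_2[OF T_cpt])
    fix k
    have up: "U k bs" if "U k cs" "length cs \<le> length bs" "take (length cs) bs = cs" for bs cs
    proof -
      have "T s bs = T s cs" if "s \<le> length cs" for s
        using that \<open>take (length cs) bs = cs\<close> unfolding T_def by (metis min.absorb1 take_take)
      then have "{s\<in>{..length cs}. T s cs} \<subseteq> {s\<in>{..length bs}. T s bs}" using that(2) by auto
      then have "card {s\<in>{..length cs}. T s cs} \<le> card {s\<in>{..length bs}. T s bs}" by (intro card_mono) auto
      then show ?thesis using that(1) unfolding U_card by linarith
    qed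
    show "mu_open (U k) \<le> (1/2) ^ k"
    proof (rule mu_open_le)
      fix L
      have "real (cnt L (U k)) * (2 ^ k * M) = (\<Sum>bs | length bs = L \<and> U k bs. 2 ^ k * real M)"
        by (simp add: cnt_def)
      also have "\<dots> \<le> (\<Sum>bs | length bs = L \<and> U k bs. real (card {s\<in>{..L}. T s bs}))"
      proof (rule sum_mono)
        fix bs assume "bs \<in> {bs. length bs = L \<and> U k bs}"
        then have "2 ^ k * M \<le> card {s\<in>{..L}. T s bs}" by (auto simp: U_card)
        then have "real (2 ^ k * M) \<le> real (card {s\<in>{..L}. T s bs})" by (rule of_nat_mono)
        then show "2 ^ k * real M \<le> real (card {s\<in>{..L}. T s bs})" by simp
      qed
      also have "\<dots> \<le> (\<Sum>bs | length bs = L. real (card {s\<in>{..L}. T s bs}))"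
        by (rule sum_mono2) (use finite_strings[of L "\<lambda>_. True"] in auto)
      also have "\<dots> = (\<Sum>s\<le>L. real (cnt L (T s)))"
        using cnt_sum[of "{..L}" L T] by (simp flip: of_nat_sum)
      also have "\<dots> \<le> (\<Sum>s\<le>L. B * cost_term c As s * 2 ^ L)"
        by (rule sum_mono) (simp add: T_cnt)
      also have "\<dots> = B * (\<Sum>s\<le>L. cost_term c As s) * 2 ^ L" by (simp add: sum_distrib_left sum_distrib_right)
      also have "\<dots> \<le> B * suminf (cost_term c As) * 2 ^ L"
        using cost_term_nonneg[OF c] by (intro mult_right_mono mult_left_mono sum_le_suminf[OF summ]) auto
      also have "\<dots> \<le> real M * 2 ^ L" using M by (intro mult_right_mono) auto
      finally have "real (cnt L (U k)) * 2 ^ k * M \<le> 2 ^ L * M" by (simp add: mult_ac)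
      then have "real (cnt L (U k)) * 2 ^ k \<le> 2 ^ L" using M by (simp add: mult_le_cancel_right)
      then have "real (cnt L (U k)) \<le> (1/2) ^ k * 2 ^ L" by (simp add: field_simps power_divide)
      then show "real (gen_cnt (U k) L) \<le> (1/2) ^ k * 2 ^ L" using gen_cnt_upward[of "U k" L] up by metis
    qed
  qed
  then obtain k where k: "Y \<notin> open_gen (U k)" using Y(1) unfolding mlr_random_def by blast
  have notU: "\<not> U k (pre Y n)" for n using k extends_pre[of Y n] unfolding open_gen_def by blast
  have "finite {s. T s (pre Y s)}"
  proof (rule ccontr)
    assume "infinite {s. T s (pre Y s)}"
    then obtain S where S: "finite S" "card S = 2 ^ k * M" "S \<subseteq> {s. T s (pre Y s)}"
      using infinite_arbitrarily_large by blast
    have "S \<subseteq> {s\<in>{..Max S}. T s (pre Y (Max S))}"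
    proof
      fix s assume "s \<in> S"
      then have "s \<le> Max S" "T s (pre Y s)" using S by auto
      then show "s \<in> {s\<in>{..Max S}. T s (pre Y (Max S))}" using T_pre[of s "Max S"] by simp
    qed
    then have "2 ^ k * M \<le> card {s\<in>{..Max S}. T s (pre Y (Max S))}"
      using S(2) card_mono[of "{s\<in>{..Max S}. T s (pre Y (Max S))}" S] by simp
    then show False using notU[of "Max S"] by (simp add: U_card)
  qed
  then obtain s0 where "\<forall>s\<in>{s. T s (pre Y s)}. s < s0"
    by (rule finite_nat_boundE)
  then have s0: "\<not> T s (pre Y s)" if "s0 \<le> s" for s
    using that by fastforce

  have G_mono: "G m s' (pre Y s')" if G: "G m s (pre Y s)" and le: "s \<le> s'" for m s s'
  proof -
    obtain r u where ru: "r \<le> s" "u \<le> s" "N m r * 2 ^ u \<le> B * l m u * 2 ^ r" "W m r (take r (pre Y s))"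
      using G unfolding G_def by blast
    have "take r (pre Y s) = take r (pre Y s')" using ru(1) le by simp
    with ru(4) have "W m r (take r (pre Y s'))" by (simp only:)
    then show ?thesis
      unfolding G_def using le ru by (intro exI[of _ r] conjI le_trans[OF ru(1)] exI[of _ u] le_trans[OF ru(2)])
  qed
  have G_ex: "\<exists>s. G m s (pre Y s)" for m
  proof -
    obtain cs where cs: "V m cs" "extends Y cs" using V(2)[of m] unfolding open_gen_def by blast
    then obtain r0 where r0: "Rs r0 m (str_code cs)" unfolding R(2) Rs(3) by blast
    define r where "r = max r0 (length cs)"
    have "Rs r m (str_code (take (length cs) (pre Y r)))"
      using Rs(2)[OF r0, of r] cs(2) unfolding extends_iff_pre by (simp add: r_def min_def)
    then have Wr: "W m r (pre Y r)" unfolding W_def by (intro exI[of _ "length cs"]) (simp add: r_def)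
    \<comment> \<open>As the limit cost is positive, \<open>B\<close> times it strictly exceeds
      \<open>C\<close> times it, so some lower approximation pays for all of
      \<open>V m\<close>.\<close>
    have "(\<lambda>u. B * (c m u - 3 * (1/2) ^ u)) \<longlonglongrightarrow> B * (limit_cost c m - 3 * 0)"
      by (intro tendsto_intros limit_cost_upper[OF c] LIMSEQ_realpow_zero) auto
    moreover have "C * limit_cost c m < B * (limit_cost c m - 3 * 0)"
      using B pos[of m] by simp
    ultimately have "\<forall>\<^sub>F u in sequentially. C * limit_cost c m < B * (c m u - 3 * (1/2) ^ u)"
      by (rule order_tendstoD)
    then obtain u where u: "C * limit_cost c m < B * (c m u - 3 * (1/2) ^ u)"
      by (auto simp: eventually_sequentially)
    have "2 ^ u * c m u - 3 \<le> real (l m u)" using l by (simp add: dyadic_lower_def algebra_simps)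
    then have "B * (2 ^ u * c m u - 3) \<le> B * real (l m u)" by (intro mult_left_mono) auto
    moreover have "B * (2 ^ u * c m u - 3) = B * (c m u - 3 * (1/2) ^ u) * 2 ^ u"
      by (simp add: algebra_simps power_divide)
    moreover have "C * limit_cost c m * 2 ^ u \<le> B * (c m u - 3 * (1/2) ^ u) * 2 ^ u"
      using u by (intro mult_right_mono) auto
    ultimately have *: "C * limit_cost c m * 2 ^ u \<le> B * real (l m u)" by linarith
    have "real (N m r) * 2 ^ u \<le> C * limit_cost c m * 2 ^ r * 2 ^ u" by (intro mult_right_mono N_le) auto
    also have "\<dots> = C * limit_cost c m * 2 ^ u * 2 ^ r" by simp
    also have "\<dots> \<le> B * real (l m u) * 2 ^ r" using * by (intro mult_right_mono) auto
    finally have "real (N m r * 2 ^ u) \<le> real (B * l m u * 2 ^ r)" by simp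
    then have "N m r * 2 ^ u \<le> B * l m u * 2 ^ r" unfolding of_nat_le_iff .
    then have "G m (max r u) (pre Y (max r u))"
      unfolding G_def using Wr by (intro exI[of _ r] conjI exI[of _ u]) simp_all
    then show ?thesis by blast
  qed
  \<comment> \<open>The reduction: wait past \<open>s0\<close> until \<open>Y\<close> shows up in
    the paid part of every \<open>V m\<close> with \<open>m \<le> n\<close>. A later change at or
    below \<open>n\<close> would put \<open>Y\<close> into a further component \<open>T s\<close>,
    which \<open>s0\<close> excludes. The condition \<open>n < s\<close> makes such a change visible
    to \<open>lx\<close>.\<close>
  define F where "F n = (LEAST s. s0 \<le> s \<and> n < s \<and> (\<forall>m\<le>n. G m s (pre Y s)))" for n
  have F_ex: "\<exists>s. s0 \<le> s \<and> n < s \<and> (\<forall>m\<le>n. G m s (pre Y s))" for n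
  proof -
    obtain g where g: "\<And>m. G m (g m) (pre Y (g m))" using G_ex by metis
    define s where "s = Max (insert s0 (insert (Suc n) (g ` {..n})))"
    have s: "s0 \<le> s" "Suc n \<le> s" "\<And>m. m \<le> n \<Longrightarrow> g m \<le> s" unfolding s_def by (rule Max_ge; simp)+
    have "G m s (pre Y s)" if "m \<le> n" for m by (rule G_mono[OF g s(3)[OF that]])
    then show ?thesis using s(1,2) by (intro exI[of _ s]) auto
  qed
  have F_cpt: "cpt Y F"
    unfolding F_def by (intro cpt_Least cpt_intros cpt_3[OF G_cpt] F_ex cpt_pre)
  have AsF: "As (F n) n \<longleftrightarrow> n \<in> A" for n
  proof -
    have F: "s0 \<le> F n" "n < F n" "\<And>m. m \<le> n \<Longrightarrow> G m (F n) (pre Y (F n))"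
      using LeastI_ex[OF F_ex[of n]] unfolding F_def by blast+
    have const: "As s n = As (F n) n" if "F n \<le> s" for s
      using that
    proof (induction s rule: dec_induct)
      case (step s)
      show ?case
      proof (rule ccontr)
        assume "As (Suc s) n \<noteq> As (F n) n"
        then have "As (Suc s - 1) n \<noteq> As (Suc s) n" using step.IH by simp
        then have "lx (Suc s) \<le> n" unfolding lx_def by (intro Least_le) blast
        then have "T (Suc s) (pre Y (Suc s))"
          using F G_mono[OF F(3)] step.hyps unfolding T_def by simp
        then show False using s0[of "Suc s"] F(1) step.hyps by simp
      qed
    qed simp
    obtain s1 where "\<forall>s\<ge>s1. As s n = (n \<in> A)" using As unfolding computable_approx_def by blast
    then show ?thesis using const[of "max s1 (F n)"] by simp
  qed
  have "cpt Y (\<lambda>n. As (F n) n)" by (intro cpt_2[OF As_cpt] F_cpt cpt_id)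
  then have "cpt Y (\<lambda>n. n \<in> A)" by (rule cpt_cong) (simp add: AsF)
  then show ?thesis unfolding cpt_def turing_le_def by (simp add: code_bool_def)
qed

section \<open>Random left-c.e. reals grow fastest\<close>

definition val :: "bool list \<Rightarrow> nat" where "val bs = fold (\<lambda>b r. 2 * r + of_bool b) bs 0"

lemma cpt_val [cpt_intros]: "cpt Y f \<Longrightarrow> cpt Y (\<lambda>x. val (f x))"
  unfolding val_def by (intro cpt_intros)

lemma val_snoc: "val (bs @ [b]) = 2 * val bs + of_bool b"
  by (simp add: val_def)

lemma val_inj: "length bs = length cs \<Longrightarrow> val bs = val cs \<Longrightarrow> bs = cs"
proof (induction bs arbitrary: cs rule: rev_induct)
  case (snoc b bs)
  then obtain b' cs' where cs: "cs = cs' @ [b']" by (cases cs rule: rev_cases) auto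
  have e: "2 * val bs + of_bool b = 2 * val cs' + of_bool b'" using snoc.prems(2) by (simp add: cs val_snoc)
  then have "b = b'" by (cases b; cases b') (simp_all, presburger+)
  moreover have "bs = cs'" using snoc.IH[of cs'] snoc.prems(1) e \<open>b = b'\<close> cs by simp
  ultimately show ?case using cs by simp
qed simp

lemma cnt_val: "cnt n (\<lambda>bs. a \<le> val bs \<and> val bs \<le> b) \<le> Suc b - a"
proof -
  have "card {bs. length bs = n \<and> a \<le> val bs \<and> val bs \<le> b} \<le> card {a..b}"
    by (rule card_inj_on_le[of val]) (auto intro!: inj_onI val_inj)
  then show ?thesis by (simp add: cnt_def)
qed

lemma cnt_UN:
  fixes S :: nat
  shows "cnt n (\<lambda>bs. \<exists>s<S. P s bs) \<le> (\<Sum>s<S. cnt n (P s))"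
proof (induction S)
  case 0 then show ?case by (simp add: cnt_def)
next
  case (Suc S)
  have "cnt n (\<lambda>bs. \<exists>s<Suc S. P s bs) = cnt n (\<lambda>bs. (\<exists>s<S. P s bs) \<or> P S bs)"
    by (rule cnt_cong) (auto simp: less_Suc_eq)
  also have "\<dots> \<le> cnt n (\<lambda>bs. \<exists>s<S. P s bs) + cnt n (P S)" by (rule cnt_disj)
  finally show ?case using Suc by simp
qed

lemma val_bin_expansion:
  assumes "0 \<le> x" "x < 1" shows "int (val (pre (bin_expansion x) n)) = \<lfloor>x * 2 ^ n\<rfloor>"
proof (induction n)
  case 0
  have "\<lfloor>x\<rfloor> = 0" using assms by linarith
  then show ?case by (simp add: pre_def val_def)
next
  case (Suc n)
  define y where "y = x * 2 ^ n"
  have "pre (bin_expansion x) (Suc n) = pre (bin_expansion x) n @ [bin_expansion x n]" by (simp add: pre_def)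
  moreover have "bin_expansion x n = odd \<lfloor>2 * y\<rfloor>" by (simp add: bin_expansion_def y_def mult_ac)
  ultimately have "int (val (pre (bin_expansion x) (Suc n))) = 2 * \<lfloor>y\<rfloor> + of_bool (odd \<lfloor>2 * y\<rfloor>)"
    using Suc by (simp add: val_snoc y_def)
  also have "\<dots> = \<lfloor>2 * y\<rfloor>"
  proof -
    have "\<lfloor>2 * y\<rfloor> = 2 * \<lfloor>y\<rfloor> \<or> \<lfloor>2 * y\<rfloor> = 2 * \<lfloor>y\<rfloor> + 1" by linarith
    then show ?thesis by auto
  qed
  finally show ?case by (simp add: y_def mult_ac)
qed

text \<open>In the test with parameter \<open>k\<close>, stage \<open>s\<close> acts once \<open>Op s\<close> has left the last interval; it then enumerates an
  interval starting at \<open>Op s\<close> whose length is \<open>(1/2) ^ k\<close> times the increase of \<open>a s / 2 ^ s\<close> since the last action.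
  If \<open>Omega\<close> avoids all intervals then \<open>Op\<close> moves over each of them, so it grows at least that fast.\<close>
lemma random_left_ce_dominates:
  fixes w :: "nat \<Rightarrow> nat \<Rightarrow> nat" and a :: "nat \<Rightarrow> nat" and Op :: "nat \<Rightarrow> real"
  assumes w_cpt: "cpt no_oracle (\<lambda>p. w (fst p) (snd p))" and a_cpt: "cpt no_oracle a"
    and w: "\<And>s k. real (w s k) \<le> Op s * 2 ^ k" "\<And>s k. Op s * 2 ^ k < real (w s k) + 1"
    and Op: "mono Op" "Op \<longlonglongrightarrow> Omega" and Omega: "0 < Omega" "Omega < 1"
    and random: "mlr_random (bin_expansion Omega)"
    and a_mono: "mono (\<lambda>s. real (a s) / 2 ^ s)" and a_le: "\<And>s. real (a s) / 2 ^ s \<le> 1"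
  shows "\<exists>K>0. \<forall>n m. real (a m) / 2 ^ m - real (a n) / 2 ^ n \<le> K * (Omega - Op n)"
proof -
  define al where "al s = real (a s) / 2 ^ s" for s
  have al_mono: "s \<le> s' \<Longrightarrow> al s \<le> al s'" for s s' using a_mono by (auto simp: al_def mono_def)
  have al_le: "al s \<le> 1" and al_ge: "0 \<le> al s" for s using a_le by (auto simp: al_def)
  have Op_le: "Op s \<le> Omega" for s using Op by (simp add: incseq_le mono_def incseq_def)
  \<comment> \<open>In units of \<open>(1/2) ^ (s + k + 2)\<close>: an integer bound above
    \<open>Op s\<close>, plus the increase of \<open>a s / 2 ^ s\<close> since the last action
    scaled by \<open>2 ^ (s + 2)\<close>, which amounts to \<open>(1/2) ^ k\<close> times that
    increase.\<close>
  define T' where "T' k s last = w s (s + k + 2) + 1 + (4 * a s - a last * 2 ^ (s + 2 - last))" for k s last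
  define step where "step k s x = (if fst (snd x) \<le> w s (snd (snd x)) then (s, T' k s (fst x), s + k + 2) else x)"
    for k s and x :: "nat \<times> nat \<times> nat"
  define st where "st k s = rec_nat (0, 0, 0) (step k) s" for k s
  define last where "last k s = fst (st k s)" for k s
  define top where "top k s = real (fst (snd (st k s))) / 2 ^ snd (snd (st k s))" for k s
  define act where "act k s \<longleftrightarrow> fst (snd (st k s)) \<le> w s (snd (snd (st k s)))" for k s
  have st_cpt: "cpt Y (\<lambda>p. st (fst p) (snd p))" for Y
    unfolding st_def step_def T'_def
    by (intro cpt_intros cpt_2[OF cpt_oracle_free[OF w_cpt]] cpt_o[OF cpt_oracle_free[OF a_cpt]])
  have st0: "st k 0 = (0, 0, 0)" for k by (simp add: st_def)
  have stS: "st k (Suc s) = (if act k s then (s, T' k s (last k s), s + k + 2) else st k s)" for k s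
    unfolding act_def last_def st_def by (simp add: step_def)
  have act_iff: "act k s \<longleftrightarrow> top k s \<le> Op s" for k s
  proof -
    let ?T = "fst (snd (st k s))" and ?r = "snd (snd (st k s))"
    have "act k s \<longleftrightarrow> real ?T \<le> Op s * 2 ^ ?r"
      unfolding act_def using w(1)[of s ?r] w(2)[of s ?r] by linarith
    then show ?thesis unfolding top_def by (simp add: field_simps)
  qed
  have last_le: "last k s = 0 \<or> last k s < s \<and> act k (last k s)" for k s
  proof (induction s)
    case 0 then show ?case by (simp add: last_def st0)
  next
    case (Suc s) then show ?case by (cases "act k s") (auto simp: last_def stS)
  qed
  have last_le': "last k s \<le> s" for k s using last_le[of k s] by auto
  have delta: "real (4 * a s - a (last k s) * 2 ^ (s + 2 - last k s)) = 2 ^ (s + 2) * (al s - al (last k s))" for k s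
  proof -
    define L where "L = last k s"
    have "L \<le> s" unfolding L_def by (rule last_le')
    have e: "real (a L * 2 ^ (s + 2 - L)) = 2 ^ (s + 2) * al L"
    proof -
      have "(2::real) ^ (s + 2 - L) * 2 ^ L = 2 ^ (s + 2)" using \<open>L \<le> s\<close> by (simp flip: power_add)
      then have "real (a L) * ((2::real) ^ (s + 2 - L) * 2 ^ L) = real (a L) * 2 ^ (s + 2)" by (simp only:)
      then show ?thesis by (simp only: al_def of_nat_mult of_nat_power of_nat_numeral) (simp add: field_simps)
    qed
    have f: "real (4 * a s) = 2 ^ (s + 2) * al s" by (simp add: al_def)
    have "real (a L * 2 ^ (s + 2 - L)) \<le> real (4 * a s)"
      unfolding e f using al_mono[OF \<open>L \<le> s\<close>] by (intro mult_left_mono) auto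
    then have "real (4 * a s - a L * 2 ^ (s + 2 - L)) = real (4 * a s) - real (a L * 2 ^ (s + 2 - L))"
      by (subst of_nat_diff) (simp_all only: of_nat_le_iff)
    then show ?thesis unfolding e f L_def[symmetric] by (simp only: right_diff_distrib)
  qed
  have T'_real: "real (T' k s (last k s)) = real (w s (s + k + 2)) + 1 + 2 ^ (s + 2) * (al s - al (last k s))" for k s
    unfolding T'_def using delta[of s k] by (simp only: of_nat_add of_nat_1)
  have top_step: "Op s + (1/2) ^ k * (al s - al (last k s)) \<le> top k (Suc s)" if "act k s" for k s
  proof -
    have "(Op s + (1/2) ^ k * (al s - al (last k s))) * 2 ^ (s + k + 2)
        = Op s * 2 ^ (s + k + 2) + 2 ^ (s + 2) * (al s - al (last k s))"
      by (simp add: power_add power_divide field_simps)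
    also have "\<dots> \<le> real (T' k s (last k s))" unfolding T'_real using w(2)[of s "s + k + 2"] by linarith
    finally show ?thesis using that by (simp add: top_def stS pos_le_divide_eq)
  qed

  define cell where "cell k s bs \<longleftrightarrow> s + k + 2 \<le> length bs \<and> act k s \<and> w s (s + k + 2) \<le> val (take (s + k + 2) bs)
      \<and> val (take (s + k + 2) bs) \<le> T' k s (last k s)" for k s bs
  \<comment> \<open>The parameter \<open>Suc k\<close> splits \<open>(1/2) ^ k\<close> into two
    halves: one for the increases of \<open>al\<close>, which sum to at most 1, the other for the
    two extra cells per stage caused by rounding, which form a geometric series.\<close>
  define U where "U k bs \<longleftrightarrow> (\<exists>s<length bs. cell (Suc k) s bs)" for k bs
  have U_cpt: "cpt no_oracle (\<lambda>p. U (fst p) (snd p))"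
    unfolding U_def cell_def act_def last_def T'_def
    by (intro cpt_intros cpt_2[OF w_cpt] cpt_o[OF a_cpt] cpt_2[OF st_cpt])
  have "mlr_test U" unfolding mlr_test_def
  proof (intro conjI allI)
    show "unif_ce U" by (rule unif_ce_decidable[OF U_cpt])
    fix k
    have up: "U k bs" if "U k cs" "length cs \<le> length bs" "take (length cs) bs = cs" for bs cs
    proof -
      obtain s where s: "s < length cs" "cell (Suc k) s cs" using \<open>U k cs\<close> unfolding U_def by blast
      then have "s + Suc k + 2 \<le> length cs" by (simp add: cell_def)
      then have "take (s + Suc k + 2) cs = take (s + Suc k + 2) bs" using that(3) by (metis min.absorb1 take_take)
      then have "cell (Suc k) s bs" using s(2) that(2) by (simp add: cell_def)
      then show ?thesis using s(1) that(2) unfolding U_def by (meson less_le_trans)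
    qed
    show "mu_open (U k) \<le> (1/2) ^ k"
    proof (rule mu_open_le)
      fix L
      define j where "j = Suc k"
      define inc where "inc s = (if act j s then al s - al (last j s) else 0)" for s
      have tel: "(\<Sum>s<S. inc s) \<le> al (last j S)" for S
      proof (induction S)
        case 0 then show ?case using al_ge by simp
      next
        case (Suc S) then show ?case by (cases "act j S") (auto simp: inc_def last_def stS)
      qed
      have cell_cnt: "real (cnt L (cell j s)) \<le> 2 ^ L * ((1/2) ^ j * inc s + (1/2) ^ (s + j + 1))" for s
      proof (cases "s + j + 2 \<le> L \<and> act j s")
        case False
        then have "cnt L (cell j s) = 0" by (auto simp: cnt_def cell_def)
        moreover have "0 \<le> inc s" using al_mono[OF last_le'[of j s]] by (simp add: inc_def)
        ultimately show ?thesis by simp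
      next
        case True
        define r where "r = s + j + 2"
        have "r \<le> L" using True by (simp add: r_def)
        have "cnt L (cell j s) \<le> cnt L (\<lambda>bs. w s r \<le> val (take r bs) \<and> val (take r bs) \<le> T' j s (last j s))"
          by (rule cnt_mono) (simp add: cell_def r_def)
        also have "\<dots> = 2 ^ (L - r) * cnt r (\<lambda>bs. w s r \<le> val bs \<and> val bs \<le> T' j s (last j s))"
          by (rule cnt_lift'[OF \<open>r \<le> L\<close>])
        also have "\<dots> \<le> 2 ^ (L - r) * (Suc (T' j s (last j s)) - w s r)"
          by (intro mult_left_mono cnt_val) simp
        finally have "real (cnt L (cell j s)) \<le> real (2 ^ (L - r) * (Suc (T' j s (last j s)) - w s r))"
          by (rule of_nat_mono)
        also have "\<dots> = 2 ^ (L - r) * (real (T' j s (last j s)) + 1 - real (w s r))"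
        proof -
          obtain D where "T' j s (last j s) = w s r + 1 + D" unfolding T'_def r_def by blast
          then show ?thesis by (simp add: algebra_simps)
        qed
        also have "\<dots> = 2 ^ (L - r) * (2 + 2 ^ (s + 2) * (al s - al (last j s)))"
          unfolding T'_real r_def by simp
        also have "\<dots> = 2 ^ L * (2 + 2 ^ (s + 2) * (al s - al (last j s))) / 2 ^ r"
          using \<open>r \<le> L\<close> by (simp add: power_diff)
        also have "\<dots> = 2 ^ L * ((1/2) ^ j * inc s + (1/2) ^ (s + j + 1))"
          using True by (simp add: inc_def r_def power_add power_divide field_simps)
        finally show ?thesis .
      qed
      have geo: "(\<Sum>s<L. (1/2::real) ^ s) \<le> 2"
        using sum_gp_strict[of "1/2::real" L] by simp
      have "cnt L (U k) \<le> cnt L (\<lambda>bs. \<exists>s<L. cell j s bs)" by (rule cnt_mono) (auto simp: U_def j_def)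
      also have "\<dots> \<le> (\<Sum>s<L. cnt L (cell j s))" by (rule cnt_UN)
      finally have "real (cnt L (U k)) \<le> (\<Sum>s<L. real (cnt L (cell j s)))" by (simp flip: of_nat_sum)
      also have "\<dots> \<le> (\<Sum>s<L. 2 ^ L * ((1/2) ^ j * inc s + (1/2) ^ (s + j + 1)))"
        by (intro sum_mono cell_cnt)
      also have "\<dots> = 2 ^ L * ((1/2) ^ j * (\<Sum>s<L. inc s) + (1/2) ^ (j + 1) * (\<Sum>s<L. (1/2) ^ s))"
        unfolding sum_distrib_left sum.distrib[symmetric] by (intro sum.cong refl) (simp add: power_add)
      also have "\<dots> \<le> 2 ^ L * ((1/2) ^ j * 1 + (1/2) ^ (j + 1) * 2)"
        using tel[of L] al_le[of "last j L"] geo by (intro mult_left_mono add_mono) auto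
      also have "\<dots> = (1/2) ^ k * 2 ^ L" by (simp add: j_def)
      finally show "real (gen_cnt (U k) L) \<le> (1/2) ^ k * 2 ^ L" using gen_cnt_upward[of "U k" L] up by simp
    qed
  qed
  then obtain k0 where k0: "bin_expansion Omega \<notin> open_gen (U k0)" using random unfolding mlr_random_def by blast
  define k where "k = Suc k0"
  have not_cell: "\<not> cell k s (pre (bin_expansion Omega) n)" for s n
  proof
    assume *: "cell k s (pre (bin_expansion Omega) n)"
    then have "s < n" by (simp add: cell_def)
    then have "U k0 (pre (bin_expansion Omega) n)" using * by (auto simp: U_def k_def)
    then show False using k0 extends_pre unfolding open_gen_def by blast
  qed
  \<comment> \<open>\<Omega> is at least \<open>Op s\<close>, so its prefix has a value of at least
    \<open>w s r\<close>; outside the cell it can only lie above \<open>T'\<close>.\<close>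
  have top_lt: "top k s < Omega" for s
  proof (induction s)
    case 0 then show ?case using Omega by (simp add: top_def st0)
  next
    case (Suc s)
    show ?case
    proof (cases "act k s")
      case False then show ?thesis using Suc by (simp add: top_def stS)
    next
      case True
      define r where "r = s + k + 2"
      define v where "v = val (pre (bin_expansion Omega) r)"
      have v: "int v = \<lfloor>Omega * 2 ^ r\<rfloor>" unfolding v_def by (rule val_bin_expansion) (use Omega in auto)
      have "Op s * 2 ^ r \<le> Omega * 2 ^ r" using Op_le by (intro mult_right_mono) auto
      then have "real (w s r) \<le> Omega * 2 ^ r" using w(1)[of s r] by linarith
      then have "int (w s r) \<le> int v" unfolding v by (simp add: le_floor_iff)
      then have "T' k s (last k s) < v"
        using not_cell[of s r] True unfolding cell_def r_def[symmetric] by (simp add: v_def[symmetric])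
      then have "real (T' k s (last k s)) < real v" by simp
      also have "real v = real_of_int \<lfloor>Omega * 2 ^ r\<rfloor>" using v by (metis of_int_of_nat_eq)
      also have "\<dots> \<le> Omega * 2 ^ r" by simp
      finally have "real (T' k s (last k s)) / 2 ^ r < Omega" by (simp add: pos_divide_less_eq)
      then show ?thesis using True by (simp add: top_def stS r_def)
    qed
  qed
  have act_ex: "\<exists>s\<ge>s0. act k s" for s0
  proof (rule ccontr)
    assume "\<not> (\<exists>s\<ge>s0. act k s)"
    then have no: "\<And>s. s0 \<le> s \<Longrightarrow> \<not> act k s" by blast
    have st_const: "st k s = st k s0" if le: "s0 \<le> s" for s
      using le by (induction s rule: dec_induct) (simp_all add: stS no)
    have top: "top k s = top k s0" if "s0 \<le> s" for s
      by (simp only: top_def st_const[OF that])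
    have "\<forall>\<^sub>F s in sequentially. top k s0 < Op s" using Op(2) top_lt by (rule order_tendstoD)
    then have "\<forall>\<^sub>F s in sequentially. s0 \<le> s \<and> top k s0 < Op s"
      by (intro eventually_conj eventually_ge_at_top)
    then obtain s where "s0 \<le> s" "top k s0 < Op s" using eventually_happens'[OF sequentially_bot] by blast
    then have "act k s" unfolding act_iff top[OF \<open>s0 \<le> s\<close>] by simp
    then show False using no \<open>s0 \<le> s\<close> by blast
  qed
  \<comment> \<open>Each interval starts at an \<open>Op s\<close> that has passed the previous one,
    so the intervals opened from stage \<open>p\<close> on are stacked above \<open>Op p\<close> and
    their lengths add up.\<close>
  have grow: "(1/2) ^ k * (al (last k s) - al (last k p)) \<le> top k s - Op p" if "act k p" "Suc p \<le> s" for p s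
    using that(2)
  proof (induction s rule: dec_induct)
    case base
    have "last k (Suc p) = p" using that(1) by (simp add: last_def stS)
    then show ?case using top_step[OF that(1)] by simp
  next
    case (step s)
    show ?case
    proof (cases "act k s")
      case False then show ?thesis using step.IH by (simp add: last_def top_def stS)
    next
      case True
      then have l: "last k (Suc s) = s" by (simp add: last_def stS)
      have "top k s \<le> Op s" using True by (simp add: act_iff)
      then have "(1/2) ^ k * (al (last k s) - al (last k p)) + (1/2) ^ k * (al s - al (last k s)) \<le> top k (Suc s) - Op p"
        using step.IH top_step[OF True] by linarith
      then show ?thesis unfolding l by (simp add: right_diff_distrib)
    qed
  qed
  have "al m - al n \<le> 2 ^ k * (Omega - Op n)" for n m
  proof -
    \<comment> \<open>The first action from \<open>n\<close> on. The one before it is no later than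
      \<open>n\<close>, so the interval opened at \<open>p\<close> already accounts for the increase
      since \<open>n\<close>.\<close>
    define p where "p = (LEAST p. n \<le> p \<and> act k p)"
    have p: "n \<le> p" "act k p" using LeastI_ex[of "\<lambda>p. n \<le> p \<and> act k p"] act_ex[of n] unfolding p_def by blast+
    have "last k p \<le> n"
    proof (rule ccontr)
      assume "\<not> last k p \<le> n"
      then have "n \<le> last k p \<and> act k (last k p)" "last k p < p" using last_le[of k p] by auto
      then show False unfolding p_def using not_less_Least by blast
    qed
    then have 1: "al (last k p) \<le> al n" by (rule al_mono)
    obtain s where s: "max m (Suc p) \<le> s" "act k s" using act_ex by blast
    have "last k (Suc s) = s" using s(2) by (simp add: last_def stS)
    then have "al m \<le> al (last k (Suc s))" using s(1) al_mono by simp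
    then have "al m - al n \<le> al (last k (Suc s)) - al (last k p)" using 1 by linarith
    then have "(1/2) ^ k * (al m - al n) \<le> (1/2) ^ k * (al (last k (Suc s)) - al (last k p))"
      by (intro mult_left_mono) auto
    also have "\<dots> \<le> top k (Suc s) - Op p" by (rule grow) (use p s in auto)
    also have "\<dots> \<le> Omega - Op n" using top_lt[of "Suc s"] Op(1) p(1) by (intro diff_mono) (auto simp: mono_def)
    finally have "2 ^ k * ((1/2) ^ k * (al m - al n)) \<le> 2 ^ k * (Omega - Op n)" by (intro mult_left_mono) auto
    then show ?thesis by (simp add: power_divide)
  qed
  then show ?thesis unfolding al_def by (intro exI[of _ "2 ^ k"]) auto
qed

section \<open>Limits of cost functions\<close>

lemma prod_decode_le: "fst (prod_decode n) \<le> n" "snd (prod_decode n) \<le> n"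
  using le_prod_encode_1[of "fst (prod_decode n)" "snd (prod_decode n)"]
    le_prod_encode_2[of "snd (prod_decode n)" "fst (prod_decode n)"] by simp_all

type_synonym history = "(nat \<times> nat \<times> nat \<times> nat) list"

text \<open>If no multiple of the limit of \<open>c\<close> dominates the limit \<open>D\<close> of \<open>d\<close>, then a finite injury construction yields a
  set that obeys \<open>c\<close> but not \<open>d\<close>. Requirement \<open>i = (e, m)\<close> is that the approximation computed by the \<open>e\<close>-th program
  does not converge to the set with total \<open>d\<close>-cost at most \<open>m\<close>. It toggles positions \<open>x\<close> where \<open>d x t\<close> is much larger than
  \<open>c x s\<close>, each time after the opponent has agreed with the current value and with the effect of the previous toggle,
  so that the opponent pays \<open>d x t\<close> for each toggle. An event \<open>(i, x, s, t)\<close> records that \<open>i\<close> toggled \<open>x\<close> at stage \<open>s\<close>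
  after seeing the opponent's stage \<open>t\<close>; events of smaller index restart a requirement.\<close>
locale toggle =
  fixes c d :: "nat \<Rightarrow> nat \<Rightarrow> real" and l ld :: "nat \<Rightarrow> nat \<Rightarrow> nat" and D :: "nat \<Rightarrow> real"
  assumes c: "cost_function c" and l: "dyadic_lower l c" and ld: "dyadic_lower ld d"
    and d_mono: "\<And>x s s'. s \<le> s' \<Longrightarrow> d x s \<le> d x s'" and d_anti: "\<And>x x' s. x \<le> x' \<Longrightarrow> d x' s \<le> d x s"
    and d_ge: "\<And>x s. 0 \<le> d x s" and d_le: "\<And>x s. d x s \<le> 1"
    and d_lim: "\<And>x. d x \<longlonglongrightarrow> D x" and D_pos: "\<And>x. 0 < D x"
    and undominated: "\<And>K. \<exists>x. K * limit_cost c x < D x"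
begin

abbreviation (input) "pos e \<equiv> fst (snd e)"
abbreviation (input) "stage e \<equiv> fst (snd (snd e))"
abbreviation (input) "seen e \<equiv> snd (snd (snd e))"

definition target :: "nat \<Rightarrow> nat" where "target i = snd (prod_decode i)"
definition opponent :: "nat \<Rightarrow> recf" where "opponent i = decode (fst (prod_decode i))"
text \<open>Between restarts, that is for fixed \<open>i\<close> and \<open>u\<close>, the gains
  total at most \<open>target i + 1\<close>; division by this ratio leaves a \<open>c\<close>-cost
  of at most \<open>(1/2) ^ (i + u)\<close>, which is summable over \<open>i\<close> and
  \<open>u\<close>.\<close>

definition ratio :: "nat \<Rightarrow> nat \<Rightarrow> nat" where "ratio i u = 2 ^ (i + u) * Suc (target i)"

text \<open>Histories begin with the newest event, so \<open>hd\<close> is the latest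
  injury.\<close>

definition restart :: "nat \<Rightarrow> history \<Rightarrow> nat" where
  "restart i H = (let F = filter (\<lambda>e. fst e < i) H in if F = [] then 0 else Suc (stage (hd F)))"
definition epoch :: "nat \<Rightarrow> history \<Rightarrow> history" where
  "epoch i H = filter (\<lambda>e. fst e = i \<and> restart i H \<le> stage e) H"
definition value_at :: "history \<Rightarrow> nat \<Rightarrow> bool" where
  "value_at H x \<longleftrightarrow> length (filter (\<lambda>e. pos e = x) H) mod 2 = 1"
text \<open>The inequality \<open>ratio i u * c x (Suc s) < d x t\<close> with denominators cleared,
  an upper bound in place of \<open>c\<close> and a lower bound in place of \<open>d\<close>. The
  cost is taken at \<open>Suc s\<close> because a toggle at stage \<open>s\<close> first shows in
  \<open>As (Suc s)\<close>.\<close>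

definition profit :: "nat \<Rightarrow> nat \<Rightarrow> nat \<Rightarrow> nat \<Rightarrow> nat \<Rightarrow> bool" where
  "profit i u s t x \<longleftrightarrow> ratio i u * (l x (Suc s) + 3) * 2 ^ t < ld x t * 2 ^ Suc s"
text \<open>The bound \<open>i\<close> leaves each position to finitely many requirements, and the
  bound \<open>restart i H\<close> avoids the positions used by smaller indices. The disjunct
  \<open>s \<le> x\<close> makes the search total; \<open>ok\<close> rejects the value
  \<open>s\<close>.\<close>

definition place :: "nat \<Rightarrow> history \<Rightarrow> nat \<Rightarrow> nat \<Rightarrow> nat" where
  "place s H i t = (LEAST x. s \<le> x \<or> max i (restart i H) \<le> x \<and> profit i (restart i H) s t x)"
definition agrees :: "nat \<Rightarrow> history \<Rightarrow> nat \<Rightarrow> nat \<Rightarrow> nat \<Rightarrow> bool" where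
  "agrees s H i t x \<longleftrightarrow> Phi s (pre no_oracle s) (opponent i) [t, x] (of_bool (value_at H x))"
text \<open>The gains of the current epoch must not exceed the target, so the requirement rests once
  the opponent has been forced past its budget. The last clause asks the opponent to have followed
  the latest toggle: that change of mind is what makes it pay.\<close>

definition ok :: "nat \<Rightarrow> history \<Rightarrow> nat \<Rightarrow> nat \<Rightarrow> bool" where
  "ok s H i t \<longleftrightarrow> place s H i t < s \<and> (\<forall>e\<in>set (epoch i H). seen e < t)
     \<and> sum_list (map (\<lambda>e. ld (pos e) (seen e) * 2 ^ (s - seen e)) (epoch i H))
         \<le> target i * 2 ^ s
     \<and> agrees s H i t (place s H i t)
     \<and> (\<forall>e\<in>set (epoch i H). (\<forall>e'\<in>set (epoch i H). stage e' \<le> stage e) \<longrightarrow> agrees s H i t (pos e))"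
text \<open>Every pair of a requirement and a stage of its opponent comes up at infinitely many
  stages.\<close>

definition ii :: "nat \<Rightarrow> nat" where "ii s = fst (prod_decode (fst (prod_decode s)))"
definition tt :: "nat \<Rightarrow> nat" where "tt s = snd (prod_decode (fst (prod_decode s)))"
definition Hs :: "nat \<Rightarrow> history" where
  "Hs s = rec_nat [] (\<lambda>s H. if ok s H (ii s) (tt s) then (ii s, place s H (ii s) (tt s), s, tt s) # H else H) s"

lemma l_cpt: "cpt Y (\<lambda>p. l (fst p) (snd p))" and ld_cpt: "cpt Y (\<lambda>p. ld (fst p) (snd p))"
  using l ld by (auto simp: dyadic_lower_def intro: cpt_oracle_free)

lemma cpt_restart:
  assumes "cpt Y i" "cpt Y H" shows "cpt Y (\<lambda>q. restart (i q) (H q))"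
  unfolding restart_def Let_def by (intro cpt_intros assms cpt_o[OF assms(1)])

lemma cpt_value_at:
  assumes "cpt Y H" "cpt Y x" shows "cpt Y (\<lambda>q. value_at (H q) (x q))"
  unfolding value_at_def by (intro cpt_intros assms cpt_o[OF assms(2)])

lemma cpt_profit:
  assumes "cpt Y i" "cpt Y u" "cpt Y s" "cpt Y t" "cpt Y x"
  shows "cpt Y (\<lambda>q. profit (i q) (u q) (s q) (t q) (x q))"
  unfolding profit_def ratio_def target_def by (intro cpt_intros assms cpt_2[OF l_cpt] cpt_2[OF ld_cpt])

lemma ratio_pos [simp]: "0 < ratio i u"
  by (simp add: ratio_def)

lemma cpt_epoch:
  assumes "cpt Y i" "cpt Y H" shows "cpt Y (\<lambda>q. epoch (i q) (H q))"
  unfolding epoch_def by (intro cpt_intros cpt_restart assms cpt_o[OF assms(1)] cpt_o[OF assms(2)])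

lemma cpt_place:
  assumes "cpt Y s" "cpt Y H" "cpt Y i" "cpt Y t" shows "cpt Y (\<lambda>q. place (s q) (H q) (i q) (t q))"
  unfolding place_def
proof (rule cpt_Least)
  show "cpt Y (\<lambda>p. s (fst p) \<le> snd p \<or> max (i (fst p)) (restart (i (fst p)) (H (fst p))) \<le> snd p
     \<and> profit (i (fst p)) (restart (i (fst p)) (H (fst p))) (s (fst p)) (t (fst p)) (snd p))"
    by (intro cpt_intros cpt_restart cpt_profit cpt_o[OF assms(1)] cpt_o[OF assms(2)] cpt_o[OF assms(3)] cpt_o[OF assms(4)])
qed auto

lemma cpt_agrees:
  assumes "cpt Y s" "cpt Y H" "cpt Y i" "cpt Y t" "cpt Y x" shows "cpt Y (\<lambda>q. agrees (s q) (H q) (i q) (t q) (x q))"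
  unfolding agrees_def opponent_def by (intro cpt_intros cpt_value_at assms)

lemma cpt_ok:
  assumes "cpt Y s" "cpt Y H" "cpt Y i" "cpt Y t" shows "cpt Y (\<lambda>q. ok (s q) (H q) (i q) (t q))"
proof -
  note a = cpt_o[OF assms(1)] cpt_o[OF assms(2)] cpt_o[OF assms(3)] cpt_o[OF assms(4)]
  show ?thesis
    unfolding ok_def target_def
    by (intro cpt_intros cpt_place cpt_agrees cpt_epoch cpt_2[OF ld_cpt] assms a)
qed

lemma cpt_Hs: "cpt Y f \<Longrightarrow> cpt Y (\<lambda>q. Hs (f q))"
  unfolding Hs_def ii_def tt_def by (intro cpt_intros cpt_ok cpt_place)

section \<open>The toggling construction in terms of stages and real numbers\<close>

definition act :: "nat \<Rightarrow> bool" where "act s \<longleftrightarrow> ok s (Hs s) (ii s) (tt s)"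
definition xx :: "nat \<Rightarrow> nat" where "xx s = place s (Hs s) (ii s) (tt s)"
definition event :: "nat \<Rightarrow> nat \<times> nat \<times> nat \<times> nat" where "event s = (ii s, xx s, s, tt s)"
definition As :: "nat \<Rightarrow> nat \<Rightarrow> bool" where "As s = value_at (Hs s)"
definition Us :: "nat \<Rightarrow> nat \<Rightarrow> nat" where "Us i s = restart i (Hs s)"
definition gain :: "nat \<Rightarrow> real" where "gain s = real (ld (xx s) (tt s)) / 2 ^ tt s"
definition acts :: "nat \<Rightarrow> nat \<Rightarrow> nat set" where "acts i s = {r. r < s \<and> act r \<and> ii r = i \<and> Us i s \<le> r}"

lemma Hs_simps [simp]: "Hs 0 = []" "Hs (Suc s) = (if act s then event s # Hs s else Hs s)"
  by (simp_all add: Hs_def act_def event_def xx_def)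

lemma event_simps [simp]: "fst (event s) = ii s" "fst (snd (event s)) = xx s" "fst (snd (snd (event s))) = s"
  "snd (snd (snd (event s))) = tt s"
  by (simp_all add: event_def)

lemma set_Hs: "set (Hs s) = event ` {r. r < s \<and> act r}"
  by (induction s) (auto simp: less_Suc_eq)

lemma sum_list_Hs:
  "sum_list (map h (filter P (Hs s))) = (\<Sum>r | r < s \<and> act r \<and> P (event r). h (event r))" for h :: "_ \<Rightarrow> nat"
proof (induction s)
  case (Suc s)
  have f: "finite {r. r < s \<and> act r \<and> P (event r)}" by simp
  show ?case
  proof (cases "act s \<and> P (event s)")
    case True
    then have "{r. r < Suc s \<and> act r \<and> P (event r)} = insert s {r. r < s \<and> act r \<and> P (event r)}" by (auto simp: less_Suc_eq)
    then show ?thesis using True Suc f by simp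
  next
    case False
    then have "{r. r < Suc s \<and> act r \<and> P (event r)} = {r. r < s \<and> act r \<and> P (event r)}" by (auto simp: less_Suc_eq)
    then show ?thesis using False Suc by auto
  qed
qed simp

lemma Us_simps [simp]: "Us i 0 = 0" "Us i (Suc s) = (if act s \<and> ii s < i then Suc s else Us i s)"
  by (simp_all add: Us_def restart_def)

lemma Us_le: "Us i s \<le> s"
  by (induction s) auto

lemma Us_mono: "s \<le> s' \<Longrightarrow> Us i s \<le> Us i s'"
  by (induction s' rule: dec_induct) (use Us_le in \<open>auto intro: le_trans simp: le_SucI\<close>)

text \<open>A restart after stage \<open>s\<close> would move the value beyond
  \<open>s\<close>.\<close>

lemma Us_const: "s \<le> s' \<Longrightarrow> Us i s' \<le> s \<Longrightarrow> Us i s' = Us i s"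
  by (induction s' rule: dec_induct) (auto split: if_splits)

lemma Us_bound: "act r \<Longrightarrow> ii r < i \<Longrightarrow> r < s \<Longrightarrow> Suc r \<le> Us i s"
  using Us_mono[of "Suc r" s i] by simp

lemma As_simps: "As 0 x = False" "As (Suc s) x = (if act s \<and> xx s = x then \<not> As s x else As s x)"
proof -
  have "Suc n mod 2 = 1 \<longleftrightarrow> n mod 2 \<noteq> 1" for n :: nat by presburger
  then show "As 0 x = False" "As (Suc s) x = (if act s \<and> xx s = x then \<not> As s x else As s x)"
    by (auto simp: As_def value_at_def)
qed

lemma ii_le: "ii s \<le> s" and tt_le: "tt s \<le> s"
  unfolding ii_def tt_def using prod_decode_le[of s] prod_decode_le[of "fst (prod_decode s)"] by linarith+

lemma finite_acts [simp]: "finite (acts i s)"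
  by (rule finite_subset[of _ "{..<s}"]) (auto simp: acts_def)

lemma set_epoch: "set (epoch i (Hs s)) = event ` acts i s"
  by (auto simp: epoch_def set_Hs acts_def Us_def)

lemma act_iff:
  "act s \<longleftrightarrow> xx s < s \<and> (\<forall>r\<in>acts (ii s) s. tt r < tt s) \<and> (\<Sum>r\<in>acts (ii s) s. gain r) \<le> real (target (ii s))
     \<and> agrees s (Hs s) (ii s) (tt s) (xx s)
     \<and> (\<forall>r\<in>acts (ii s) s. (\<forall>r'\<in>acts (ii s) s. r' \<le> r) \<longrightarrow> agrees s (Hs s) (ii s) (tt s) (xx r))"
proof -
  let ?i = "ii s"
  let ?E = "epoch ?i (Hs s)"
  \<comment> \<open>Scaling by \<open>2 ^ s\<close> is exact only if no exponent
    \<open>s - seen e\<close> is truncated, which holds once all seen stages lie below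
    \<open>tt s \<le> s\<close>.\<close>
  have sum: "sum_list (map (\<lambda>e. ld (pos e) (seen e) * 2 ^ (s - seen e)) ?E) \<le> target ?i * 2 ^ s
      \<longleftrightarrow> (\<Sum>r\<in>acts ?i s. gain r) \<le> real (target ?i)" if "\<forall>r\<in>acts ?i s. tt r < tt s"
  proof -
    have "sum_list (map (\<lambda>e. ld (pos e) (seen e) * 2 ^ (s - seen e)) ?E)
        = (\<Sum>r\<in>acts ?i s. ld (xx r) (tt r) * 2 ^ (s - tt r))"
      unfolding epoch_def sum_list_Hs by (simp add: acts_def Us_def conj_ac)
    moreover have "real (\<Sum>r\<in>acts ?i s. ld (xx r) (tt r) * 2 ^ (s - tt r)) = (\<Sum>r\<in>acts ?i s. gain r) * 2 ^ s"
      unfolding of_nat_sum sum_distrib_right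
    proof (rule sum.cong[OF refl])
      fix r assume "r \<in> acts ?i s"
      then have "tt r \<le> s" using that tt_le[of s] by fastforce
      then have "(2::real) ^ (s - tt r) = 2 ^ s / 2 ^ tt r" by (simp add: power_diff)
      then show "real (ld (xx r) (tt r) * 2 ^ (s - tt r)) = gain r * 2 ^ s" by (simp add: gain_def)
    qed
    moreover have "a \<le> target ?i * 2 ^ s \<longleftrightarrow> real a \<le> real (target ?i) * 2 ^ s" for a
      using of_nat_le_iff[of a "target ?i * 2 ^ s", where ?'a = real, symmetric] by simp
    ultimately show ?thesis by simp
  qed
  show ?thesis
  proof (cases "\<forall>r\<in>acts ?i s. tt r < tt s")
    case True
    show ?thesis by (simp add: act_def ok_def xx_def[symmetric] set_epoch sum[OF True])
  next
    case False
    then show ?thesis by (simp add: act_def ok_def set_epoch) blast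
  qed
qed

lemma profit_at: "act s \<Longrightarrow> max (ii s) (Us (ii s) s) \<le> xx s \<and> profit (ii s) (Us (ii s) s) s (tt s) (xx s)"
proof -
  let ?P = "\<lambda>x. s \<le> x \<or> max (ii s) (Us (ii s) s) \<le> x \<and> profit (ii s) (Us (ii s) s) s (tt s) x"
  assume "act s"
  then have "\<not> s \<le> xx s" by (simp add: act_iff)
  moreover have "?P (xx s)" unfolding xx_def place_def Us_def by (rule LeastI[of _ s]) simp
  ultimately show ?thesis by blast
qed

lemma xx_le:
  assumes "max (ii s) (Us (ii s) s) \<le> x" "profit (ii s) (Us (ii s) s) s (tt s) x"
  shows "xx s \<le> x"
  unfolding xx_def place_def by (rule Least_le) (use assms in \<open>simp add: Us_def\<close>)

lemma gain_bounds: "0 \<le> gain s" "gain s \<le> d (xx s) (tt s)" "d (xx s) (tt s) - 3 / 2 ^ tt s \<le> gain s"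
proof -
  have "real (ld (xx s) (tt s)) \<le> 2 ^ tt s * d (xx s) (tt s)" "2 ^ tt s * d (xx s) (tt s) \<le> real (ld (xx s) (tt s)) + 3"
    using ld by (auto simp: dyadic_lower_def)
  then show "0 \<le> gain s" "gain s \<le> d (xx s) (tt s)" "d (xx s) (tt s) - 3 / 2 ^ tt s \<le> gain s"
    by (simp_all add: gain_def pos_divide_le_eq pos_le_divide_eq mult.commute left_diff_distrib right_diff_distrib)
qed

lemma paid_le:
  assumes "act s" shows "c (xx s) (Suc s) \<le> gain s / real (ratio (ii s) (Us (ii s) s))"
proof -
  define N where "N = real (ratio (ii s) (Us (ii s) s))"
  have N: "0 < N" by (simp add: N_def)
  have "ratio (ii s) (Us (ii s) s) * (l (xx s) (Suc s) + 3) * 2 ^ tt s < ld (xx s) (tt s) * 2 ^ Suc s"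
    using profit_at[OF assms] by (simp add: profit_def)
  then have "real (ratio (ii s) (Us (ii s) s) * (l (xx s) (Suc s) + 3) * 2 ^ tt s) < real (ld (xx s) (tt s) * 2 ^ Suc s)"
    by (rule of_nat_less_iff[THEN iffD2])
  then have "N * (real (l (xx s) (Suc s)) + 3) * 2 ^ tt s < real (ld (xx s) (tt s)) * 2 ^ Suc s" by (simp add: N_def)
  moreover have "2 ^ Suc s * c (xx s) (Suc s) \<le> real (l (xx s) (Suc s)) + 3" using l unfolding dyadic_lower_def by blast
  then have "N * (2 ^ Suc s * c (xx s) (Suc s)) * 2 ^ tt s \<le> N * (real (l (xx s) (Suc s)) + 3) * 2 ^ tt s"
    using N by (intro mult_right_mono mult_left_mono) auto
  ultimately have "N * (2 ^ Suc s * c (xx s) (Suc s)) * 2 ^ tt s \<le> real (ld (xx s) (tt s)) * 2 ^ Suc s" by linarith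
  then have "(N * c (xx s) (Suc s) * 2 ^ tt s) * 2 ^ Suc s \<le> real (ld (xx s) (tt s)) * 2 ^ Suc s" by (simp add: mult_ac)
  then have "N * c (xx s) (Suc s) * 2 ^ tt s \<le> real (ld (xx s) (tt s))" by (rule mult_right_le_imp_le) simp
  then show ?thesis unfolding N_def[symmetric] gain_def using N by (simp add: field_simps)
qed

text \<open>A period between restarts is identified by the value of \<open>Us\<close> during it,
  which lets \<open>epoch_gain\<close> fix the period in advance.\<close>

lemma acts_alt: "acts i s = {r. r < s \<and> act r \<and> ii r = i \<and> Us i r = Us i s}"
proof -
  have "Us i s \<le> r \<longleftrightarrow> Us i r = Us i s" if "r < s" for r
    using Us_const[of r s i] Us_le[of i r] that by auto
  then show ?thesis by (auto simp: acts_def)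
qed

text \<open>Before every action the gains of the period total at most the target, and one more
  action gains at most 1 because \<open>d\<close> is bounded by 1.\<close>

lemma epoch_gain: "(\<Sum>r | r < s \<and> act r \<and> ii r = i \<and> Us i r = u. gain r) \<le> real (target i) + 1"
proof (induction s)
  case (Suc s)
  have f: "finite {r. r < s \<and> act r \<and> ii r = i \<and> Us i r = u}" by simp
  show ?case
  proof (cases "act s \<and> ii s = i \<and> Us i s = u")
    case True
    then have "{r. r < Suc s \<and> act r \<and> ii r = i \<and> Us i r = u} = insert s (acts i s)"
      unfolding acts_alt by (auto simp: less_Suc_eq)
    moreover have "s \<notin> acts i s" by (simp add: acts_def)
    moreover have "(\<Sum>r\<in>acts i s. gain r) \<le> real (target i)" using True unfolding act_iff by auto
    moreover have "gain s \<le> 1" using gain_bounds(2)[of s] d_le by (rule order_trans)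
    ultimately show ?thesis by simp
  next
    case False
    then have "{r. r < Suc s \<and> act r \<and> ii r = i \<and> Us i r = u} = {r. r < s \<and> act r \<and> ii r = i \<and> Us i r = u}"
      by (auto simp: less_Suc_eq)
    then show ?thesis using Suc by simp
  qed
qed simp

text \<open>Actions are grouped by requirement and period; the ratio leaves
  \<open>(1/2) ^ i * (1/2) ^ u\<close> for each group, and two geometric series give 4.\<close>

lemma cost_bound: "(\<Sum>r | r < s \<and> act r. c (xx r) (Suc r)) \<le> 4"
proof -
  let ?N = "\<lambda>i u. 1 / real (ratio i u)"
  let ?R = "{r. r < s \<and> act r}"
  have geo: "(\<Sum>i<s. (1/2::real) ^ i) \<le> 2" using sum_gp_strict[of "1/2::real" s] by simp
  have geo0: "0 \<le> (\<Sum>i<s. (1/2::real) ^ i)" by (intro sum_nonneg) simp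
  have "(\<Sum>r\<in>?R. c (xx r) (Suc r)) \<le> (\<Sum>r\<in>?R. ?N (ii r) (Us (ii r) r) * gain r)"
    by (rule sum_mono) (use paid_le in auto)
  also have "\<dots> = (\<Sum>r\<in>?R. \<Sum>i<s. \<Sum>u<s. if ii r = i \<and> Us i r = u then ?N i u * gain r else 0)"
  proof (rule sum.cong[OF refl])
    fix r assume r: "r \<in> ?R"
    then have "ii r < s" "Us (ii r) r < s" using ii_le[of r] Us_le[of "ii r" r] by auto
    have "(\<Sum>i<s. \<Sum>u<s. if ii r = i \<and> Us i r = u then ?N i u * gain r else 0)
       = (\<Sum>i<s. if ii r = i then (\<Sum>u<s. if Us i r = u then ?N i u * gain r else 0) else 0)"
      by (intro sum.cong refl) auto
    also have "\<dots> = ?N (ii r) (Us (ii r) r) * gain r"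
      using \<open>ii r < s\<close> \<open>Us (ii r) r < s\<close> by (simp add: sum.delta')
    finally show "?N (ii r) (Us (ii r) r) * gain r
       = (\<Sum>i<s. \<Sum>u<s. if ii r = i \<and> Us i r = u then ?N i u * gain r else 0)" by simp
  qed
  also have "\<dots> = (\<Sum>i<s. \<Sum>r\<in>?R. \<Sum>u<s. if ii r = i \<and> Us i r = u then ?N i u * gain r else 0)"
    by (rule sum.swap)
  also have "\<dots> = (\<Sum>i<s. \<Sum>u<s. \<Sum>r\<in>?R. if ii r = i \<and> Us i r = u then ?N i u * gain r else 0)"
    by (intro sum.cong refl sum.swap)
  also have "\<dots> = (\<Sum>i<s. \<Sum>u<s. ?N i u * (\<Sum>r | r < s \<and> act r \<and> ii r = i \<and> Us i r = u. gain r))"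
  proof (intro sum.cong refl)
    fix i u
    have "(\<Sum>r\<in>?R. if ii r = i \<and> Us i r = u then ?N i u * gain r else 0)
       = (\<Sum>r\<in>{r \<in> ?R. ii r = i \<and> Us i r = u}. ?N i u * gain r)"
      by (rule sum.inter_filter[symmetric]) simp
    also have "{r \<in> ?R. ii r = i \<and> Us i r = u} = {r. r < s \<and> act r \<and> ii r = i \<and> Us i r = u}" by auto
    finally show "(\<Sum>r\<in>?R. if ii r = i \<and> Us i r = u then ?N i u * gain r else 0)
       = ?N i u * (\<Sum>r | r < s \<and> act r \<and> ii r = i \<and> Us i r = u. gain r)"
      by (simp only: sum_distrib_left)
  qed
  also have "\<dots> \<le> (\<Sum>i<s. \<Sum>u<s. ?N i u * (real (target i) + 1))"
    by (intro sum_mono mult_left_mono epoch_gain) simp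
  also have "\<dots> = (\<Sum>i<s. \<Sum>u<s. (1/2) ^ i * (1/2) ^ u)"
  proof (intro sum.cong refl)
    fix i u
    have "real (ratio i u) = (2 ^ i * 2 ^ u) * (real (target i) + 1)" by (simp add: ratio_def power_add algebra_simps)
    moreover have "real (target i) + 1 \<noteq> 0" by linarith
    ultimately show "1 / real (ratio i u) * (real (target i) + 1) = (1/2) ^ i * (1/2) ^ u"
      by (simp add: power_divide)
  qed
  also have "\<dots> = (\<Sum>i<s. (1/2) ^ i) * (\<Sum>u<s. (1/2) ^ u)"
    by (simp add: sum_product)
  also have "\<dots> \<le> 2 * 2" using geo geo0 by (intro mult_mono) auto
  finally show ?thesis by simp
qed

end

section \<open>Finite injury and the failure of every opponent\<close>

context toggle
begin

text \<open>A value strictly between the two limits separates the approximations, so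
  \<open>s\<close> and \<open>t\<close> may grow independently.\<close>

lemma eventually_profit:
  assumes "real (ratio i u) * limit_cost c x < D x"
  shows "\<exists>t0. \<forall>t\<ge>t0. \<forall>s\<ge>t0. profit i u s t x"
proof -
  define N where "N = real (ratio i u)"
  define f where "f s = N * (c x (Suc s) + 3 * (1/2) ^ Suc s)" for s
  define g where "g t = d x t - 3 * (1/2) ^ t" for t
  have "(\<lambda>s. N * (c x (Suc s) + 3 * (1/2) ^ Suc s)) \<longlonglongrightarrow> N * (limit_cost c x + 3 * 0)"
    by (intro tendsto_intros LIMSEQ_Suc[OF limit_cost_upper(3)[OF c]] LIMSEQ_Suc[OF LIMSEQ_realpow_zero]) auto
  then have f: "f \<longlonglongrightarrow> N * limit_cost c x" unfolding f_def by simp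
  have "(\<lambda>t. d x t - 3 * (1/2) ^ t) \<longlonglongrightarrow> D x - 3 * 0"
    by (intro tendsto_intros d_lim LIMSEQ_realpow_zero) auto
  then have g: "g \<longlonglongrightarrow> D x" unfolding g_def by simp
  obtain y where y: "N * limit_cost c x < y" "y < D x" using dense[OF assms] unfolding N_def by blast
  have "\<forall>\<^sub>F s in sequentially. f s < y \<and> y < g s"
    by (intro eventually_conj order_tendstoD(2)[OF f y(1)] order_tendstoD(1)[OF g y(2)])
  then obtain t0 where t0: "\<forall>s\<ge>t0. f s < y \<and> y < g s" by (rule eventually_sequentiallyE)
  have "profit i u s t x" if "t0 \<le> t" "t0 \<le> s" for s t
  proof -
    have "real (l x (Suc s)) \<le> 2 ^ Suc s * c x (Suc s)" "2 ^ t * d x t \<le> real (ld x t) + 3"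
      using l ld unfolding dyadic_lower_def by blast+
    moreover have "2 ^ Suc s * f s = N * (2 ^ Suc s * c x (Suc s) + 3)" "2 ^ t * g t = 2 ^ t * d x t - 3"
      unfolding f_def g_def by (simp_all add: algebra_simps power_divide)
    ultimately have 1: "N * (real (l x (Suc s)) + 3) \<le> 2 ^ Suc s * f s" and 2: "2 ^ t * g t \<le> real (ld x t)"
      by (simp_all add: N_def mult_left_mono)
    have "N * (real (l x (Suc s)) + 3) * 2 ^ t \<le> 2 ^ Suc s * f s * 2 ^ t" using 1 by (intro mult_right_mono) auto
    also have "\<dots> < 2 ^ Suc s * g t * 2 ^ t"
      using t0 that by (intro mult_strict_right_mono mult_strict_left_mono) (auto intro: less_trans)
    also have "\<dots> = 2 ^ t * g t * 2 ^ Suc s" by simp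
    also have "\<dots> \<le> real (ld x t) * 2 ^ Suc s" using 2 by (intro mult_right_mono) auto
    finally have "real (ratio i u * (l x (Suc s) + 3) * 2 ^ t) < real (ld x t * 2 ^ Suc s)" by (simp add: N_def)
    then show ?thesis unfolding profit_def by (rule of_nat_less_iff[THEN iffD1])
  qed
  then show ?thesis by blast
qed

lemma limit_cost_antimono: "x \<le> x' \<Longrightarrow> limit_cost c x' \<le> limit_cost c x"
  by (rule LIMSEQ_le[OF limit_cost_upper(3)[OF c] limit_cost_upper(3)[OF c]]) (use cost_mono(2)[OF c] in auto)

lemma D_le: "D x \<le> 1"
  by (rule LIMSEQ_le_const2[OF d_lim]) (use d_le in auto)

text \<open>A constant that works from \<open>n\<close> on could be enlarged by
  \<open>1 / limit_cost c n\<close> to work everywhere: below \<open>n\<close> the added term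
  already reaches the bound 1 on \<open>D\<close>.\<close>

lemma undominated_above:
  assumes "0 \<le> K" shows "\<exists>x\<ge>n. K * limit_cost c x < D x"
proof (rule ccontr)
  assume "\<not> ?thesis"
  then have dom: "D x \<le> K * limit_cost c x" if "n \<le> x" for x using that by force
  have "0 < K * limit_cost c n" using D_pos[of n] dom[of n] by simp
  then have pos: "0 < limit_cost c n" using assms by (simp add: zero_less_mult_iff)
  obtain x where x: "(K + 1 / limit_cost c n) * limit_cost c x < D x" using undominated by blast
  show False
  proof (cases "n \<le> x")
    case True
    have "K * limit_cost c x \<le> (K + 1 / limit_cost c n) * limit_cost c x"
      using pos limit_cost_upper(2)[OF c] by (intro mult_right_mono) auto
    then show False using x dom[OF True] by linarith
  next
    case False
    then have le: "limit_cost c n \<le> limit_cost c x" by (intro limit_cost_antimono) simp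
    have "1 \<le> limit_cost c x / limit_cost c n" using pos le by (simp add: pos_le_divide_eq)
    also have "\<dots> \<le> (K + 1 / limit_cost c n) * limit_cost c x"
      using assms limit_cost_upper(2)[OF c, of x] by (simp add: distrib_right)
    finally show False using x D_le[of x] by linarith
  qed
qed

lemma acts_tt_less:
  assumes "act s" "act s'" "ii s = i" "ii s' = i" "Us i s' \<le> s" "s < s'" shows "tt s < tt s'"
proof -
  have "s \<in> acts i s'" using assms by (simp add: acts_def)
  then show ?thesis using assms(2,4) unfolding act_iff[of s'] by blast
qed

text \<open>After the last injury the period is fixed. An eventually profitable position
  \<open>x\<close> forces later places to be at most \<open>x\<close>, so actions with large
  \<open>tt\<close> gain at least half of \<open>D x\<close>, and \<open>epoch_gain\<close> limits
  their number. Actions with small \<open>tt\<close> are few because \<open>tt\<close> strictly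
  increases.\<close>

lemma finite_requirement: "finite {s. act s \<and> ii s = i}"
proof (induction i rule: less_induct)
  case (less i)
  have "finite (\<Union>j<i. {s. act s \<and> ii s = j})" using less by blast
  then obtain s1 where s1: "\<forall>s\<in>(\<Union>j<i. {s. act s \<and> ii s = j}). s < s1"
    by (rule finite_nat_boundE)
  define u where "u = Us i s1"
  have U: "Us i s = u" if "s1 \<le> s" for s
    using that
  proof (induction s rule: dec_induct)
    case base then show ?case by (simp add: u_def)
  next
    case (step s)
    have "\<not> (act s \<and> ii s < i)"
    proof
      assume "act s \<and> ii s < i"
      then have "s \<in> (\<Union>j<i. {s. act s \<and> ii s = j})" by auto
      then show False using s1 step.hyps by (meson not_le)
    qed
    then show ?case using step.IH by auto
  qed
  have u_le: "u \<le> s1" unfolding u_def by (rule Us_le)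
  obtain x where x: "max i u \<le> x" "real (ratio i u) * limit_cost c x < D x"
    using undominated_above[of "real (ratio i u)" "max i u"] by auto
  obtain t0 where t0: "\<forall>t\<ge>t0. \<forall>s\<ge>t0. profit i u s t x" using eventually_profit[OF x(2)] by (elim exE)
  define \<delta> where "\<delta> = D x / 2"
  have \<delta>: "0 < \<delta>" "\<delta> < D x" using D_pos[of x] by (auto simp: \<delta>_def)
  have "(\<lambda>t. d x t - 3 * (1/2) ^ t) \<longlonglongrightarrow> D x - 3 * 0"
    by (intro tendsto_intros d_lim LIMSEQ_realpow_zero) auto
  then have "\<forall>\<^sub>F t in sequentially. \<delta> < d x t - 3 * (1/2) ^ t" using \<delta>(2) by (intro order_tendstoD(1)) auto
  then obtain t1 where t1: "\<forall>t\<ge>t1. \<delta> < d x t - 3 * (1/2) ^ t" by (rule eventually_sequentiallyE)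
  define T where "T = max t0 t1"
  let ?S = "{s. act s \<and> ii s = i}"
  let ?S1 = "{s \<in> ?S. s1 \<le> s \<and> T \<le> tt s}"
  let ?S2 = "{s \<in> ?S. s1 \<le> s \<and> tt s < T}"
  have acts: "tt s < tt s'" if "s \<in> ?S" "s' \<in> ?S" "s1 \<le> s" "s < s'" for s s'
  proof -
    have "Us i s' \<le> s" using U[of s'] that(3,4) u_le by simp
    then show ?thesis using that acts_tt_less[of s s' i] by auto
  qed
  have gain: "\<delta> \<le> gain s" if s: "s \<in> ?S1" for s
  proof -
    have "profit (ii s) (Us (ii s) s) s (tt s) x" using s t0 U[of s] tt_le[of s] by (auto simp: T_def)
    moreover have "max (ii s) (Us (ii s) s) \<le> x" using s U[of s] x(1) by auto
    ultimately have "xx s \<le> x" by (intro xx_le)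
    then have "d x (tt s) \<le> d (xx s) (tt s)" by (rule d_anti)
    moreover have "\<delta> < d x (tt s) - 3 / 2 ^ tt s" using t1 s by (auto simp: T_def power_divide)
    ultimately show ?thesis using gain_bounds(3)[of s] by linarith
  qed
  have "finite ?S1"
  proof (rule ccontr)
    assume inf: "infinite ?S1"
    obtain k where k: "real (target i) + 1 < real k * \<delta>" using reals_Archimedean3[OF \<delta>(1)] by blast
    obtain F where F: "finite F" "card F = k" "F \<subseteq> ?S1" using infinite_arbitrarily_large[OF inf] by blast
    obtain m where m: "\<forall>s\<in>F. s < m" using F(1) by (rule finite_nat_boundE)
    have "real k * \<delta> \<le> (\<Sum>s\<in>F. gain s)"
      using sum_bounded_below[of F \<delta> gain] gain F by auto
    also have "\<dots> \<le> (\<Sum>s | s < m \<and> act s \<and> ii s = i \<and> Us i s = u. gain s)"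
      by (rule sum_mono2) (use m F(3) U gain_bounds(1) in auto)
    also have "\<dots> \<le> real (target i) + 1" by (rule epoch_gain)
    finally show False using k by linarith
  qed
  moreover have "finite ?S2"
  proof (rule finite_imageD[of tt])
    show "finite (tt ` ?S2)" by (rule finite_subset[of _ "{..<T}"]) auto
    show "inj_on tt ?S2"
    proof (rule inj_onI)
      fix s s' assume "s \<in> ?S2" "s' \<in> ?S2" "tt s = tt s'"
      then show "s = s'" using acts[of s s'] acts[of s' s] by (cases s s' rule: linorder_cases) auto
    qed
  qed
  moreover have "?S \<subseteq> ?S1 \<union> ?S2 \<union> {..<s1}" by auto
  ultimately show ?case by (meson finite_Un finite_lessThan finite_subset)
qed

lemma finite_le_requirement: "finite {s. act s \<and> ii s \<le> i}"
proof -
  have "{s. act s \<and> ii s \<le> i} = (\<Union>j\<le>i. {s. act s \<and> ii s = j})" by auto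
  then show ?thesis using finite_requirement by simp
qed

definition A :: "nat set" where "A = {x. \<exists>s0. \<forall>s\<ge>s0. As s x}"

lemma As_stable: "\<exists>s0. \<forall>s\<ge>s0. As s x = (x \<in> A)"
proof -
  obtain s0 where s0: "\<forall>s\<in>{s. act s \<and> ii s \<le> x}. s < s0"
    using finite_le_requirement[of x] by (rule finite_nat_boundE)
  have const: "As s x = As s0 x" if "s0 \<le> s" for s
    using that
  proof (induction s rule: dec_induct)
    case (step s)
    have "\<not> (act s \<and> xx s = x)" using s0 step.hyps profit_at[of s] by auto
    then show ?case using step.IH by (simp add: As_simps)
  qed simp
  have "As s0 x = (x \<in> A)"
  proof
    assume "As s0 x"
    then have "\<forall>s\<ge>s0. As s x" using const by blast
    then show "x \<in> A" unfolding A_def by blast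
  next
    assume "x \<in> A"
    then obtain s1 where "\<forall>s\<ge>s1. As s x" unfolding A_def by blast
    then show "As s0 x" using const[of "max s0 s1"] by simp
  qed
  then show ?thesis using const by (intro exI[of _ s0]) blast
qed

lemma approx: "computable_approx As A"
  unfolding computable_approx_def
proof (intro conjI allI As_stable)
  show "computable2 (\<lambda>s x. if As s x then 1 else 0)"
    unfolding As_def by (intro computable2I cpt_intros cpt_value_at cpt_Hs)
qed

lemma cost_term_As: "cost_term c As (Suc s) = (if act s then c (xx s) (Suc s) else 0)"
proof (cases "act s")
  case True
  have ch: "As s x \<noteq> As (Suc s) x \<longleftrightarrow> x = xx s" for x using True by (auto simp: As_simps)
  then have "As s \<noteq> As (Suc s)" by metis
  moreover have "(LEAST x. As s x \<noteq> As (Suc s) x) = xx s" by (rule Least_equality) (use ch in auto)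
  ultimately show ?thesis using True by (simp add: cost_term_def)
next
  case False
  then have "As s = As (Suc s)" by (auto simp: As_simps)
  then show ?thesis using False by (simp add: cost_term_def)
qed

lemma obeys_c: "obeys A c"
proof -
  have "summable (cost_term c As)"
  proof (rule summableI_nonneg_bounded[where x = 4])
    show "0 \<le> cost_term c As n" for n by (rule cost_term_nonneg[OF c])
    fix n
    have "(\<Sum>s<n. cost_term c As s) \<le> (\<Sum>s<Suc n. cost_term c As s)" using cost_term_nonneg[OF c] by simp
    also have "\<dots> = (\<Sum>s<n. cost_term c As (Suc s))" by (subst sum.lessThan_Suc_shift) (simp add: cost_term_def)
    also have "\<dots> = (\<Sum>r\<in>{r\<in>{..<n}. act r}. c (xx r) (Suc r))"
      unfolding cost_term_As by (rule sum.inter_filter[symmetric]) simp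
    also have "{r\<in>{..<n}. act r} = {r. r < n \<and> act r}" by auto
    also have "(\<Sum>r | r < n \<and> act r. c (xx r) (Suc r)) \<le> 4" by (rule cost_bound)
    finally show "(\<Sum>s<n. cost_term c As s) \<le> 4" .
  qed
  then show ?thesis unfolding obeys_def using approx by blast
qed

text \<open>Requirements of larger index restart after \<open>r\<close> and use only positions
  beyond \<open>r\<close>, while \<open>xx r < r\<close>.\<close>

lemma toggled:
  assumes "act r" "r < s" "\<And>q. r < q \<Longrightarrow> q < s \<Longrightarrow> act q \<Longrightarrow> ii r < ii q"
  shows "As s (xx r) = (\<not> As r (xx r))"
proof -
  have "Suc r \<le> s" using assms(2) by simp
  then show ?thesis using assms(3)
  proof (induction s rule: dec_induct)
    case base then show ?case using assms(1) by (simp add: As_simps)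
  next
    case (step s)
    have "xx s \<noteq> xx r" if "act s"
    proof -
      have "ii r < ii s" using step that by simp
      then have "Suc r \<le> Us (ii s) s" using assms(1) step.hyps by (intro Us_bound) auto
      then have "r < xx s" using profit_at[OF that] by simp
      then show ?thesis using assms(1) act_iff[of r] by auto
    qed
    then show ?case using step by (auto simp: As_simps)
  qed
qed

text \<open>Against an approximation \<open>Bs\<close> of finite \<open>d\<close>-cost there is a
  requirement \<open>i\<close> whose target is at least this cost. Each action in its final period
  forces a separate payment, so the gains stay within the target; once everything relevant has
  settled, \<open>i\<close> acts again, contrary to finiteness.\<close>

lemma not_obeys_d: "\<not> obeys A d"
proof
  assume "obeys A d"
  then obtain Bs where Bs: "computable_approx Bs A" and summ: "summable (cost_term d Bs)"
    unfolding obeys_def by blast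
  obtain p where p: "\<And>s x. ev no_oracle p [s, x] (of_bool (Bs s x))"
    using Bs unfolding computable_approx_def computable2_def of_bool_def by blast
  have B_lim: "\<exists>s0. \<forall>s\<ge>s0. Bs s x = (x \<in> A)" for x using Bs unfolding computable_approx_def by blast
  have B_nonneg: "0 \<le> cost_term d Bs s" for s using d_ge by (simp add: cost_term_def)
  obtain m where m: "suminf (cost_term d Bs) \<le> real m" using real_arch_simple by blast
  define i where "i = prod_encode (code p, m)"
  have i: "opponent i = p" "target i = m" by (simp_all add: i_def opponent_def target_def)
  obtain s1 where "\<forall>s\<in>{s. act s \<and> ii s \<le> i}. s < s1"
    using finite_le_requirement[of i] by (rule finite_nat_boundE)
  then have s1: "i < ii s" if "act s" "s1 \<le> s" for s using that by force
  define u where "u = Us i s1"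
  define R where "R = acts i s1"
  have U: "Us i s = u" if "s1 \<le> s" for s
    using that
  proof (induction s rule: dec_induct)
    case base then show ?case by (simp add: u_def)
  next
    case (step s)
    then show ?case using s1[of s] by auto
  qed
  have before: "r < s1" if "act r" "ii r = i" for r
    using s1[OF that(1)] that(2) by (cases "s1 \<le> r") auto
  have R: "acts i s = R" if "s1 \<le> s" for s
  proof -
    have "r < s \<and> act r \<and> ii r = i \<and> Us i s \<le> r \<longleftrightarrow> r < s1 \<and> act r \<and> ii r = i \<and> Us i s1 \<le> r" for r
      using that before[of r] U[of s] by (auto simp: u_def)
    then show ?thesis by (simp add: R_def acts_def)
  qed
  have u_le: "u \<le> s1" unfolding u_def by (rule Us_le)
  have agree: "Bs t x = As s x" if "agrees s (Hs s) i t x" for s t x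
  proof -
    have "ev no_oracle p [t, x] (of_bool (As s x))"
      using Phi_sound[OF extends_pre, of s no_oracle s] that unfolding agrees_def i As_def by metis
    with p have "of_bool (Bs t x) = (of_bool (As s x) :: nat)" by (rule ev_det)
    then show ?thesis by (simp only: of_bool_eq_iff)
  qed
  have RD: "act r" "ii r = i" "u \<le> r" "r < s1" "Us i r = u" if "r \<in> R" for r
    using that u_def Us_const[of r s1 i] unfolding R_def acts_def by auto
  have B_at: "Bs (tt r) (xx r) = As r (xx r)" if "r \<in> R" for r
    using act_iff[of r] RD[OF that] by (intro agree) auto
  \<comment> \<open>Until the next action of the final period only larger indices act, since an
    action of smaller index would restart the period.\<close>
  have quiet: "i < ii q" if "r \<in> R" "r < q" "q < s" "act q" "\<forall>r'\<in>R. r' \<le> r \<or> s \<le> r'" for r q s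
  proof (rule ccontr)
    assume *: "\<not> i < ii q"
    then have "q < s1" using s1[OF that(4)] by (meson not_le)
    have "ii q \<noteq> i"
    proof
      assume "ii q = i"
      then have "q \<in> R" using that(2,4) \<open>q < s1\<close> RD(3)[OF that(1)] by (simp add: R_def acts_def u_def)
      then show False using that by fastforce
    qed
    then have "Suc q \<le> u" using * Us_bound[OF that(4) _ \<open>q < s1\<close>, of i] by (simp add: u_def)
    then show False using RD(3)[OF that(1)] that(2) by simp
  qed
  \<comment> \<open>Some stage in between changes \<open>x\<close>, so its least change is at most
    \<open>x\<close>, and the monotonicity of \<open>d\<close> bounds the payment from
    below.\<close>
  have change: "\<exists>q>a. q \<le> b \<and> d x a \<le> cost_term d Bs q" if "a \<le> b" "Bs a x \<noteq> Bs b x" for a b x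
  proof -
    have "\<exists>q>a. q \<le> b \<and> Bs (q - 1) x \<noteq> Bs q x"
      using that
    proof (induction b rule: dec_induct)
      case (step b)
      show ?case
      proof (cases "Bs a x = Bs b x")
        case True
        then show ?thesis using step by (intro exI[of _ "Suc b"]) auto
      next
        case False
        then show ?thesis using step.IH by (auto intro: le_SucI)
      qed
    qed simp
    then obtain q where q: "a < q" "q \<le> b" "Bs (q - 1) x \<noteq> Bs q x" by blast
    have "(LEAST y. Bs (q - 1) y \<noteq> Bs q y) \<le> x" by (rule Least_le) (rule q(3))
    then have "d x q \<le> d (LEAST y. Bs (q - 1) y \<noteq> Bs q y) q" by (rule d_anti)
    moreover have "d x a \<le> d x q" using q(1) by (intro d_mono) simp
    moreover have "Bs (q - 1) \<noteq> Bs q" using q(3) by metis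
    ultimately have "d x a \<le> cost_term d Bs q" using q(1) by (simp add: cost_term_def)
    then show ?thesis using q by blast
  qed
  have lim_As: "\<exists>s0\<ge>s1. \<forall>s\<ge>s0. As s x = (x \<in> A)" for x
    using As_stable[of x] by (meson le_trans max.cobounded1 max.cobounded2)
  have finR: "finite R" by (simp add: R_def)
  have tt_less: "tt r < tt r'" if "r \<in> R" "r' \<in> R" "r < r'" for r r'
    using that RD[OF that(1)] RD[OF that(2)] by (intro acts_tt_less) auto
  \<comment> \<open>The payment for the toggle at \<open>r\<close> falls after \<open>tt r\<close>
    and no later than the next \<open>tt\<close>, so different toggles are paid at different stages.
    For the last toggle it is forced by the common limit of both approximations.\<close>
  have "\<exists>q>tt r. gain r \<le> cost_term d Bs q \<and> (\<forall>r'\<in>R. r < r' \<longrightarrow> q \<le> tt r')" if r: "r \<in> R" for r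
  proof -
    have "\<exists>b\<ge>tt r. Bs (tt r) (xx r) \<noteq> Bs b (xx r) \<and> (\<forall>r'\<in>R. r < r' \<longrightarrow> b \<le> tt r')"
    proof (cases "\<exists>r'\<in>R. r < r'")
      case True
      define r' where "r' = (LEAST r'. r' \<in> R \<and> r < r')"
      have r': "r' \<in> R" "r < r'" using LeastI_ex[of "\<lambda>r'. r' \<in> R \<and> r < r'"] True unfolding r'_def by blast+
      have least: "r' \<le> r''" if "r'' \<in> R" "r < r''" for r'' unfolding r'_def using that by (intro Least_le) blast
      have "acts i r' = {q \<in> R. q < r'}"
        using RD[OF r'(1)] unfolding R_def acts_def u_def[symmetric] by auto
      then have "r \<in> acts i r' \<and> (\<forall>q\<in>acts i r'. q \<le> r)" using r r' least by force
      then have "agrees r' (Hs r') i (tt r') (xx r)" using act_iff[of r'] RD[OF r'(1)] by blast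
      then have "Bs (tt r') (xx r) = As r' (xx r)" by (rule agree)
      also have "\<dots> = (\<not> As r (xx r))"
        using quiet[OF r] RD[OF r] least r' by (intro toggled) (auto simp: not_le[symmetric])
      finally have "Bs (tt r) (xx r) \<noteq> Bs (tt r') (xx r)" using B_at[OF r] by simp
      moreover have "tt r' \<le> tt r''" if "r'' \<in> R" "r < r''" for r''
        using least[OF that] tt_less[OF r'(1) that(1)] by (cases "r' = r''") auto
      ultimately show ?thesis using tt_less[OF r r'] by (intro exI[of _ "tt r'"]) auto
    next
      case False
      obtain s0 where s0: "s1 \<le> s0" "\<forall>s\<ge>s0. As s (xx r) = (xx r \<in> A)" using lim_As by blast
      obtain b0 where b0: "\<forall>s\<ge>b0. Bs s (xx r) = (xx r \<in> A)" using B_lim by blast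
      have "As s0 (xx r) = (\<not> As r (xx r))"
        using quiet[OF r] RD[OF r] False s0 by (intro toggled) (auto simp: not_less)
      then have "Bs (tt r) (xx r) \<noteq> Bs (max b0 (tt r)) (xx r)" using B_at[OF r] b0 s0 by auto
      then show ?thesis using False by (intro exI[of _ "max b0 (tt r)"]) auto
    qed
    then obtain b where b: "tt r \<le> b" "Bs (tt r) (xx r) \<noteq> Bs b (xx r)" "\<forall>r'\<in>R. r < r' \<longrightarrow> b \<le> tt r'" by blast
    obtain q where "q > tt r" "q \<le> b" "d (xx r) (tt r) \<le> cost_term d Bs q" using change[OF b(1,2)] by blast
    then show ?thesis using b(3) gain_bounds(2)[of r] by (intro exI[of _ q]) (auto intro: order_trans)
  qed
  then obtain Q where Q: "\<And>r. r \<in> R \<Longrightarrow> tt r < Q r" "\<And>r. r \<in> R \<Longrightarrow> gain r \<le> cost_term d Bs (Q r)"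
     "\<And>r r'. r \<in> R \<Longrightarrow> r' \<in> R \<Longrightarrow> r < r' \<Longrightarrow> Q r \<le> tt r'" by metis
  have "inj_on Q R"
  proof (rule inj_onI)
    fix r r' assume "r \<in> R" "r' \<in> R" "Q r = Q r'"
    then show "r = r'" using Q(1)[of r] Q(1)[of r'] Q(3)[of r r'] Q(3)[of r' r] by (cases r r' rule: linorder_cases) auto
  qed
  have "(\<Sum>r\<in>R. gain r) \<le> (\<Sum>r\<in>R. cost_term d Bs (Q r))" by (intro sum_mono Q(2))
  also have "\<dots> = (\<Sum>q\<in>Q ` R. cost_term d Bs q)" using \<open>inj_on Q R\<close> by (simp add: sum.reindex)
  also have "\<dots> \<le> suminf (cost_term d Bs)" by (rule sum_le_suminf[OF summ]) (use B_nonneg finR in auto)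
  finally have gainR: "(\<Sum>r\<in>R. gain r) \<le> real (target i)" using m i by simp

  obtain x where x: "max i u \<le> x" "real (ratio i u) * limit_cost c x < D x"
    using undominated_above[of "real (ratio i u)" "max i u"] by auto
  obtain t0 where t0: "\<forall>t\<ge>t0. \<forall>s\<ge>t0. profit i u s t x" using eventually_profit[OF x(2)] by (elim exE)
  \<comment> \<open>All positions where \<open>ok\<close> can ask for agreement: the new place,
    which is at most \<open>x\<close>, and the places of the final period.\<close>
  define X where "X = {..x} \<union> xx ` R"
  have finX: "finite X" using finR by (simp add: X_def)
  have ev_B: "\<forall>\<^sub>F t in sequentially. \<forall>y\<in>X. Bs t y = (y \<in> A)"
    by (rule eventually_ball_finite[OF finX]) (simp add: eventually_sequentially B_lim)
  have ev_tt: "\<forall>\<^sub>F t in sequentially. \<forall>r\<in>R. tt r < t"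
    using finR by (simp add: eventually_ball_finite_distrib eventually_gt_at_top)
  have "\<forall>\<^sub>F t in sequentially. (\<forall>y\<in>X. Bs t y = (y \<in> A)) \<and> (\<forall>r\<in>R. tt r < t) \<and> t0 \<le> t"
    by (intro eventually_conj ev_B ev_tt eventually_ge_at_top)
  then obtain t where t: "\<forall>y\<in>X. Bs t y = (y \<in> A)" "\<forall>r\<in>R. tt r < t" "t0 \<le> t"
    using eventually_happens'[OF sequentially_bot] by blast
  have ev_A: "\<forall>\<^sub>F s in sequentially. \<forall>y\<in>X. As s y = (y \<in> A)"
    by (rule eventually_ball_finite[OF finX]) (simp add: eventually_sequentially As_stable)
  have ev_Phi: "\<forall>\<^sub>F s in sequentially. \<forall>y\<in>X. Phi s (pre no_oracle s) p [t, y] (of_bool (Bs t y))"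
  proof -
    have "\<forall>\<^sub>F s in sequentially. Phi s (pre no_oracle s) p [t, y] (of_bool (Bs t y))" for y
    proof -
      obtain N where "\<forall>s\<ge>N. \<forall>bs. N \<le> length bs \<longrightarrow> extends no_oracle bs \<longrightarrow> Phi s bs p [t, y] (of_bool (Bs t y))"
        using Phi_complete[OF p[of t y]] by (elim exE)
      then show ?thesis unfolding eventually_sequentially by (intro exI[of _ N]) simp
    qed
    then show ?thesis using finX by (simp add: eventually_ball_finite_distrib)
  qed
  have "\<forall>\<^sub>F s in sequentially. (\<forall>y\<in>X. As s y = (y \<in> A)) \<and> (\<forall>y\<in>X. Phi s (pre no_oracle s) p [t, y] (of_bool (Bs t y)))
     \<and> x < s \<and> t0 \<le> s \<and> s1 \<le> s"
    by (intro eventually_conj ev_A ev_Phi eventually_ge_at_top eventually_gt_at_top)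
  then obtain N where N: "\<forall>s\<ge>N. (\<forall>y\<in>X. As s y = (y \<in> A)) \<and> (\<forall>y\<in>X. Phi s (pre no_oracle s) p [t, y] (of_bool (Bs t y)))
     \<and> x < s \<and> t0 \<le> s \<and> s1 \<le> s"
    by (rule eventually_sequentiallyE)
  define s where "s = prod_encode (prod_encode (i, t), N)"
  have "N \<le> s" unfolding s_def by (rule le_prod_encode_2)
  with N have s: "\<forall>y\<in>X. As s y = (y \<in> A)" "\<forall>y\<in>X. Phi s (pre no_oracle s) p [t, y] (of_bool (Bs t y))"
    "x < s" "t0 \<le> s" "s1 \<le> s" by blast+
  have st: "ii s = i" "tt s = t" by (simp_all add: s_def ii_def tt_def)
  have "xx s \<le> x" by (rule xx_le) (use x t0 t s U in \<open>simp_all add: st\<close>)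
  have ag: "agrees s (Hs s) i t y" if "y \<in> X" for y
  proof -
    have "value_at (Hs s) y = Bs t y" using s(1) t(1) that by (simp add: As_def)
    then show ?thesis unfolding agrees_def i using s(2) that by simp
  qed
  have "act s"
    unfolding act_iff st R[OF s(5)]
    using \<open>xx s \<le> x\<close> s(3) t(2) gainR ag by (auto simp: X_def)
  then show False using s1[of s] s(5) st by simp
qed

end

lemma cost_domination:
  assumes "cost_function c" "dyadic_lower l c" "dyadic_lower ld d"
    and "\<And>x s s'. s \<le> s' \<Longrightarrow> d x s \<le> d x s'" "\<And>x x' s. x \<le> x' \<Longrightarrow> d x' s \<le> d x s"
    and "\<And>x s. 0 \<le> d x s" "\<And>x s. d x s \<le> 1" "\<And>x. d x \<longlonglongrightarrow> D x" "\<And>x. 0 < D x"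
    and obeys: "\<And>A. obeys A c \<Longrightarrow> obeys A d"
  shows "\<exists>K. \<forall>x. D x \<le> K * limit_cost c x"
proof (rule ccontr)
  assume "\<not> ?thesis"
  then have "\<exists>x. K * limit_cost c x < D x" for K by (meson not_le)
  then interpret toggle c d l ld D using assms by unfold_locales auto
  show False using obeys[OF obeys_c] not_obeys_d by blast
qed

section \<open>The smart set\<close>

text \<open>The pair \<open>q = (e, n)\<close> keeps a marker outside the set and watches the strings whose \<open>e\<close>-th computation agrees with
  the set up to the marker. If their measure exceeds \<open>2 ^ e\<close> times the cost of \<open>n\<close>, the marker is enumerated and they
  become errors for \<open>e\<close> for good. The cost of the enumeration is thus charged to an increase of the measure of the
  errors, weighted by \<open>(1/2) ^ e\<close>.\<close>
locale smart_construction =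
  fixes c :: "nat \<Rightarrow> nat \<Rightarrow> real" and l :: "nat \<Rightarrow> nat \<Rightarrow> nat"
  assumes c: "cost_function c" and l: "dyadic_lower l c" and pos: "\<And>x. 0 < limit_cost c x"
    and growth: "\<And>a. cpt no_oracle a \<Longrightarrow> mono (\<lambda>s. real (a s) / 2 ^ s) \<Longrightarrow> (\<And>s. real (a s) / 2 ^ s \<le> 1) \<Longrightarrow>
      \<exists>K. \<forall>n m. real (a m) / 2 ^ m - real (a n) / 2 ^ n \<le> K * limit_cost c n"
begin

text \<open>The least element of column \<open>q\<close> still outside the set. Columns keep the
  pairs apart, and the marker is at least \<open>q\<close>, hence at least the second component of
  \<open>q\<close>, whose cost therefore bounds that of the marker.\<close>

definition marker :: "nat list \<Rightarrow> nat \<Rightarrow> nat" where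
  "marker A q = prod_encode (q, LEAST i. prod_encode (q, i) \<notin> set A)"
text \<open>Only an answer 0 on an element counts: the set grows, so such an error is permanent,
  whereas a wrong answer 1 may become right.\<close>

definition err :: "nat \<Rightarrow> nat list \<Rightarrow> nat \<Rightarrow> bool list \<Rightarrow> bool" where
  "err s A e bs \<longleftrightarrow> (\<exists>z\<in>set A. Phi s bs (decode e) [z] 0)"
definition correct :: "nat \<Rightarrow> nat list \<Rightarrow> nat \<Rightarrow> bool list \<Rightarrow> bool" where
  "correct s A q bs \<longleftrightarrow> (\<forall>z\<le>marker A q. Phi s bs (decode (fst (prod_decode q))) [z] (of_bool (z \<in> set A)))"
definition watched :: "nat \<Rightarrow> nat list \<Rightarrow> nat \<Rightarrow> bool list \<Rightarrow> bool" where
  "watched s A q bs \<longleftrightarrow> correct s A q bs \<and> \<not> err s A (fst (prod_decode q)) bs"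
text \<open>For \<open>q\<close> coding \<open>(e, n)\<close>, the measure
  \<open>cnt s (watched s A q) / 2 ^ s\<close> is compared with \<open>2 ^ e\<close> times the upper
  bound \<open>(l n (Suc s) + 3) / 2 ^ Suc s\<close> of the cost; the factor 2 matches the
  denominators.\<close>

definition big :: "nat \<Rightarrow> nat list \<Rightarrow> nat \<Rightarrow> bool" where
  "big s A q \<longleftrightarrow> 2 ^ fst (prod_decode q) * (l (snd (prod_decode q)) (Suc s) + 3) < 2 * cnt s (watched s A q)"
definition qq :: "nat \<Rightarrow> nat" where "qq s = fst (prod_decode s)"
definition As :: "nat \<Rightarrow> nat list" where
  "As s = rec_nat [] (\<lambda>s A. if big s A (qq s) then marker A (qq s) # A else A) s"
definition act :: "nat \<Rightarrow> bool" where "act s \<longleftrightarrow> big s (As s) (qq s)"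
definition ee :: "nat \<Rightarrow> nat" where "ee s = fst (prod_decode (qq s))"
definition lev :: "nat \<Rightarrow> nat" where "lev s = snd (prod_decode (qq s))"
definition A :: "nat set" where "A = {x. \<exists>s. x \<in> set (As s)}"
definition errs :: "nat \<Rightarrow> nat \<Rightarrow> nat" where "errs e s = cnt s (err s (As s) e)"
definition al :: "nat \<Rightarrow> nat \<Rightarrow> real" where "al e s = real (errs e s) / 2 ^ s"

section \<open>The measure of errors pays for the set\<close>

lemma As_simps [simp]: "As 0 = []" "As (Suc s) = (if act s then marker (As s) (qq s) # As s else As s)"
  by (simp_all add: As_def act_def)

lemma marker_ex: "\<exists>i. prod_encode (q, i) \<notin> set L"
proof -
  have "infinite (range (\<lambda>i. prod_encode (q, i)))"
    using finite_imageD[of "\<lambda>i. prod_encode (q, i)" UNIV] by (auto simp: inj_on_def)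
  then have "\<not> range (\<lambda>i. prod_encode (q, i)) \<subseteq> set L" by (meson finite_set finite_subset)
  then show ?thesis by blast
qed

lemma marker_notin: "marker L q \<notin> set L"
  unfolding marker_def by (rule LeastI_ex) (rule marker_ex)

lemma l_cpt: "cpt Y (\<lambda>p. l (fst p) (snd p))"
  using l by (auto simp: dyadic_lower_def intro: cpt_oracle_free)

lemma cpt_marker:
  assumes "cpt Y L" "cpt Y q" shows "cpt Y (\<lambda>x. marker (L x) (q x))"
  unfolding marker_def
  by (intro cpt_intros cpt_Least assms cpt_o[OF assms(1)] cpt_o[OF assms(2)] marker_ex)

lemma cpt_err:
  assumes "cpt Y s" "cpt Y L" "cpt Y e" "cpt Y bs" shows "cpt Y (\<lambda>x. err (s x) (L x) (e x) (bs x))"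
  unfolding err_def
  by (intro cpt_intros assms cpt_o[OF assms(1)] cpt_o[OF assms(3)] cpt_o[OF assms(4)])

lemma cpt_correct:
  assumes "cpt Y s" "cpt Y L" "cpt Y q" "cpt Y bs" shows "cpt Y (\<lambda>x. correct (s x) (L x) (q x) (bs x))"
  unfolding correct_def
  by (intro cpt_intros cpt_marker assms cpt_o[OF assms(1)] cpt_o[OF assms(2)] cpt_o[OF assms(3)] cpt_o[OF assms(4)])

lemma cpt_watched:
  assumes "cpt Y s" "cpt Y L" "cpt Y q" "cpt Y bs" shows "cpt Y (\<lambda>x. watched (s x) (L x) (q x) (bs x))"
  unfolding watched_def by (intro cpt_intros cpt_correct cpt_err assms)

lemma cpt_As: "cpt Y f \<Longrightarrow> cpt Y (\<lambda>x. As (f x))"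
  unfolding As_def big_def qq_def by (intro cpt_intros cpt_marker cpt_watched cpt_2[OF l_cpt])

lemma cpt_errs: "cpt Y (errs e)"
  unfolding errs_def by (intro cpt_intros cpt_err cpt_As)

lemma As_mono: "s \<le> t \<Longrightarrow> set (As s) \<subseteq> set (As t)"
  by (induction t rule: dec_induct) auto

lemma err_mono:
  assumes "err s (As s) e (take s bs)" "s \<le> t" "s \<le> length bs" shows "err t (As t) e (take t bs)"
  using assms(1) Phi_mono[OF _ assms(2,3)] As_mono[OF assms(2)] unfolding err_def by blast

lemma cnt_err_take: "s \<le> t \<Longrightarrow> cnt t (\<lambda>bs. err s (As s) e (take s bs)) = 2 ^ (t - s) * errs e s"
  unfolding errs_def by (rule cnt_lift')

lemma errs_mono: "s \<le> t \<Longrightarrow> 2 ^ (t - s) * errs e s \<le> errs e t"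
  unfolding cnt_err_take[symmetric] unfolding errs_def[of e t]
proof (rule cnt_mono)
  fix bs :: "bool list" assume st: "s \<le> t" "length bs = t" "err s (As s) e (take s bs)"
  have "err t (As t) e (take t bs)" by (rule err_mono[OF st(3) st(1)]) (simp add: st)
  then show "err t (As t) e bs" using st(2) by simp
qed

lemma al_mono: "s \<le> t \<Longrightarrow> al e s \<le> al e t"
proof -
  assume "s \<le> t"
  then have "real (2 ^ (t - s) * errs e s) \<le> real (errs e t)" by (intro of_nat_mono errs_mono)
  then have "2 ^ (t - s) * real (errs e s) * 2 ^ s \<le> real (errs e t) * 2 ^ s" by (intro mult_right_mono) auto
  moreover have "2 ^ (t - s) * real (errs e s) * 2 ^ s = real (errs e s) * (2 ^ (t - s) * 2 ^ s)" by simp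
  moreover have "(2::real) ^ (t - s) * 2 ^ s = 2 ^ t" using \<open>s \<le> t\<close> by (simp flip: power_add)
  ultimately have "real (errs e s) * 2 ^ t \<le> real (errs e t) * 2 ^ s" by (simp only:)
  then show ?thesis by (simp add: al_def field_simps)
qed

lemma al_bounds: "0 \<le> al e s" "al e s \<le> 1"
proof -
  have "real (errs e s) \<le> real (2 ^ s)" unfolding errs_def by (intro of_nat_mono cnt_le)
  then show "0 \<le> al e s" "al e s \<le> 1" by (simp_all add: al_def)
qed

text \<open>The watched strings answer 0 at the marker and are not yet errors, so enumerating the
  marker adds their whole measure to that of the errors.\<close>

lemma act_step:
  assumes "act s" shows "2 ^ ee s * c (lev s) (Suc s) \<le> al (ee s) (Suc s) - al (ee s) s"
proof -
  let ?W = "\<lambda>bs. watched s (As s) (qq s) bs" and ?E = "\<lambda>bs. err s (As s) (ee s) bs"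
  have "cnt s ?E + cnt s ?W = cnt s (\<lambda>bs. ?E bs \<or> ?W bs)"
    by (rule cnt_disjoint[symmetric]) (simp add: watched_def ee_def)
  then have "2 * (errs (ee s) s + cnt s ?W) = cnt (Suc s) (\<lambda>bs. ?E (take s bs) \<or> ?W (take s bs))"
    using cnt_lift'[of s "Suc s" "\<lambda>bs. ?E bs \<or> ?W bs"] by (simp add: errs_def)
  also have "\<dots> \<le> errs (ee s) (Suc s)" unfolding errs_def
  proof (rule cnt_mono)
    fix bs :: "bool list" assume len: "length bs = Suc s" and "?E (take s bs) \<or> ?W (take s bs)"
    then consider "?E (take s bs)" | "?W (take s bs)" by blast
    then show "err (Suc s) (As (Suc s)) (ee s) bs"
    proof cases
      case 1 then show ?thesis using err_mono[of s "ee s" bs "Suc s"] len by simp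
    next
      case 2
      let ?k = "marker (As s) (qq s)"
      have "Phi s (take s bs) (decode (ee s)) [?k] (of_bool (?k \<in> set (As s)))"
        using 2 unfolding watched_def correct_def ee_def by blast
      then have "Phi s (take s bs) (decode (ee s)) [?k] 0" by (simp add: marker_notin)
      then have "Phi (Suc s) (take (Suc s) bs) (decode (ee s)) [?k] 0"
        by (rule Phi_mono) (simp_all add: len)
      then show ?thesis using assms len by (simp add: err_def)
    qed
  qed
  finally have "real (2 * (errs (ee s) s + cnt s ?W)) \<le> real (errs (ee s) (Suc s))" by (rule of_nat_mono)
  then have 1: "2 * real (errs (ee s) s) + 2 * real (cnt s ?W) \<le> real (errs (ee s) (Suc s))" by simp
  have "2 ^ ee s * (l (lev s) (Suc s) + 3) < 2 * cnt s ?W"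
    using assms unfolding act_def big_def ee_def lev_def .
  then have "real (2 ^ ee s * (l (lev s) (Suc s) + 3)) < real (2 * cnt s ?W)" by (rule of_nat_less_iff[THEN iffD2])
  then have 2: "2 ^ ee s * (real (l (lev s) (Suc s)) + 3) < 2 * real (cnt s ?W)" by simp
  have "2 ^ Suc s * c (lev s) (Suc s) \<le> real (l (lev s) (Suc s)) + 3" using l unfolding dyadic_lower_def by blast
  then have "2 ^ ee s * (2 ^ Suc s * c (lev s) (Suc s)) \<le> 2 ^ ee s * (real (l (lev s) (Suc s)) + 3)"
    by (rule mult_left_mono) simp
  moreover have "2 ^ ee s * c (lev s) (Suc s) * 2 ^ Suc s = 2 ^ ee s * (2 ^ Suc s * c (lev s) (Suc s))"
    by (simp only: mult_ac)
  ultimately have "2 ^ ee s * c (lev s) (Suc s) * 2 ^ Suc s \<le> real (errs (ee s) (Suc s)) - 2 * real (errs (ee s) s)"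
    using 1 2 by linarith
  then have "2 ^ ee s * c (lev s) (Suc s) \<le> (real (errs (ee s) (Suc s)) - 2 * real (errs (ee s) s)) / 2 ^ Suc s"
    by (simp only: pos_le_divide_eq zero_less_power zero_less_numeral)
  then show ?thesis by (simp add: al_def diff_divide_distrib)
qed

text \<open>For each \<open>e\<close> the error measure increases by at most 1 in total, so 2 is the
  bound on the sum of the weights \<open>(1/2) ^ e\<close>.\<close>

lemma cost_sum: "(\<Sum>s<S. if act s then c (lev s) (Suc s) else 0) \<le> 2"
proof -
  have geo: "(\<Sum>e<S. (1/2::real) ^ e) \<le> 2" using sum_gp_strict[of "1/2::real" S] by simp
  have inc: "0 \<le> al e (Suc s) - al e s" for e s using al_mono[of s "Suc s" e] by simp
  have "(\<Sum>s<S. if act s then c (lev s) (Suc s) else 0) \<le> (\<Sum>s<S. \<Sum>e<S. (1/2) ^ e * (al e (Suc s) - al e s))"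
  proof (rule sum_mono)
    fix s assume s: "s \<in> {..<S}"
    have "ee s \<in> {..<S}"
      using s prod_decode_le[of s] prod_decode_le[of "fst (prod_decode s)"] by (auto simp: ee_def qq_def)
    then have "(1/2) ^ ee s * (al (ee s) (Suc s) - al (ee s) s) \<le> (\<Sum>e<S. (1/2) ^ e * (al e (Suc s) - al e s))"
      by (intro member_le_sum) (use inc in auto)
    moreover have "c (lev s) (Suc s) \<le> (1/2) ^ ee s * (al (ee s) (Suc s) - al (ee s) s)" if "act s"
      using act_step[OF that] by (simp add: power_divide field_simps)
    moreover have "0 \<le> (1/2) ^ ee s * (al (ee s) (Suc s) - al (ee s) s)" using inc by simp
    ultimately show "(if act s then c (lev s) (Suc s) else 0) \<le> (\<Sum>e<S. (1/2) ^ e * (al e (Suc s) - al e s))" by fastforce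
  qed
  also have "\<dots> = (\<Sum>e<S. (1/2) ^ e * (\<Sum>s<S. al e (Suc s) - al e s))"
    by (subst sum.swap) (simp add: sum_distrib_left)
  also have "\<dots> \<le> (\<Sum>e<S. (1/2) ^ e)"
  proof (rule sum_mono)
    fix e
    have "(\<Sum>s<S. al e (Suc s) - al e s) \<le> 1"
      using sum_lessThan_telescope[of "al e" S] al_bounds[of e] by (smt (verit))
    then show "(1/2) ^ e * (\<Sum>s<S. al e (Suc s) - al e s) \<le> (1/2) ^ e" by (simp add: mult_left_le)
  qed
  finally show ?thesis using geo by simp
qed

lemma approx: "computable_approx (\<lambda>s x. x \<in> set (As s)) A"
  unfolding computable_approx_def
proof (intro conjI allI)
  show "computable2 (\<lambda>s x. if x \<in> set (As s) then 1 else 0)"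
    by (intro computable2I cpt_intros cpt_As)
  fix x
  show "\<exists>s0. \<forall>s\<ge>s0. (x \<in> set (As s)) = (x \<in> A)"
  proof (cases "x \<in> A")
    case True
    then obtain s0 where "x \<in> set (As s0)" unfolding A_def by blast
    then show ?thesis using True As_mono by blast
  next
    case False then show ?thesis unfolding A_def by blast
  qed
qed

lemma ce: "ce_set A"
  unfolding A_def by (intro ce_set_search cpt_intros cpt_As)

lemma obeys_c: "obeys A c"
proof -
  let ?B = "\<lambda>s x. x \<in> set (As s)"
  have le: "cost_term c ?B (Suc s) \<le> (if act s then c (lev s) (Suc s) else 0)" for s
  proof (cases "act s")
    case True
    let ?k = "marker (As s) (qq s)"
    have ch: "?B s x \<noteq> ?B (Suc s) x \<longleftrightarrow> x = ?k" for x using True marker_notin[of "As s" "qq s"] by auto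
    have "(LEAST x. ?B s x \<noteq> ?B (Suc s) x) = ?k" by (rule Least_equality) (use ch in auto)
    then have "cost_term c ?B (Suc s) \<le> max 0 (c ?k (Suc s))" by (simp add: cost_term_def)
    moreover have "lev s \<le> ?k"
      using prod_decode_le(2)[of "qq s"] le_prod_encode_1[of "qq s"] unfolding lev_def marker_def by (meson le_trans)
    then have "c ?k (Suc s) \<le> c (lev s) (Suc s)" by (rule cost_mono(2)[OF c])
    moreover have "0 \<le> c ?k (Suc s)" using c by (simp add: cost_function_def)
    ultimately show ?thesis using True by simp
  next
    case False then show ?thesis by (simp add: cost_term_def)
  qed
  have "summable (cost_term c ?B)"
  proof (rule summableI_nonneg_bounded[where x = 2])
    show "0 \<le> cost_term c ?B n" for n by (rule cost_term_nonneg[OF c])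
    fix n
    have "(\<Sum>s<n. cost_term c ?B s) \<le> (\<Sum>s<Suc n. cost_term c ?B s)" using cost_term_nonneg[OF c] by simp
    also have "\<dots> = (\<Sum>s<n. cost_term c ?B (Suc s))" by (subst sum.lessThan_Suc_shift) (simp add: cost_term_def)
    also have "\<dots> \<le> (\<Sum>s<n. if act s then c (lev s) (Suc s) else 0)" by (intro sum_mono le)
    also have "\<dots> \<le> 2" by (rule cost_sum)
    finally show "(\<Sum>s<n. cost_term c ?B s) \<le> 2" .
  qed
  then show ?thesis unfolding obeys_def using approx by blast
qed

text \<open>Late actions for \<open>q\<close> each raise the bounded quantity \<open>al e\<close> by
  at least half of the positive limit cost.\<close>

lemma finite_acts: "finite {s. act s \<and> qq s = q}"
proof -
  define e n where "e = fst (prod_decode q)" and "n = snd (prod_decode q)"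
  define \<delta> where "\<delta> = limit_cost c n / 2"
  have \<delta>: "0 < \<delta>" "\<delta> < limit_cost c n" using pos[of n] by (auto simp: \<delta>_def)
  obtain s1 where s1: "\<forall>s\<ge>s1. \<delta> < c n s"
    using order_tendstoD(1)[OF limit_cost_upper(3)[OF c] \<delta>(2)] by (rule eventually_sequentiallyE)
  have "finite {s. act s \<and> qq s = q \<and> s1 \<le> s}"
  proof (rule ccontr)
    assume inf: "infinite {s. act s \<and> qq s = q \<and> s1 \<le> s}"
    obtain k where k: "1 < real k * \<delta>" using reals_Archimedean3[OF \<delta>(1)] by blast
    obtain F where F: "finite F" "card F = k" "F \<subseteq> {s. act s \<and> qq s = q \<and> s1 \<le> s}"
      using infinite_arbitrarily_large[OF inf] by blast
    obtain m where m: "\<forall>s\<in>F. s < m" using F(1) by (rule finite_nat_boundE)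
    have "\<delta> \<le> al e (Suc s) - al e s" if "s \<in> F" for s
    proof -
      have s: "act s" "ee s = e" "lev s = n" "s1 \<le> Suc s" using F(3) that by (auto simp: ee_def lev_def e_def n_def)
      have "\<delta> \<le> 1 * c n (Suc s)" using s1 s(4) by (simp add: less_imp_le)
      also have "\<dots> \<le> 2 ^ e * c n (Suc s)" using c by (intro mult_right_mono) (auto simp: cost_function_def)
      also have "\<dots> \<le> al e (Suc s) - al e s" using act_step[OF s(1)] by (simp add: s)
      finally show ?thesis .
    qed
    then have "real k * \<delta> \<le> (\<Sum>s\<in>F. al e (Suc s) - al e s)"
      using sum_bounded_below[of F \<delta> "\<lambda>s. al e (Suc s) - al e s"] F(2) by auto
    also have "\<dots> \<le> (\<Sum>s<m. al e (Suc s) - al e s)"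
      by (rule sum_mono2) (use m al_mono[of _ "Suc _" e] in auto)
    also have "\<dots> = al e m - al e 0" by (rule sum_lessThan_telescope)
    also have "\<dots> \<le> 1" using al_bounds[of e m] al_bounds[of e 0] by linarith
    finally show False using k by linarith
  qed
  moreover have "{s. act s \<and> qq s = q} \<subseteq> {s. act s \<and> qq s = q \<and> s1 \<le> s} \<union> {..<s1}" by auto
  ultimately show ?thesis by (meson finite_Un finite_lessThan finite_subset)
qed

lemma marker_stable: "\<exists>s0. \<forall>s\<ge>s0. marker (As s) q = marker (As s0) q"
proof -
  obtain s0 where s0: "\<forall>s\<in>{s. act s \<and> qq s = q}. s < s0"
    using finite_acts[of q] by (rule finite_nat_boundE)
  have "marker (As s) q = marker (As s0) q" if "s0 \<le> s" for s
    using that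
  proof (induction s rule: dec_induct)
    case (step s)
    have "prod_encode (q, i) \<in> set (As (Suc s)) \<longleftrightarrow> prod_encode (q, i) \<in> set (As s)" for i
    proof (cases "act s")
      case True
      then have "qq s \<noteq> q" using s0 step.hyps by auto
      then show ?thesis by (simp add: marker_def)
    qed simp
    then show ?case using step.IH by (simp add: marker_def del: As_simps)
  qed simp
  then show ?thesis by blast
qed

text \<open>An element entering the set at or below the marker would turn the old answer 0 into an
  error. Without an error the set is thus unchanged up to the marker, which stays in place.\<close>

lemma correct_persists:
  assumes "correct s (As s) q (take s bs)" "s \<le> t" "t \<le> length bs" "\<not> err t (As t) (fst (prod_decode q)) (take t bs)"
  shows "correct t (As t) q (take t bs)"
proof -
  let ?k = "marker (As s) q"
  have Phi: "Phi t (take t bs) (decode (fst (prod_decode q))) [z] (of_bool (z \<in> set (As s)))" if "z \<le> ?k" for z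
    by (rule Phi_mono[of s]) (use assms that in \<open>auto simp: correct_def\<close>)
  have same: "z \<in> set (As t) \<longleftrightarrow> z \<in> set (As s)" if "z \<le> ?k" for z
    using Phi[OF that] assms(4) As_mono[OF assms(2)] unfolding err_def by (cases "z \<in> set (As s)") auto
  have "marker (As t) q = ?k"
  proof -
    define i where "i = (LEAST i. prod_encode (q, i) \<notin> set (As s))"
    have k: "?k = prod_encode (q, i)" by (simp add: marker_def i_def)
    have "(LEAST i. prod_encode (q, i) \<notin> set (As t)) = i"
    proof (rule Least_equality)
      show "prod_encode (q, i) \<notin> set (As t)" using same[of ?k] marker_notin[of "As s" q] by (simp add: k)
      fix j assume "prod_encode (q, j) \<notin> set (As t)"
      then have "prod_encode (q, j) \<notin> set (As s)" using As_mono[OF assms(2)] by blast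
      then show "i \<le> j" unfolding i_def by (rule Least_le)
    qed
    then show ?thesis by (simp add: marker_def i_def)
  qed
  then show ?thesis using Phi same by (simp add: correct_def)
qed

text \<open>The quantifier over all \<open>m \<le> n\<close> makes the components nested. The bound
  \<open>m \<le> s\<close> discards strings that are errors by stage \<open>m\<close>, so only later
  errors count towards the measure.\<close>

definition V :: "nat \<Rightarrow> nat \<Rightarrow> bool list \<Rightarrow> bool" where
  "V e n bs \<longleftrightarrow> (\<forall>m\<le>n. \<exists>s\<le>length bs. m \<le> s \<and> watched s (As s) (prod_encode (e, m)) (take s bs))"

lemma V_up:
  assumes "V e n cs" "length cs \<le> length bs" "take (length cs) bs = cs" shows "V e n bs"
  unfolding V_def
proof (intro allI impI)
  fix m assume "m \<le> n"
  then obtain s where s: "s \<le> length cs" "m \<le> s" "watched s (As s) (prod_encode (e, m)) (take s cs)"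
    using assms(1) unfolding V_def by blast
  have "take s cs = take s bs" using s(1) assms(3) by (metis min.absorb1 take_take)
  then show "\<exists>s\<le>length bs. m \<le> s \<and> watched s (As s) (prod_encode (e, m)) (take s bs)"
    using s assms(2) by (intro exI[of _ s]) simp
qed

text \<open>At a stage \<open>t\<close> that attends to \<open>(e, n)\<close> without acting, a
  string of \<open>V e n\<close> either has become an error since stage \<open>n\<close> or, by
  \<open>correct_persists\<close>, is still watched; the watched ones are few because
  \<open>big\<close> fails.\<close>

lemma V_cnt:
  assumes "max L n \<le> t" "qq t = prod_encode (e, n)" "\<not> act t"
  shows "real (cnt L (V e n)) \<le> 2 ^ L * (al e t - al e n + 2 ^ e * (limit_cost c n + 3 * (1/2) ^ t))"
proof -
  let ?q = "prod_encode (e, n)"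
  let ?E = "\<lambda>s bs. err s (As s) e (take s bs)"
  let ?W = "\<lambda>bs. watched t (As t) ?q bs"
  have split: "(?E t bs \<and> \<not> ?E n bs) \<or> ?W bs" if len: "length bs = t" and V: "V e n (take L bs)" for bs
  proof -
    obtain s where "s \<le> length (take L bs)" "n \<le> s" "watched s (As s) ?q (take s (take L bs))"
      using V unfolding V_def by blast
    then have s: "s \<le> L" "n \<le> s" "watched s (As s) ?q (take s bs)" by (auto simp: min_def split: if_splits)
    have "\<not> ?E n bs"
      using s err_mono[of n e bs s] assms(1) len unfolding watched_def by auto
    moreover have "?W bs" if "\<not> ?E t bs"
      using correct_persists[of s ?q bs t] s assms(1) len that unfolding watched_def by simp
    ultimately show ?thesis by blast
  qed
  have "?E t bs" if "length bs = t" "?E n bs" for bs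
    by (rule err_mono[OF that(2)]) (use assms(1) that(1) in auto)
  then have "cnt t (\<lambda>bs. (?E t bs \<and> \<not> ?E n bs) \<or> ?E n bs) = cnt t (?E t)"
    by (intro cnt_cong) blast
  also have "\<dots> = errs e t" unfolding errs_def by (rule cnt_cong) simp
  finally have "cnt t (\<lambda>bs. ?E t bs \<and> \<not> ?E n bs) + 2 ^ (t - n) * errs e n = errs e t"
    using cnt_disjoint[of t "\<lambda>bs. ?E t bs \<and> \<not> ?E n bs" "?E n"] cnt_err_take[of n t e] assms(1) by simp
  then have "real (cnt t (\<lambda>bs. ?E t bs \<and> \<not> ?E n bs) + 2 ^ (t - n) * errs e n) = real (errs e t)"
    by (rule arg_cong)
  then have "real (cnt t (\<lambda>bs. ?E t bs \<and> \<not> ?E n bs)) + 2 ^ (t - n) * real (errs e n) = real (errs e t)"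
    by (simp only: of_nat_add of_nat_mult of_nat_power of_nat_numeral)
  moreover have "(2::real) ^ (t - n) = 2 ^ t / 2 ^ n" using assms(1) by (simp add: power_diff)
  ultimately have E: "real (cnt t (\<lambda>bs. ?E t bs \<and> \<not> ?E n bs)) = 2 ^ t * (al e t - al e n)"
    by (simp add: al_def right_diff_distrib)
  have "2 * cnt t ?W \<le> 2 ^ e * (l n (Suc t) + 3)"
    using assms(2,3) unfolding act_def big_def by simp
  then have "real (2 * cnt t ?W) \<le> real (2 ^ e * (l n (Suc t) + 3))" by (rule of_nat_mono)
  then have "2 * real (cnt t ?W) \<le> 2 ^ e * (real (l n (Suc t)) + 3)" by simp
  also have "\<dots> \<le> 2 ^ e * (2 ^ Suc t * limit_cost c n + 6)"
  proof (intro mult_left_mono)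
    have "real (l n (Suc t)) \<le> 2 ^ Suc t * c n (Suc t)" using l unfolding dyadic_lower_def by blast
    also have "\<dots> \<le> 2 ^ Suc t * limit_cost c n" using limit_cost_upper(1)[OF c] by (intro mult_left_mono) auto
    finally show "real (l n (Suc t)) + 3 \<le> 2 ^ Suc t * limit_cost c n + 6" by simp
  qed simp
  also have "\<dots> = 2 * (2 ^ t * (2 ^ e * (limit_cost c n + 3 * (1/2) ^ t)))"
    by (simp add: algebra_simps power_divide)
  finally have W: "real (cnt t ?W) \<le> 2 ^ t * (2 ^ e * (limit_cost c n + 3 * (1/2) ^ t))" by linarith
  have "2 ^ (t - L) * cnt L (V e n) = cnt t (\<lambda>bs. V e n (take L bs))" using cnt_lift'[of L t "V e n"] assms(1) by simp
  also have "\<dots> \<le> cnt t (\<lambda>bs. (?E t bs \<and> \<not> ?E n bs) \<or> ?W bs)" by (rule cnt_mono) (rule split)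
  also have "\<dots> \<le> cnt t (\<lambda>bs. ?E t bs \<and> \<not> ?E n bs) + cnt t ?W" by (rule cnt_disj)
  finally have "real (2 ^ (t - L) * cnt L (V e n)) \<le> real (cnt t (\<lambda>bs. ?E t bs \<and> \<not> ?E n bs) + cnt t ?W)"
    by (rule of_nat_mono)
  then have "2 ^ (t - L) * real (cnt L (V e n)) \<le> 2 ^ t * (al e t - al e n + 2 ^ e * (limit_cost c n + 3 * (1/2) ^ t))"
    using E W by (simp add: distrib_left)
  also have "(2::real) ^ t = 2 ^ (t - L) * 2 ^ L" using assms(1) by (simp flip: power_add)
  finally show ?thesis by (simp add: mult.assoc)
qed

lemma bounded_test_V: "bounded_test c (V e)"
  unfolding bounded_test_def
proof (intro conjI allI)
  show "unif_ce (V e)"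
    unfolding V_def by (intro unif_ce_decidable cpt_intros cpt_watched cpt_As)
  have "V e (Suc n) bs \<Longrightarrow> V e n bs" for n bs by (simp add: V_def)
  then show "open_gen (V e (Suc n)) \<subseteq> open_gen (V e n)" for n
    unfolding open_gen_def by blast
  have "mono (\<lambda>s. real (errs e s) / 2 ^ s)" "\<And>s. real (errs e s) / 2 ^ s \<le> 1"
    using al_mono[of _ _ e] al_bounds(2)[of e] by (auto simp: al_def mono_def)
  from growth[OF cpt_errs this] obtain K where K: "\<And>n m. al e m - al e n \<le> K * limit_cost c n"
    unfolding al_def by blast
  \<comment> \<open>\<open>K\<close> accounts for the errors and \<open>2 ^ e\<close> for the
    watched strings; the further factor 2 absorbs the term \<open>3 * (1/2) ^ t\<close>, which drops
    below the positive limit cost.\<close>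
  have "mu_open (V e n) \<le> (K + 2 ^ Suc e) * limit_cost c n" for n
  proof (rule mu_open_le)
    fix L
    obtain s0 where s0: "\<forall>s\<in>{s. act s \<and> qq s = prod_encode (e, n)}. s < s0"
      using finite_acts by (rule finite_nat_boundE)
    have "(\<lambda>t. 3 * (1/2::real) ^ t) \<longlonglongrightarrow> 3 * 0" by (intro tendsto_intros LIMSEQ_realpow_zero) auto
    then have "\<forall>\<^sub>F t in sequentially. 3 * (1/2) ^ t < limit_cost c n" using pos[of n] by (intro order_tendstoD(2)) auto
    then obtain t0 where t0: "\<forall>t\<ge>t0. 3 * (1/2) ^ t < limit_cost c n" by (rule eventually_sequentiallyE)
    define N where "N = max (max L n) (max s0 t0)"
    \<comment> \<open>A stage beyond \<open>N\<close> that attends to \<open>(e, n)\<close>, hence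
      one after the last action for this pair.\<close>
    define t where "t = prod_encode (prod_encode (e, n), N)"
    have "N \<le> t" unfolding t_def by (rule le_prod_encode_2)
    have q: "qq t = prod_encode (e, n)" by (simp add: t_def qq_def)
    have "\<not> act t" using s0 q \<open>N \<le> t\<close> by (auto simp: N_def)
    have "real (gen_cnt (V e n) L) = real (cnt L (V e n))" using gen_cnt_upward[of "V e n" L] V_up by metis
    also have "\<dots> \<le> 2 ^ L * (al e t - al e n + 2 ^ e * (limit_cost c n + 3 * (1/2) ^ t))"
      using \<open>N \<le> t\<close> q \<open>\<not> act t\<close> by (intro V_cnt) (auto simp: N_def)
    also have "\<dots> \<le> 2 ^ L * (K * limit_cost c n + 2 ^ e * (limit_cost c n + limit_cost c n))"
      using K t0 \<open>N \<le> t\<close> by (intro mult_left_mono add_mono) (auto simp: N_def less_imp_le)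
    also have "\<dots> = (K + 2 ^ Suc e) * limit_cost c n * 2 ^ L" by (simp add: algebra_simps)
    finally show "real (gen_cnt (V e n) L) \<le> (K + 2 ^ Suc e) * limit_cost c n * 2 ^ L" .
  qed
  then show "\<exists>C. \<forall>n. mu_open (V e n) \<le> C * limit_cost c n" by blast
qed

text \<open>A program that computes \<open>A\<close> from \<open>Y\<close> never errs, and as the
  marker settles, it is eventually seen to be correct up to the marker.\<close>

lemma turing_le_captured:
  assumes "turing_le A Y" shows "captured c Y"
proof -
  obtain p where p: "\<And>x. ev Y p [x] (of_bool (x \<in> A))"
    using assms unfolding turing_le_def of_bool_def by blast
  define e where "e = code p"
  have watch: "\<exists>s\<ge>m. watched s (As s) (prod_encode (e, m)) (pre Y s)" for m
  proof -
    let ?q = "prod_encode (e, m)"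
    obtain s0 where s0: "\<forall>s\<ge>s0. marker (As s) ?q = marker (As s0) ?q" using marker_stable by blast
    define k where "k = marker (As s0) ?q"
    have "\<forall>\<^sub>F s in sequentially. \<forall>z\<in>{..k}. (z \<in> set (As s)) = (z \<in> A)"
      by (rule eventually_ball_finite)
        (use approx in \<open>auto simp: computable_approx_def eventually_sequentially\<close>)
    moreover have "\<forall>\<^sub>F s in sequentially. \<forall>z\<in>{..k}. Phi s (pre Y s) p [z] (of_bool (z \<in> A))"
    proof (rule eventually_ball_finite)
      show "\<forall>z\<in>{..k}. \<forall>\<^sub>F s in sequentially. Phi s (pre Y s) p [z] (of_bool (z \<in> A))"
      proof
        fix z
        obtain N where "\<forall>s\<ge>N. \<forall>bs. N \<le> length bs \<longrightarrow> extends Y bs \<longrightarrow> Phi s bs p [z] (of_bool (z \<in> A))"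
          using Phi_complete[OF p[of z]] by (elim exE)
        then show "\<forall>\<^sub>F s in sequentially. Phi s (pre Y s) p [z] (of_bool (z \<in> A))"
          unfolding eventually_sequentially by (intro exI[of _ N]) simp
      qed
    qed simp
    ultimately have "\<forall>\<^sub>F s in sequentially. (\<forall>z\<in>{..k}. (z \<in> set (As s)) = (z \<in> A))
        \<and> (\<forall>z\<in>{..k}. Phi s (pre Y s) p [z] (of_bool (z \<in> A))) \<and> s0 \<le> s \<and> m \<le> s"
      by (intro eventually_conj eventually_ge_at_top)
    then obtain s where s: "\<forall>z\<in>{..k}. (z \<in> set (As s)) = (z \<in> A)"
        "\<forall>z\<in>{..k}. Phi s (pre Y s) p [z] (of_bool (z \<in> A))" "s0 \<le> s" "m \<le> s"
      using eventually_happens'[OF sequentially_bot] by blast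
    have "marker (As s) ?q = k" using s0 s(3) unfolding k_def by blast
    then have "correct s (As s) ?q (pre Y s)" using s(1,2) by (simp add: correct_def e_def)
    moreover have "\<not> err s (As s) e (pre Y s)"
    proof
      assume "err s (As s) e (pre Y s)"
      then obtain z where z: "z \<in> set (As s)" "Phi s (pre Y s) p [z] 0" unfolding err_def e_def by auto
      have "z \<in> A" using z(1) unfolding A_def by blast
      moreover have "ev Y p [z] 0" using Phi_sound[OF extends_pre z(2)] .
      then have "of_bool (z \<in> A) = (0 :: nat)" by (rule ev_det[OF p])
      ultimately show False by simp
    qed
    ultimately show ?thesis using s(4) unfolding watched_def by auto
  qed
  have "Y \<in> open_gen (V e n)" for n
  proof -
    obtain g where g: "\<And>m. m \<le> g m" "\<And>m. watched (g m) (As (g m)) (prod_encode (e, m)) (pre Y (g m))"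
      using watch by metis
    define L where "L = Max (g ` {..n})"
    have gL: "g m \<le> L" if "m \<le> n" for m unfolding L_def using that by (intro Max_ge) auto
    have "V e n (pre Y L)"
      unfolding V_def
    proof (intro allI impI)
      fix m assume "m \<le> n"
      then show "\<exists>s\<le>length (pre Y L). m \<le> s \<and> watched s (As s) (prod_encode (e, m)) (take s (pre Y L))"
        using g[of m] gL[of m] by (intro exI[of _ "g m"]) simp
    qed
    then show ?thesis unfolding open_gen_def using extends_pre by blast
  qed
  then show ?thesis unfolding captured_def using bounded_test_V by blast
qed

lemma exists_smart:
  "\<exists>A. ce_set A \<and> obeys A c \<and> (\<forall>Y. mlr_random Y \<longrightarrow> (captured c Y \<longleftrightarrow> turing_le A Y))"
  using ce obeys_c turing_le_captured obeys_captured_turing_le[OF c pos obeys_c] by blast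

end

theorem theorem3p3:
  fixes c :: "nat \<Rightarrow> nat \<Rightarrow> real" and Omega :: real and Om :: "nat \<Rightarrow> real"
  assumes "computable_rat_seq Om" and "mono Om" and "Om \<longlonglongrightarrow> Omega"
    and "0 < Omega" and "Omega < 1" and "mlr_random (bin_expansion Omega)"
    and "cost_function c"
    and "cost_implies c (c_Omega Om)"
  shows "\<exists>A. ce_set A \<and> smart_for Om c A"
proof -
  obtain h where h: "computable1 h" "\<And>s. Om s = rat_of_code (h s)"
    using assms(1) unfolding computable_rat_seq_def by blast
  \<comment> \<open>\<open>Om\<close> may begin with negative rationals; truncation at 0 suits
    \<open>floor_code\<close>, keeps the limit and does not increase the cost.\<close>
  define Op where "Op s = max 0 (Om s)" for s
  define w where "w s k = floor_code (h s) k" for s k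
  have w_cpt: "cpt no_oracle (\<lambda>p. w (fst p) (snd p))"
    unfolding w_def by (intro cpt_intros cpt_o[OF computable1D[OF h(1)]])
  have w: "real (w s k) \<le> Op s * 2 ^ k" "Op s * 2 ^ k < real (w s k) + 1" for s k
    using floor_code[of "h s" k] by (simp_all add: w_def Op_def h(2))
  have Op_mono: "mono Op" using assms(2) unfolding Op_def mono_def by (meson max.mono order_refl)
  have "Op \<longlonglongrightarrow> max 0 Omega" unfolding Op_def by (intro tendsto_intros assms(3))
  then have Op_lim: "Op \<longlonglongrightarrow> Omega" using assms(4) by (simp add: max_def)
  have Op_le: "Op s \<le> Omega" for s using Op_mono Op_lim by (simp add: incseq_le mono_def incseq_def)
  have Op_ge: "0 \<le> Op s" for s by (simp add: Op_def)
  have KS: "\<exists>K>0. \<forall>n m. real (a m) / 2 ^ m - real (a n) / 2 ^ n \<le> K * (Omega - Op n)"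
    if "cpt no_oracle a" "mono (\<lambda>s. real (a s) / 2 ^ s)" "\<And>s. real (a s) / 2 ^ s \<le> 1" for a
    by (rule random_left_ce_dominates[OF w_cpt that(1) w Op_mono Op_lim assms(4-6) that(2,3)])

  \<comment> \<open>The domination is applied to \<open>1 - (1/2) ^ s\<close>, which strictly
    increases; so the gap \<open>Omega - Op n\<close> has to be positive.\<close>
  have Op_less: "Op n < Omega" for n
  proof -
    let ?a = "\<lambda>s. 2 ^ s - 1 :: nat"
    have a: "real (?a s) / 2 ^ s = 1 - (1/2) ^ s" for s by (simp add: of_nat_diff diff_divide_distrib power_divide)
    have "cpt no_oracle ?a" by (intro cpt_intros)
    moreover have "mono (\<lambda>s. real (?a s) / 2 ^ s)" unfolding a mono_def by (simp add: power_decreasing)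
    moreover have "real (?a s) / 2 ^ s \<le> 1" for s unfolding a by simp
    ultimately obtain K where K: "0 < K" "\<And>n m. real (?a m) / 2 ^ m - real (?a n) / 2 ^ n \<le> K * (Omega - Op n)"
      using KS[of ?a] by blast
    have "(1/2::real) ^ Suc n < (1/2) ^ n" by simp
    then have "0 < K * (Omega - Op n)" using K(2)[of "Suc n" n] unfolding a by linarith
    then show ?thesis using K(1) by (simp add: zero_less_mult_iff)
  qed

  obtain l where l: "dyadic_lower l c"
    using dyadic_lower_exists[of c] assms(7) by (auto simp: cost_function_def)
  define d where "d = c_Omega Op"
  \<comment> \<open>Both values are rounded down with denominator \<open>2 ^ s\<close>; subtracting
    1 compensates for the rounding of the subtracted one.\<close>
  define ld where "ld x s = (if x < s then w s s - w x s - 1 else 0)" for x s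
  have ld: "dyadic_lower ld d" unfolding dyadic_lower_def
  proof (intro conjI allI)
    show "cpt no_oracle (\<lambda>p. ld (fst p) (snd p))"
      unfolding ld_def by (intro cpt_intros cpt_2[OF w_cpt])
    fix x s
    have "real (ld x s) \<le> 2 ^ s * d x s \<and> 2 ^ s * d x s \<le> real (ld x s) + 3"
    proof (cases "x < s")
      case True
      then have "Op x \<le> Op s" using Op_mono by (simp add: mono_def)
      then have "Op x * 2 ^ s \<le> Op s * 2 ^ s" by (intro mult_right_mono) auto
      moreover have "2 ^ s * d x s = Op s * 2 ^ s - Op x * 2 ^ s"
        using True by (simp add: d_def c_Omega_def algebra_simps)
      moreover have "real (ld x s) = max 0 (real (w s s) - real (w x s) - 1)" using True by (simp add: ld_def)
      ultimately show ?thesis using w[of s s] w[of x s] by linarith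
    next
      case False then show ?thesis by (simp add: ld_def d_def c_Omega_def)
    qed
    then show "real (ld x s) \<le> 2 ^ s * d x s" "2 ^ s * d x s \<le> real (ld x s) + 3" by blast+
  qed
  have obeys_d: "obeys A d" if "obeys A c" for A
  proof -
    obtain As where As: "computable_approx As A" "summable (cost_term (c_Omega Om) As)"
      using assms(8) \<open>obeys A c\<close> unfolding cost_implies_def obeys_def by blast
    have "0 \<le> d x s \<and> d x s \<le> c_Omega Om x s" for x s
    proof (cases "x < s")
      case True
      then have "Om x \<le> Om s" using assms(2) by (simp add: mono_def)
      then show ?thesis using True by (auto simp: d_def c_Omega_def Op_def)
    next
      case False then show ?thesis by (simp add: d_def c_Omega_def)
    qed
    then have le: "norm (cost_term d As s) \<le> cost_term (c_Omega Om) As s" for s by (simp add: cost_term_def)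
    have "summable (cost_term d As)" by (rule summable_comparison_test'[OF As(2), of 0]) (rule le)
    then show ?thesis using As(1) unfolding obeys_def by blast
  qed
  have Op_mono': "s \<le> s' \<Longrightarrow> Op s \<le> Op s'" for s s' using Op_mono by (simp add: mono_def)
  have "\<exists>K. \<forall>x. Omega - Op x \<le> K * limit_cost c x"
  proof (rule cost_domination[OF assms(7) l ld])
    fix x x' s s' :: nat
    show "s \<le> s' \<Longrightarrow> d x s \<le> d x s'" using Op_mono'[of s s'] Op_mono'[of x s'] by (auto simp: d_def c_Omega_def)
    show "x \<le> x' \<Longrightarrow> d x' s \<le> d x s" using Op_mono'[of x x'] Op_mono'[of x s] by (auto simp: d_def c_Omega_def)
    show "0 \<le> d x s" using Op_mono'[of x s] by (auto simp: d_def c_Omega_def)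
    show "d x s \<le> 1" using Op_le[of s] Op_ge[of x] assms(5) by (auto simp: d_def c_Omega_def)
    show "d x \<longlonglongrightarrow> Omega - Op x"
    proof (rule Lim_transform_eventually)
      show "(\<lambda>s. Op s - Op x) \<longlonglongrightarrow> Omega - Op x" by (intro tendsto_intros Op_lim)
      show "\<forall>\<^sub>F s in sequentially. Op s - Op x = d x s"
        unfolding eventually_sequentially by (intro exI[of _ "Suc x"]) (auto simp: d_def c_Omega_def)
    qed
    show "0 < Omega - Op x" using Op_less by simp
  qed (rule obeys_d)
  then obtain K where K: "\<And>x. Omega - Op x \<le> K * limit_cost c x" by blast
  have pos: "0 < limit_cost c x" for x
    using K[of x] Op_less[of x] limit_cost_upper(2)[OF assms(7), of x] by (cases "limit_cost c x = 0") auto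
  \<comment> \<open>The assumption \<open>growth\<close> joins the two dominations: increases of
    \<open>a s / 2 ^ s\<close> are bounded by tails of \<Omega>, and these by the limit
    cost.\<close>
  have "smart_construction c l"
  proof (unfold_locales)
    fix a assume a: "cpt no_oracle a" "mono (\<lambda>s. real (a s) / 2 ^ s)" "\<And>s. real (a s) / 2 ^ s \<le> 1"
    obtain K' where K': "0 < K'" "\<And>n m. real (a m) / 2 ^ m - real (a n) / 2 ^ n \<le> K' * (Omega - Op n)"
      using KS[OF a] by blast
    have "real (a m) / 2 ^ m - real (a n) / 2 ^ n \<le> (K' * K) * limit_cost c n" for n m
    proof -
      have "K' * (Omega - Op n) \<le> K' * (K * limit_cost c n)" using K K'(1) by (intro mult_left_mono) auto
      then show ?thesis using K'(2)[of m n] by (simp add: mult.assoc)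
    qed
    then show "\<exists>K. \<forall>n m. real (a m) / 2 ^ m - real (a n) / 2 ^ n \<le> K * limit_cost c n" by blast
  qed (fact assms(7) l pos)+
  from smart_construction.exists_smart[OF this] obtain A where
    A: "ce_set A" "obeys A c" "\<forall>Y. mlr_random Y \<longrightarrow> (captured c Y \<longleftrightarrow> turing_le A Y)" by blast
  moreover have "obeys A (c_Omega Om)" using A(2) assms(8) unfolding cost_implies_def by blast
  ultimately show ?thesis unfolding smart_for_def by blast
qed

end
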